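(* Let $\gamma>1$ and $r\in\mathcal{I}_0=(-1,2\gamma-1)$. The operator $\mathbf{A}^{\mu_r}:=\mathbf{L}^{( *,\mu_r)}-\mathbf{L}$ on $L^2(M_\gamma,\mu_r)$ admits an orthogonal basis of eigenfunctions and its spectrum is given by $$\{0\}\cup\Big\{\pm i\sqrt{C_{\mu_r}(\gamma,k)-1}:k=0,1,2,\dots\Big\},$$ where $$C_{\mu_r}(\gamma,k)=\frac{\Gamma\big(\frac{2k+1+r}{\gamma}\big)\,\Gamma\big(2k+2-\frac{2k+1+r}{\gamma}\big)}{\Gamma(k+1)^2}\Big(\frac{\gamma}{2}\Big)^{2k+2}(\gamma-1)^{-\left(2k+2-\frac{2k+1+r}{\gamma}\right)}.$$
   Context: For $\gamma>1$ let $M_\gamma=\{(\zeta_1,\zeta_2)\in\mathbb{C}^2:\operatorname{Im}\zeta_2=|\zeta_1|^\gamma\}$, parametrized up to a null set by $(s,\alpha,\theta)\in\mathbb{R}\times(0,\infty)\times[0,2\pi)$ via $\zeta=(\alpha e^{i\theta},\,s+i\alpha^\gamma)$. For $r\in\mathbb{R}$, $\mu_r$ is the measure $\alpha^{r}\,ds\,d\alpha\,d\theta$ on $M_\gamma$. Each $f\in L^2(M_\gamma,\mu_r)$ has a partial Fourier expansion $f=\sum_{k\in\mathbb{Z}}f_k(s,\alpha)e^{ik\theta}$. The Leray transform of $M_\gamma$ is formally $$\mathbf{L}f(z)=\frac{\gamma^2}{8\pi^2 i}\int_{M_\gamma}f(\zeta)\frac{|\zeta_1|^{\gamma-2}\,d\zeta_2\wedge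 d\bar\zeta_1\wedge d\zeta_1}{[\gamma\bar\zeta_1|\zeta_1|^{\gamma-2}(\zeta_1-z_1)+i(\zeta_2-z_2)]^2};$$ for $z=(\alpha_ze^{i\theta_z},s_z+i\alpha_z^\gamma)\in M_\gamma$ it is understood as $\mathbf{L}f=\sum_{k\ge0}\mathbf{L}_kf$, where, with $A=(\gamma-1)\alpha_\zeta^\gamma+\alpha_z^\gamma+i(s_\zeta-s_z)$ and $B=\gamma\alpha_z\alpha_\zeta^{\gamma-1}$, $$\mathbf{L}_kf(s_z,\alpha_z,\theta_z)=e^{ik\theta_z}\,\frac{\gamma^2(k+1)}{2\pi}\int_0^\infty\!\int_{-\infty}^\infty\frac{B^k}{A^{k+2}}f_k(s_\zeta,\alpha_\zeta)\,\alpha_\zeta^{\gamma-1}\,ds_\zeta\,d\alpha_\zeta .$$ For $r\in(-1,2\gamma-1)$, $\mathbf{L}$ is a bounded operator on $L^2(M_\gamma,\mu_r)$, and $\mathbf{L}^{( *,\mu_r)}$ denotes its Hilbert space adjoint with respect to $\langle f,g\rangle_{\mu_r}=\int_{M_\gamma}f\bar g\,d\mu_r$.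
   Formalization: The displayed set is shown to be exactly the set of eigenvalues, and the spectrum is shown to be its closure; the displayed set is not closed in general (e.g. γ=3, r=0, where C tends to 3/(2√2) without attaining it), so it cannot always equal the spectrum. *)

theory Defs
  imports "HOL-Analysis.Analysis"
begin

text \<open>
  The space \<open>L\<^sup>2(M)\<close> of complex-valued functions is represented by its representatives; every
  notion below is invariant under equality almost everywhere, and equations between elements of
  \<open>L\<^sup>2(M)\<close> are stated almost everywhere.
\<close>

definition L2 :: "'a measure \<Rightarrow> ('a \<Rightarrow> complex) set" where
  "L2 M = {f \<in> borel_measurable M. integrable M (\<lambda>x. (cmod (f x))\<^sup>2)}"

definition l2_inner :: "'a measure \<Rightarrow> ('a \<Rightarrow> complex) \<Rightarrow> ('a \<Rightarrow> complex) \<Rightarrow> complex" where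
  "l2_inner M f g = (LINT x|M. f x * cnj (g x))"

definition l2_norm :: "'a measure \<Rightarrow> ('a \<Rightarrow> complex) \<Rightarrow> real" where
  "l2_norm M f = sqrt (LINT x|M. (cmod (f x))\<^sup>2)"

text \<open>
  Membership of the terms and of the limit is part of the definition, because \<open>l2_norm\<close> takes the
  junk value \<open>0\<close> outside \<open>L2 M\<close>.
\<close>

definition l2_sums :: "'a measure \<Rightarrow> (nat \<Rightarrow> 'a \<Rightarrow> complex) \<Rightarrow> ('a \<Rightarrow> complex) \<Rightarrow> bool" where
  "l2_sums M F g \<longleftrightarrow> (\<forall>k. F k \<in> L2 M) \<and> g \<in> L2 M \<and>
     (\<lambda>n. l2_norm M (\<lambda>x. (\<Sum>k<n. F k x) - g x)) \<longlonglongrightarrow> 0"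

definition l2_bounded_operator ::
  "'a measure \<Rightarrow> (('a \<Rightarrow> complex) \<Rightarrow> 'a \<Rightarrow> complex) \<Rightarrow> bool" where
  "l2_bounded_operator M T \<longleftrightarrow>
     (\<forall>f\<in>L2 M. T f \<in> L2 M) \<and>
     (\<forall>f\<in>L2 M. \<forall>g\<in>L2 M. AE x in M. T (\<lambda>y. f y + g y) x = T f x + T g x) \<and>
     (\<forall>c. \<forall>f\<in>L2 M. AE x in M. T (\<lambda>y. c * f y) x = c * T f x) \<and>
     (\<exists>K. \<forall>f\<in>L2 M. l2_norm M (T f) \<le> K * l2_norm M f)"

text \<open>The adjoint; for bounded \<open>T\<close> the chosen value exists and is unique almost everywhere.\<close>

definition l2_adjoint ::
  "'a measure \<Rightarrow> (('a \<Rightarrow> complex) \<Rightarrow> 'a \<Rightarrow> complex) \<Rightarrow> ('a \<Rightarrow> complex) \<Rightarrow> 'a \<Rightarrow> complex" where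
  "l2_adjoint M T f =
     (SOME g. g \<in> L2 M \<and> (\<forall>h\<in>L2 M. l2_inner M (T h) f = l2_inner M h g))"

definition l2_eigenfunction ::
  "'a measure \<Rightarrow> (('a \<Rightarrow> complex) \<Rightarrow> 'a \<Rightarrow> complex) \<Rightarrow> complex \<Rightarrow> ('a \<Rightarrow> complex) \<Rightarrow> bool" where
  "l2_eigenfunction M T c f \<longleftrightarrow>
     f \<in> L2 M \<and> \<not> (AE x in M. f x = 0) \<and> (AE x in M. T f x = c * f x)"

definition l2_point_spectrum ::
  "'a measure \<Rightarrow> (('a \<Rightarrow> complex) \<Rightarrow> 'a \<Rightarrow> complex) \<Rightarrow> complex set" where
  "l2_point_spectrum M T = {c. \<exists>f. l2_eigenfunction M T c f}"

text \<open>The complement of the set of \<open>c\<close> for which \<open>T - c\<close> has a bounded two-sided inverse.\<close>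

definition l2_spectrum ::
  "'a measure \<Rightarrow> (('a \<Rightarrow> complex) \<Rightarrow> 'a \<Rightarrow> complex) \<Rightarrow> complex set" where
  "l2_spectrum M T = {c. \<not> (\<exists>R. l2_bounded_operator M R \<and>
     (\<forall>f\<in>L2 M. (AE x in M. T (R f) x - c * R f x = f x) \<and>
                (AE x in M. R (\<lambda>y. T f y - c * f y) x = f x)))}"

text \<open>A set of pairwise orthogonal nonzero elements whose linear span is dense.\<close>

definition l2_orthogonal_basis :: "'a measure \<Rightarrow> ('a \<Rightarrow> complex) set \<Rightarrow> bool" where
  "l2_orthogonal_basis M E \<longleftrightarrow>
     E \<subseteq> L2 M \<and>
     (\<forall>e\<in>E. \<not> (AE x in M. e x = 0)) \<and>
     (\<forall>e\<in>E. \<forall>e'\<in>E. e \<noteq> e' \<longrightarrow> l2_inner M e e' = 0) \<and>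
     (\<forall>f\<in>L2 M. \<forall>\<epsilon>>0. \<exists>F c. finite F \<and> F \<subseteq> E \<and>
        l2_norm M (\<lambda>x. f x - (\<Sum>e\<in>F. c e * e x)) < \<epsilon>)"

definition hypersurface :: "real \<Rightarrow> (complex \<times> complex) set" where
  "hypersurface \<gamma> = {\<zeta>. Im (snd \<zeta>) = cmod (fst \<zeta>) powr \<gamma>}"

definition hypersurface_param :: "real \<Rightarrow> real \<times> real \<times> real \<Rightarrow> complex \<times> complex" where
  "hypersurface_param \<gamma> = (\<lambda>(s, \<alpha>, \<theta>). (of_real \<alpha> * cis \<theta>, Complex s (\<alpha> powr \<gamma>)))"

text \<open>
  The measure \<open>\<alpha>\<^sup>r ds d\<alpha> d\<theta>\<close> carried over to the hypersurface by the parametrization; the omitted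
  points with vanishing first coordinate form a null set.
\<close>

definition mu :: "real \<Rightarrow> real \<Rightarrow> (complex \<times> complex) measure" where
  "mu \<gamma> r = distr
     (density (restrict_space lborel (UNIV \<times> {0<..} \<times> {0..<2*pi}))
        (\<lambda>(s, \<alpha>, \<theta>). ennreal (\<alpha> powr r)))
     (restrict_space borel (hypersurface \<gamma>))
     (hypersurface_param \<gamma>)"

definition fourier_coeff ::
  "real \<Rightarrow> (complex \<times> complex \<Rightarrow> complex) \<Rightarrow> int \<Rightarrow> real \<Rightarrow> real \<Rightarrow> complex" where
  "fourier_coeff \<gamma> f k s \<alpha> = 1 / (2 * of_real pi) *
     (LBINT \<theta>:{0..<2*pi}. f (hypersurface_param \<gamma> (s, \<alpha>, \<theta>)) * cis (- (of_int k * \<theta>)))"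

definition leray_mode ::
  "real \<Rightarrow> nat \<Rightarrow> (complex \<times> complex \<Rightarrow> complex) \<Rightarrow> complex \<times> complex \<Rightarrow> complex" where
  "leray_mode \<gamma> k f z =
     (let s\<^sub>z = Re (snd z); \<alpha>\<^sub>z = cmod (fst z); \<theta>\<^sub>z = Arg (fst z);
          A = (\<lambda>s \<alpha>. Complex ((\<gamma> - 1) * \<alpha> powr \<gamma> + \<alpha>\<^sub>z powr \<gamma>) (s - s\<^sub>z));
          B = (\<lambda>\<alpha>. \<gamma> * \<alpha>\<^sub>z * \<alpha> powr (\<gamma> - 1))
      in cis (real k * \<theta>\<^sub>z) * of_real (\<gamma>\<^sup>2 * (real k + 1) / (2 * pi)) *
         (LBINT \<alpha>:{0<..}. LBINT s.
            of_real (B \<alpha>) ^ k / A s \<alpha> ^ (k + 2) * fourier_coeff \<gamma> f (int k) s \<alpha>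
              * of_real (\<alpha> powr (\<gamma> - 1))))"

text \<open>
  The sum over the modes is taken in \<open>L\<^sup>2\<close>; the chosen value is unique almost everywhere.  The
  parameter \<open>r\<close> only enters through the norm in which the series converges.
\<close>

definition leray ::
  "real \<Rightarrow> real \<Rightarrow> (complex \<times> complex \<Rightarrow> complex) \<Rightarrow> complex \<times> complex \<Rightarrow> complex" where
  "leray \<gamma> r f = (SOME g. l2_sums (mu \<gamma> r) (\<lambda>k. leray_mode \<gamma> k f) g)"

definition leray_skew ::
  "real \<Rightarrow> real \<Rightarrow> (complex \<times> complex \<Rightarrow> complex) \<Rightarrow> complex \<times> complex \<Rightarrow> complex" where
  "leray_skew \<gamma> r f = (\<lambda>z. l2_adjoint (mu \<gamma> r) (leray \<gamma> r) f z - leray \<gamma> r f z)"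

definition leray_C :: "real \<Rightarrow> real \<Rightarrow> nat \<Rightarrow> real" where
  "leray_C r \<gamma> k =
     Gamma ((2 * real k + 1 + r) / \<gamma>) * Gamma (2 * real k + 2 - (2 * real k + 1 + r) / \<gamma>)
       / (Gamma (real k + 1))\<^sup>2
     * (\<gamma> / 2) ^ (2 * k + 2)
     * (\<gamma> - 1) powr (- (2 * real k + 2 - (2 * real k + 1 + r) / \<gamma>))"

end

theory Submission
  imports Defs "HOL-Real_Asymp.Real_Asymp"
begin

text \<open>
  The Leray transform is the sum of its modes \<open>\<^bold>L\<^sub>k f = e\<^bsup>i k \<theta>\<^esup> T\<^sub>k f\<^sub>k\<close>, \<open>k \<ge> 0\<close>, where \<open>f\<^sub>k\<close> is a Fourier
  coefficient of \<open>f\<close> and \<open>T\<^sub>k\<close> is an integral operator in the variables \<open>(\<alpha>, s)\<close>. Each mode is an oblique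
  projection \<open>P\<close> that satisfies \<open>P\<^sup>2 = P\<close> and \<open>P P\<^sup>* P = C P\<close> with \<open>C = C\<^bsub>\<mu>\<^sub>r\<^esub>(\<gamma>, k)\<close>, and modes with different \<open>k\<close> act on
  orthogonal subspaces. The reason is that after a Fourier transform in \<open>s\<close> the operator \<open>T\<^sub>k\<close> becomes a family of rank-one
  projections in \<open>\<alpha>\<close>, one for each positive frequency, and dilations identify all members of the family, so that they have the same
  norm.

  These two identities determine the spectrum. Expanding the product shows that \<open>D = P\<^sup>* - P\<close> satisfies
  \<open>D\<^sup>3 = - (C - 1) D\<close> (lemma \<open>D_cube\<close>), so that \<open>D\<close> has no eigenvalues except \<open>0\<close> and \<open>\<plusminus> i (C - 1)\<^sup>1\<^sup>/\<^sup>2\<close>, the function space is the sum of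
  their eigenspaces, and \<open>(D - c)\<^sup>-\<^sup>1\<close> is a quadratic polynomial in \<open>D\<close>. In the direct sum over \<open>k\<close> one obtains the point
  spectrum, an orthogonal basis of eigenfunctions, and for \<open>c\<close> at positive distance from the point
  spectrum a resolvent. This argument is carried out for abstract operators in the locale
  \<open>oblique_projections\<close>.

  The identities for \<open>T\<^sub>k\<close> are verified on the kernels, without the Fourier transform in \<open>s\<close>. The kernel is a product of
  powers of the radial variables and of \<open>1 / A\<^bsup>k + 2\<^esup>\<close> with \<open>A = \<alpha>\<^sub>z\<^sup>\<gamma> + (\<gamma> - 1) \<alpha>\<^sub>\<zeta>\<^sup>\<gamma> + i (s\<^sub>\<zeta> - s\<^sub>z)\<close>. Partial fractions show that
  the integral over \<open>s\<close> of a product of two such inverse powers is again an inverse power of the sum of the bases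
  (lemma \<open>integral_power_product\<close>). The radial integrals that remain are integrals of \<open>1 / (X + W)\<^sup>N\<close>,
  with \<open>X\<close> complex and \<open>W\<close> a combination of \<open>\<gamma>\<close>-th powers; the Laplace representation of the
  inverse power reduces them to Gamma integrals (lemma \<open>integral_complex_inverse_power\<close>). Lemmas
  \<open>mode_kernel_idempotent\<close> and \<open>mode_kernel_triple\<close> are the result.

  The exchanges of integrals are justified by Schur's test with a power of \<open>\<alpha>\<close> as weight, which applies for every \<open>r\<close> in
  the given interval (lemma \<open>mode_kernel_schur\<close>). It bounds each mode with some constant. Then
  \<open>P P\<^sup>* P = C P\<close> gives the norm \<open>C\<^sup>1\<^sup>/\<^sup>2\<close>, and Stirling's formula bounds \<open>C\<close> uniformly in
  \<open>k\<close> (lemma \<open>leray_C_bounded\<close>), which makes the series of the modes converge.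
\<close>

section \<open>The space of square-integrable functions\<close>

lemma borel_measurable_cnj [measurable]: "cnj \<in> borel_measurable borel"
  by (intro borel_measurable_continuous_onI continuous_intros)

lemma L2_measurable: "f \<in> L2 M \<Longrightarrow> f \<in> borel_measurable M"
  by (simp add: L2_def)

lemma L2I_bounded:
  assumes "f \<in> borel_measurable M" "(\<integral>\<^sup>+x. ennreal ((cmod (f x))\<^sup>2) \<partial>M) < \<infinity>"
  shows "f \<in> L2 M"
  using assms unfolding L2_def by (auto intro!: integrableI_nonneg)

lemma L2_nn_integral_finite: "f \<in> L2 M \<Longrightarrow> (\<integral>\<^sup>+x. ennreal ((cmod (f x))\<^sup>2) \<partial>M) < \<infinity>"
  unfolding L2_def by (auto simp: integrable_iff_bounded)

lemma L2_zero [simp]: "(\<lambda>x. 0) \<in> L2 M"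
  by (simp add: L2_def)

lemma L2_cmult [intro]: "f \<in> L2 M \<Longrightarrow> (\<lambda>x. c * f x) \<in> L2 M"
  by (auto simp: L2_def norm_mult power_mult_distrib)

lemma L2_add [intro]:
  assumes "f \<in> L2 M" "g \<in> L2 M"
  shows "(\<lambda>x. f x + g x) \<in> L2 M"
proof -
  have [measurable]: "f \<in> borel_measurable M" "g \<in> borel_measurable M"
    using assms by (auto simp: L2_def)
  have "integrable M (\<lambda>x. (cmod (f x + g x))\<^sup>2)"
  proof (rule Bochner_Integration.integrable_bound)
    show "integrable M (\<lambda>x. 2 * (cmod (f x))\<^sup>2 + 2 * (cmod (g x))\<^sup>2)"
      using assms by (auto simp: L2_def)
    have "norm ((cmod (f x + g x))\<^sup>2) \<le> norm (2 * (cmod (f x))\<^sup>2 + 2 * (cmod (g x))\<^sup>2)" for x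
    proof -
      have "(cmod (f x + g x))\<^sup>2 \<le> (cmod (f x) + cmod (g x))\<^sup>2"
        by (intro power_mono norm_triangle_ineq) auto
      also have "\<dots> \<le> 2 * (cmod (f x))\<^sup>2 + 2 * (cmod (g x))\<^sup>2"
        using sum_squares_bound[of "cmod (f x)" "cmod (g x)"] by (simp add: power2_sum)
      finally show ?thesis by simp
    qed
    then show "AE x in M. norm ((cmod (f x + g x))\<^sup>2)
        \<le> norm (2 * (cmod (f x))\<^sup>2 + 2 * (cmod (g x))\<^sup>2)" by simp
  qed auto
  then show ?thesis by (auto simp: L2_def)
qed

lemma L2_uminus [intro]: "f \<in> L2 M \<Longrightarrow> (\<lambda>x. - f x) \<in> L2 M"
  using L2_cmult[of f M "-1"] by simp

lemma L2_diff [intro]: "f \<in> L2 M \<Longrightarrow> g \<in> L2 M \<Longrightarrow> (\<lambda>x. f x - g x) \<in> L2 M"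
  using L2_add[of f M "\<lambda>x. - g x"] L2_uminus[of g M] by simp

lemma L2_sum [intro]:
  assumes "\<And>i. i \<in> I \<Longrightarrow> F i \<in> L2 M"
  shows "(\<lambda>x. \<Sum>i\<in>I. F i x) \<in> L2 M"
  using assms by (induction I rule: infinite_finite_induct) auto

lemma L2_integrable_mult:
  assumes "f \<in> L2 M" "g \<in> L2 M"
  shows "integrable M (\<lambda>x. f x * cnj (g x))"
proof -
  have [measurable]: "f \<in> borel_measurable M" "g \<in> borel_measurable M"
    using assms by (auto simp: L2_def)
  show ?thesis
  proof (rule Bochner_Integration.integrable_bound)
    show "integrable M (\<lambda>x. (cmod (f x))\<^sup>2 + (cmod (g x))\<^sup>2)"
      using assms by (auto simp: L2_def)
    show "(\<lambda>x. f x * cnj (g x)) \<in> borel_measurable M"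
      by measurable
    have "norm (f x * cnj (g x)) \<le> norm ((cmod (f x))\<^sup>2 + (cmod (g x))\<^sup>2)" for x
    proof -
      have "0 \<le> cmod (f x) * cmod (g x)" by simp
      then have "cmod (f x) * cmod (g x) \<le> (cmod (f x))\<^sup>2 + (cmod (g x))\<^sup>2"
        using sum_squares_bound[of "cmod (f x)" "cmod (g x)"] by linarith
      then show ?thesis by (simp add: norm_mult)
    qed
    then show "AE x in M. norm (f x * cnj (g x)) \<le> norm ((cmod (f x))\<^sup>2 + (cmod (g x))\<^sup>2)"
      by simp
  qed
qed

lemma l2_inner_add_left:
  "\<lbrakk>f \<in> L2 M; f' \<in> L2 M; g \<in> L2 M\<rbrakk> \<Longrightarrow>
    l2_inner M (\<lambda>x. f x + f' x) g = l2_inner M f g + l2_inner M f' g"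
  by (simp add: l2_inner_def distrib_right L2_integrable_mult)

lemma l2_inner_cmult_left: "l2_inner M (\<lambda>x. c * f x) g = c * l2_inner M f g"
  by (simp add: l2_inner_def mult.assoc)

lemma l2_inner_diff_left:
  "\<lbrakk>f \<in> L2 M; f' \<in> L2 M; g \<in> L2 M\<rbrakk> \<Longrightarrow>
    l2_inner M (\<lambda>x. f x - f' x) g = l2_inner M f g - l2_inner M f' g"
  by (simp add: l2_inner_def left_diff_distrib L2_integrable_mult)

lemma l2_inner_zero_left [simp]: "l2_inner M (\<lambda>x. 0) g = 0"
  by (simp add: l2_inner_def)

lemma l2_inner_cnj: "cnj (l2_inner M f g) = l2_inner M g f"
  unfolding l2_inner_def by (subst Bochner_Integration.integral_cnj [symmetric]) (simp add: mult.commute)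

lemma l2_inner_zero_right [simp]: "l2_inner M f (\<lambda>x. 0) = 0"
  by (simp add: l2_inner_def)

lemma l2_inner_add_right:
  "\<lbrakk>f \<in> L2 M; g \<in> L2 M; g' \<in> L2 M\<rbrakk> \<Longrightarrow>
    l2_inner M f (\<lambda>x. g x + g' x) = l2_inner M f g + l2_inner M f g'"
  by (simp add: l2_inner_def distrib_left L2_integrable_mult)

lemma l2_inner_cmult_right: "l2_inner M f (\<lambda>x. c * g x) = cnj c * l2_inner M f g"
  by (simp add: l2_inner_def mult.left_commute)

lemma l2_inner_diff_right:
  "\<lbrakk>f \<in> L2 M; g \<in> L2 M; g' \<in> L2 M\<rbrakk> \<Longrightarrow>
    l2_inner M f (\<lambda>x. g x - g' x) = l2_inner M f g - l2_inner M f g'"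
  by (simp add: l2_inner_def right_diff_distrib L2_integrable_mult)

lemma l2_inner_sum_left:
  assumes "\<And>i. i \<in> I \<Longrightarrow> F i \<in> L2 M" "g \<in> L2 M"
  shows "l2_inner M (\<lambda>x. \<Sum>i\<in>I. F i x) g = (\<Sum>i\<in>I. l2_inner M (F i) g)"
  using assms
  by (induction I rule: infinite_finite_induct) (auto simp: l2_inner_add_left L2_sum)

lemma l2_inner_sum_right:
  assumes "\<And>i. i \<in> I \<Longrightarrow> F i \<in> L2 M" "g \<in> L2 M"
  shows "l2_inner M g (\<lambda>x. \<Sum>i\<in>I. F i x) = (\<Sum>i\<in>I. l2_inner M g (F i))"
  using assms
  by (induction I rule: infinite_finite_induct) (auto simp: l2_inner_add_right L2_sum)

lemma l2_norm_nonneg [simp]: "l2_norm M f \<ge> 0"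
  by (simp add: l2_norm_def)

lemma l2_norm_square: "(l2_norm M f)\<^sup>2 = (LINT x|M. (cmod (f x))\<^sup>2)"
  by (simp add: l2_norm_def)

lemma l2_inner_self: "l2_inner M f f = of_real ((l2_norm M f)\<^sup>2)"
  unfolding l2_norm_square l2_inner_def
  by (simp add: complex_norm_square [symmetric] del: of_real_power flip: integral_complex_of_real)

lemma l2_norm_nn_integral:
  assumes "f \<in> L2 M"
  shows "(\<integral>\<^sup>+x. ennreal ((cmod (f x))\<^sup>2) \<partial>M) = ennreal ((l2_norm M f)\<^sup>2)"
  using assms unfolding l2_norm_square by (intro nn_integral_eq_integral) (auto simp: L2_def)

lemma l2_inner_cong_AE:
  assumes "f \<in> L2 M" "g \<in> L2 M" "f' \<in> L2 M" "g' \<in> L2 M"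
    and "AE x in M. f x = f' x" "AE x in M. g x = g' x"
  shows "l2_inner M f g = l2_inner M f' g'"
  unfolding l2_inner_def
proof (rule integral_cong_AE)
  show "AE x in M. f x * cnj (g x) = f' x * cnj (g' x)"
    using assms(5,6) by eventually_elim simp
  have [measurable]: "f \<in> borel_measurable M" "g \<in> borel_measurable M"
    "f' \<in> borel_measurable M" "g' \<in> borel_measurable M"
    using assms by (auto simp: L2_def)
  show "(\<lambda>x. f x * cnj (g x)) \<in> borel_measurable M"
    "(\<lambda>x. f' x * cnj (g' x)) \<in> borel_measurable M" by measurable
qed

lemma l2_norm_cmult: "l2_norm M (\<lambda>x. c * f x) = cmod c * l2_norm M f"
  by (simp add: l2_norm_def norm_mult power_mult_distrib real_sqrt_mult)

lemma l2_norm_minus_commute: "l2_norm M (\<lambda>x. f x - g x) = l2_norm M (\<lambda>x. g x - f x)"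
  by (simp add: l2_norm_def norm_minus_commute)

lemma l2_norm_zero [simp]: "l2_norm M (\<lambda>x. 0) = 0"
  by (simp add: l2_norm_def)

lemma l2_norm_eq_0_iff:
  assumes "f \<in> L2 M"
  shows "l2_norm M f = 0 \<longleftrightarrow> (AE x in M. f x = 0)"
proof -
  have "l2_norm M f = 0 \<longleftrightarrow> (LINT x|M. (cmod (f x))\<^sup>2) = 0"
    by (simp add: l2_norm_def)
  also have "\<dots> \<longleftrightarrow> (AE x in M. (cmod (f x))\<^sup>2 = 0)"
    using assms by (intro integral_nonneg_eq_0_iff_AE) (auto simp: L2_def)
  finally show ?thesis by simp
qed

lemma l2_norm_diff_square:
  assumes "f \<in> L2 M" "g \<in> L2 M"
  shows "(l2_norm M (\<lambda>x. f x - g x))\<^sup>2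
    = (l2_norm M f)\<^sup>2 - 2 * Re (l2_inner M f g) + (l2_norm M g)\<^sup>2"
proof -
  have "complex_of_real ((l2_norm M (\<lambda>x. f x - g x))\<^sup>2)
      = l2_inner M f f - l2_inner M f g - l2_inner M g f + l2_inner M g g"
    unfolding l2_inner_self [symmetric]
    using assms by (simp add: l2_inner_diff_left l2_inner_diff_right L2_diff)
  from arg_cong[OF this, of Re] have "(l2_norm M (\<lambda>x. f x - g x))\<^sup>2 =
    (l2_norm M f)\<^sup>2 - Re (l2_inner M f g) - Re (l2_inner M g f) + (l2_norm M g)\<^sup>2"
    by (simp only: l2_inner_self Re_complex_of_real minus_complex.sel plus_complex.sel)
  moreover have "Re (l2_inner M g f) = Re (l2_inner M f g)"
    by (metis cnj.simps(1) l2_inner_cnj)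
  ultimately show ?thesis by simp
qed

lemma l2_Cauchy_Schwarz:
  assumes "f \<in> L2 M" "g \<in> L2 M"
  shows "cmod (l2_inner M f g) \<le> l2_norm M f * l2_norm M g"
proof -
  \<comment> \<open>The square of \<open>\<parallel>v\<parallel> u - \<parallel>u\<parallel> v\<close> is nonnegative; a unimodular factor then replaces the real part by the modulus.\<close>
  have main: "Re (l2_inner M u v) \<le> l2_norm M u * l2_norm M v"
    if u: "u \<in> L2 M" and v: "v \<in> L2 M" for u v
  proof (cases "l2_norm M u = 0 \<or> l2_norm M v = 0")
    case True
    then have "AE x in M. u x * cnj (v x) = 0"
    proof
      assume "l2_norm M u = 0"
      then have "AE x in M. u x = 0" using u l2_norm_eq_0_iff by blast
      then show ?thesis by eventually_elim simp
    next
      assume "l2_norm M v = 0"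
      then have "AE x in M. v x = 0" using v l2_norm_eq_0_iff by blast
      then show ?thesis by eventually_elim simp
    qed
    then have "l2_inner M u v = 0"
      unfolding l2_inner_def by (rule integral_eq_zero_AE)
    then show ?thesis by simp
  next
    case False
    define a where "a = l2_norm M u"
    define b where "b = l2_norm M v"
    have ab: "a > 0" "b > 0"
      using False l2_norm_nonneg[of M u] l2_norm_nonneg[of M v] unfolding a_def b_def by linarith+
    have "0 \<le> (l2_norm M (\<lambda>x. of_real b * u x - of_real a * v x))\<^sup>2" by simp
    also have "\<dots> = 2 * a\<^sup>2 * b\<^sup>2 - 2 * (a * b * Re (l2_inner M u v))"
    proof -
      have "(l2_norm M (\<lambda>x. of_real b * u x))\<^sup>2 = b\<^sup>2 * a\<^sup>2"
        "(l2_norm M (\<lambda>x. of_real a * v x))\<^sup>2 = a\<^sup>2 * b\<^sup>2"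
        unfolding l2_norm_cmult a_def [symmetric] b_def [symmetric]
        by (simp_all add: power_mult_distrib)
      moreover have "Re (l2_inner M (\<lambda>x. of_real b * u x) (\<lambda>x. of_real a * v x))
          = a * b * Re (l2_inner M u v)"
        by (simp add: l2_inner_cmult_left l2_inner_cmult_right)
      ultimately show ?thesis
        using l2_norm_diff_square[OF L2_cmult[OF u] L2_cmult[OF v]] by simp
    qed
    finally have "(a * b) * Re (l2_inner M u v) \<le> (a * b) * (a * b)"
      by (simp add: power2_eq_square mult_ac)
    then show ?thesis using ab unfolding a_def b_def by (simp add: mult_le_cancel_left)
  qed
  show ?thesis
  proof (cases "l2_inner M f g = 0")
    case False
    define c where "c = cnj (sgn (l2_inner M f g))"
    have "cmod (l2_inner M f g) = Re (l2_inner M (\<lambda>x. c * f x) g)"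
    proof -
      have "c * l2_inner M f g = of_real (cmod (l2_inner M f g))"
        unfolding c_def sgn_div_norm using False
        by (simp add: scaleR_conv_of_real field_simps complex_norm_square power2_eq_square)
          (metis complex_norm_square mult.commute of_real_mult power2_eq_square)
      then show ?thesis by (simp add: l2_inner_cmult_left)
    qed
    also have "\<dots> \<le> l2_norm M (\<lambda>x. c * f x) * l2_norm M g"
      using assms by (intro main) auto
    also have "\<dots> = l2_norm M f * l2_norm M g"
      using False by (simp add: l2_norm_cmult c_def norm_sgn)
    finally show ?thesis .
  qed (simp)
qed

lemma l2_norm_triangle:
  assumes "f \<in> L2 M" "g \<in> L2 M"
  shows "l2_norm M (\<lambda>x. f x + g x) \<le> l2_norm M f + l2_norm M g"
proof (rule power2_le_imp_le)
  have "(l2_norm M (\<lambda>x. f x - (-1) * g x))\<^sup>2 =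
      (l2_norm M f)\<^sup>2 - 2 * Re (l2_inner M f (\<lambda>x. (-1) * g x)) + (l2_norm M (\<lambda>x. (-1) * g x))\<^sup>2"
    using assms by (intro l2_norm_diff_square) auto
  then have "(l2_norm M (\<lambda>x. f x + g x))\<^sup>2 =
      (l2_norm M f)\<^sup>2 + 2 * Re (l2_inner M f g) + (l2_norm M g)\<^sup>2"
    unfolding l2_inner_cmult_right l2_norm_cmult by simp
  also have "\<dots> \<le> (l2_norm M f)\<^sup>2 + 2 * (l2_norm M f * l2_norm M g) + (l2_norm M g)\<^sup>2"
    using l2_Cauchy_Schwarz[OF assms] complex_Re_le_cmod[of "l2_inner M f g"] by linarith
  also have "\<dots> = (l2_norm M f + l2_norm M g)\<^sup>2" by (simp add: power2_sum)
  finally show "(l2_norm M (\<lambda>x. f x + g x))\<^sup>2 \<le> (l2_norm M f + l2_norm M g)\<^sup>2" .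
qed simp

lemma l2_norm_triangle_diff:
  assumes "f \<in> L2 M" "g \<in> L2 M" "h \<in> L2 M"
  shows "l2_norm M (\<lambda>x. f x - h x) \<le> l2_norm M (\<lambda>x. f x - g x) + l2_norm M (\<lambda>x. g x - h x)"
  using l2_norm_triangle[of "\<lambda>x. f x - g x" M "\<lambda>x. g x - h x"] assms by auto

text \<open>
  Identities between operators are verified below in the weak form, that is, after taking the inner
  product with an arbitrary \<open>h\<close>: in this form they are equations between complex numbers, and a
  change of representatives does not affect them.
\<close>

lemma AE_eq_if_l2_inner_eq:
  assumes "f \<in> L2 M" "g \<in> L2 M" "\<And>h. h \<in> L2 M \<Longrightarrow> l2_inner M f h = l2_inner M g h"
  shows "AE x in M. f x = g x"
proof -
  have d: "(\<lambda>x. f x - g x) \<in> L2 M" using assms by auto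
  have "l2_inner M (\<lambda>x. f x - g x) (\<lambda>x. f x - g x) = 0"
    using assms(3)[OF d] by (simp add: l2_inner_diff_left[OF assms(1,2) d])
  then have "l2_norm M (\<lambda>x. f x - g x) = 0" by (simp add: l2_inner_self)
  then have "AE x in M. f x - g x = 0" using l2_norm_eq_0_iff[OF d] by simp
  then show ?thesis by simp
qed

lemma l2_norm_sum_orthogonal:
  assumes "finite I" "\<And>i. i \<in> I \<Longrightarrow> F i \<in> L2 M"
    and "\<And>i j. i \<in> I \<Longrightarrow> j \<in> I \<Longrightarrow> i \<noteq> j \<Longrightarrow> l2_inner M (F i) (F j) = 0"
  shows "(l2_norm M (\<lambda>x. \<Sum>i\<in>I. F i x))\<^sup>2 = (\<Sum>i\<in>I. (l2_norm M (F i))\<^sup>2)"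
proof -
  have "complex_of_real ((l2_norm M (\<lambda>x. \<Sum>i\<in>I. F i x))\<^sup>2)
      = (\<Sum>i\<in>I. \<Sum>j\<in>I. l2_inner M (F i) (F j))"
    unfolding l2_inner_self [symmetric] using assms
    by (subst l2_inner_sum_left) (auto intro!: sum.cong l2_inner_sum_right L2_sum)
  also have "\<dots> = (\<Sum>i\<in>I. \<Sum>j\<in>I. if j = i then l2_inner M (F i) (F i) else 0)"
    using assms by (intro sum.cong) auto
  also have "\<dots> = (\<Sum>i\<in>I. l2_inner M (F i) (F i))"
    using assms(1) by (intro sum.cong) auto
  also have "\<dots> = complex_of_real (\<Sum>i\<in>I. (l2_norm M (F i))\<^sup>2)"
    by (simp add: l2_inner_self)
  finally show ?thesis by (simp only: of_real_eq_iff)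
qed

text \<open>
  Completeness. Along a subsequence with \<open>\<parallel>S\<^sub>j\<^sub>+\<^sub>1 - S\<^sub>j\<parallel> \<le> 2\<^sup>-\<^sup>j\<close> the differences are absolutely
  summable almost everywhere: the weights \<open>2\<^sup>j\<close> make \<open>\<Sum> 2\<^sup>j \<bar>S\<^sub>j\<^sub>+\<^sub>1 - S\<^sub>j\<bar>\<^sup>2\<close> integrable, and
  \<open>2 \<bar>a\<bar> \<le> 2\<^sup>-\<^sup>j + 2\<^sup>j \<bar>a\<bar>\<^sup>2\<close>. Fatou's lemma turns the pointwise limit into a limit in norm.
\<close>

lemma l2_complete:
  assumes S: "\<And>n. S n \<in> L2 M"
    and Cauchy: "\<And>e. e > 0 \<Longrightarrow> \<exists>N. \<forall>m\<ge>N. \<forall>n\<ge>N. l2_norm M (\<lambda>x. S m x - S n x) < e"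
  obtains g where "g \<in> L2 M" "(\<lambda>n. l2_norm M (\<lambda>x. S n x - g x)) \<longlonglongrightarrow> 0"
proof -
  have [measurable]: "\<And>n. S n \<in> borel_measurable M" using S by (auto simp: L2_def)
  have "\<exists>N. \<forall>j. \<forall>m\<ge>N j. \<forall>n\<ge>N j. l2_norm M (\<lambda>x. S m x - S n x) < (1/2) ^ j"
    using Cauchy by (intro choice) auto
  then obtain N0 where N0: "\<And>j m n. m \<ge> N0 j \<Longrightarrow> n \<ge> N0 j \<Longrightarrow>
      l2_norm M (\<lambda>x. S m x - S n x) < (1/2) ^ j" by metis
  define N where "N j = Max (N0 ` {..j})" for j
  have N_mono: "N j \<le> N (Suc j)" for j unfolding N_def by (intro Max_mono) auto
  have N_ge: "N0 j \<le> N j" for j unfolding N_def by (intro Max_ge) auto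
  define D where "D j x = S (N (Suc j)) x - S (N j) x" for j x
  have D_L2: "D j \<in> L2 M" for j unfolding D_def using S by auto
  have [measurable]: "\<And>j. D j \<in> borel_measurable M" using D_L2 by (auto simp: L2_def)
  have D_norm: "l2_norm M (D j) < (1/2) ^ j" for j
    unfolding D_def using N_ge[of j] N_mono[of j] by (intro N0) auto
  have "(\<integral>\<^sup>+x. (\<Sum>j. ennreal (2 ^ j * (cmod (D j x))\<^sup>2)) \<partial>M)
      = (\<Sum>j. \<integral>\<^sup>+x. ennreal (2 ^ j * (cmod (D j x))\<^sup>2) \<partial>M)"
    by (intro nn_integral_suminf) auto
  also have "\<dots> = (\<Sum>j. ennreal (2 ^ j * (l2_norm M (D j))\<^sup>2))"
    using D_L2 by (simp add: ennreal_mult nn_integral_cmult l2_norm_nn_integral)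
  also have "\<dots> \<le> (\<Sum>j. ennreal ((1/2) ^ j))"
  proof (intro suminf_le ennreal_leI)
    fix j
    have "(l2_norm M (D j))\<^sup>2 \<le> ((1/2) ^ j)\<^sup>2"
      using D_norm[of j] by (intro power_mono) auto
    then have "2 ^ j * (l2_norm M (D j))\<^sup>2 \<le> 2 ^ j * ((1/2) ^ j)\<^sup>2"
      by (intro mult_left_mono) auto
    also have "\<dots> = (1/2::real) ^ j" by (simp add: power2_eq_square power_one_over)
    finally show "2 ^ j * (l2_norm M (D j))\<^sup>2 \<le> (1/2) ^ j" .
  qed auto
  also have "\<dots> = ennreal (\<Sum>j. (1/2) ^ j)"
    by (intro suminf_ennreal2) (auto simp: summable_geometric_iff)
  finally have "(\<integral>\<^sup>+x. (\<Sum>j. ennreal (2 ^ j * (cmod (D j x))\<^sup>2)) \<partial>M) < \<infinity>"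
    by (rule le_less_trans) simp
  then have "AE x in M. (\<Sum>j. ennreal (2 ^ j * (cmod (D j x))\<^sup>2)) \<noteq> \<infinity>"
    by (intro nn_integral_PInf_AE) (auto simp: less_top)
  then have AE_conv: "AE x in M. convergent (\<lambda>j. S (N j) x)"
  proof eventually_elim
    case (elim x)
    then have "summable (\<lambda>j. 2 ^ j * (cmod (D j x))\<^sup>2)"
      by (intro summable_suminf_not_top) auto
    then have sm: "summable (\<lambda>j. (1/2) ^ j + 2 ^ j * (cmod (D j x))\<^sup>2)"
      by (intro summable_add) (auto simp: summable_geometric_iff)
    have "summable (\<lambda>j. D j x)"
    proof (rule summable_norm_cancel, rule summable_comparison_test'[OF sm])
      fix j :: nat
      have "0 \<le> (1/2) ^ j * (1 - 2 ^ j * cmod (D j x))\<^sup>2" by simp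
      also have "\<dots> = (1/2) ^ j + 2 ^ j * (cmod (D j x))\<^sup>2 - 2 * cmod (D j x)"
        by (simp add: power2_eq_square algebra_simps power_one_over)
      finally show "norm (cmod (D j x)) \<le> (1/2) ^ j + 2 ^ j * (cmod (D j x))\<^sup>2"
        using norm_ge_zero[of "D j x"] unfolding real_norm_def abs_norm_cancel by linarith
    qed
    then have "convergent (\<lambda>n. \<Sum>j<n. D j x)" by (simp add: summable_iff_convergent)
    then have "convergent (\<lambda>n. (\<Sum>j<n. D j x) + S (N 0) x)"
      by (intro convergent_add convergent_const)
    moreover have "(\<Sum>j<n. D j x) + S (N 0) x = S (N n) x" for n
      unfolding D_def by (subst sum_lessThan_telescope) simp
    ultimately show ?case by simp
  qed
  define g where "g x = lim (\<lambda>j. S (N j) x)" for x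
  have g_meas [measurable]: "g \<in> borel_measurable M" unfolding g_def by measurable
  have AE_lim: "AE x in M. (\<lambda>j. S (N j) x) \<longlonglongrightarrow> g x"
    using AE_conv by eventually_elim (simp add: g_def convergent_LIMSEQ_iff)
  have tail: "(\<integral>\<^sup>+x. ennreal ((cmod (S n x - g x))\<^sup>2) \<partial>M) \<le> ennreal (((1/2) ^ i)\<^sup>2)"
    if "n \<ge> N i" for n i
  proof -
    have "(\<integral>\<^sup>+x. ennreal ((cmod (S n x - g x))\<^sup>2) \<partial>M)
        = (\<integral>\<^sup>+x. liminf (\<lambda>j. ennreal ((cmod (S n x - S (N j) x))\<^sup>2)) \<partial>M)"
    proof (rule nn_integral_cong_AE)
      show "AE x in M. ennreal ((cmod (S n x - g x))\<^sup>2)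
          = liminf (\<lambda>j. ennreal ((cmod (S n x - S (N j) x))\<^sup>2))"
        using AE_lim
      proof eventually_elim
        case (elim x)
        then have "(\<lambda>j. ennreal ((cmod (S n x - S (N j) x))\<^sup>2))
            \<longlonglongrightarrow> ennreal ((cmod (S n x - g x))\<^sup>2)"
          by (intro tendsto_intros)
        from lim_imp_Liminf[OF _ this] show ?case by simp
      qed
    qed
    also have "\<dots> \<le> liminf (\<lambda>j. \<integral>\<^sup>+x. ennreal ((cmod (S n x - S (N j) x))\<^sup>2) \<partial>M)"
      by (intro nn_integral_liminf) auto
    also have "\<dots> \<le> liminf (\<lambda>j. ennreal (((1/2) ^ i)\<^sup>2))"
    proof (rule Liminf_mono)
      show "\<forall>\<^sub>F j in sequentially. (\<integral>\<^sup>+x. ennreal ((cmod (S n x - S (N j) x))\<^sup>2) \<partial>M)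
          \<le> ennreal (((1/2) ^ i)\<^sup>2)"
        using eventually_ge_at_top[of i]
      proof eventually_elim
        case (elim j)
        have "N i \<le> N j" using elim unfolding N_def by (intro Max_mono) auto
        then have "l2_norm M (\<lambda>x. S n x - S (N j) x) < (1/2) ^ i"
          using that N_ge[of i] by (intro N0) auto
        then have "(l2_norm M (\<lambda>x. S n x - S (N j) x))\<^sup>2 \<le> ((1/2) ^ i)\<^sup>2"
          by (intro power_mono) auto
        then show ?case
          using S by (subst l2_norm_nn_integral) (auto intro!: ennreal_leI)
      qed
    qed
    finally show ?thesis by (simp add: Liminf_const)
  qed
  have diff_L2: "(\<lambda>x. S n x - g x) \<in> L2 M" if "n \<ge> N i" for n i
    using tail[OF that] by (intro L2I_bounded) (auto intro: le_less_trans)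
  have g_L2: "g \<in> L2 M"
    using L2_diff[OF S[of "N 0"] diff_L2[of 0 "N 0"]] by simp
  have "(\<lambda>n. l2_norm M (\<lambda>x. S n x - g x)) \<longlonglongrightarrow> 0"
  proof (rule LIMSEQ_I)
    fix e :: real assume "e > 0"
    then obtain i where i: "(1/2) ^ i < e"
      using real_arch_pow_inv[of e "1/2"] by auto
    have "norm (l2_norm M (\<lambda>x. S n x - g x) - 0) < e" if "n \<ge> N i" for n
    proof -
      have "ennreal ((l2_norm M (\<lambda>x. S n x - g x))\<^sup>2) \<le> ennreal (((1/2) ^ i)\<^sup>2)"
        using tail[OF that] l2_norm_nn_integral[OF diff_L2[OF that]] by simp
      then have "(l2_norm M (\<lambda>x. S n x - g x))\<^sup>2 \<le> ((1/2) ^ i)\<^sup>2"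
        by (subst (asm) ennreal_le_iff) auto
      then have "l2_norm M (\<lambda>x. S n x - g x) \<le> (1/2) ^ i"
        by (rule power2_le_imp_le) simp
      then show ?thesis using i by simp
    qed
    then show "\<exists>no. \<forall>n\<ge>no. norm (l2_norm M (\<lambda>x. S n x - g x) - 0) < e" by blast
  qed
  with g_L2 show thesis by (rule that)
qed

lemma l2_sums_inner:
  assumes "l2_sums M F g" "h \<in> L2 M"
  shows "(\<lambda>k. l2_inner M (F k) h) sums l2_inner M g h"
proof -
  have F: "\<And>k. F k \<in> L2 M" and g: "g \<in> L2 M"
    and lim: "(\<lambda>n. l2_norm M (\<lambda>x. (\<Sum>k<n. F k x) - g x)) \<longlonglongrightarrow> 0"
    using assms(1) by (auto simp: l2_sums_def)
  have "(\<lambda>n. (\<Sum>k<n. l2_inner M (F k) h) - l2_inner M g h) \<longlonglongrightarrow> 0"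
  proof (rule Lim_null_comparison)
    show "\<forall>\<^sub>F n in sequentially. norm ((\<Sum>k<n. l2_inner M (F k) h) - l2_inner M g h)
        \<le> l2_norm M (\<lambda>x. (\<Sum>k<n. F k x) - g x) * l2_norm M h"
    proof (intro always_eventually allI)
      fix n
      have "(\<Sum>k<n. l2_inner M (F k) h) - l2_inner M g h
          = l2_inner M (\<lambda>x. (\<Sum>k<n. F k x) - g x) h"
        using F g assms(2) by (subst l2_inner_diff_left) (auto simp: l2_inner_sum_left)
      then show "norm ((\<Sum>k<n. l2_inner M (F k) h) - l2_inner M g h)
          \<le> l2_norm M (\<lambda>x. (\<Sum>k<n. F k x) - g x) * l2_norm M h"
        using F g assms(2) by (simp add: l2_Cauchy_Schwarz L2_diff L2_sum)
    qed
    show "(\<lambda>n. l2_norm M (\<lambda>x. (\<Sum>k<n. F k x) - g x) * l2_norm M h) \<longlonglongrightarrow> 0"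
      using tendsto_mult_right[OF lim, of "l2_norm M h"] by simp
  qed
  then show ?thesis unfolding sums_def by (simp add: LIM_zero_iff)
qed

lemma l2_sums_norm_le:
  assumes "l2_sums M F g" "\<And>n. l2_norm M (\<lambda>x. \<Sum>k<n. F k x) \<le> B"
  shows "l2_norm M g \<le> B"
proof (rule LIMSEQ_le_const)
  have F: "\<And>k. F k \<in> L2 M" and g: "g \<in> L2 M"
    and lim: "(\<lambda>n. l2_norm M (\<lambda>x. (\<Sum>k<n. F k x) - g x)) \<longlonglongrightarrow> 0"
    using assms(1) by (auto simp: l2_sums_def)
  show "(\<lambda>n. B + l2_norm M (\<lambda>x. (\<Sum>k<n. F k x) - g x)) \<longlonglongrightarrow> B"
    using tendsto_add[OF tendsto_const lim, of B] by simp
  have "l2_norm M g \<le> B + l2_norm M (\<lambda>x. (\<Sum>k<n. F k x) - g x)" for n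
  proof -
    have "l2_norm M (\<lambda>x. g x - 0) \<le> l2_norm M (\<lambda>x. g x - (\<Sum>k<n. F k x))
        + l2_norm M (\<lambda>x. (\<Sum>k<n. F k x) - 0)"
      using F g by (intro l2_norm_triangle_diff) auto
    then show ?thesis using assms(2)[of n] by (simp add: l2_norm_minus_commute[of M g])
  qed
  then show "\<exists>N. \<forall>n\<ge>N. l2_norm M g \<le> B + l2_norm M (\<lambda>x. (\<Sum>k<n. F k x) - g x)" by blast
qed

text \<open>
  By Pythagoras the partial sums form a Cauchy sequence. The transform, its adjoint, the resolvent
  and the orthogonal expansions are all obtained as such series.
\<close>

lemma l2_orthogonal_series:
  assumes F: "\<And>k. F k \<in> L2 M"
    and orth: "\<And>j k. j \<noteq> k \<Longrightarrow> l2_inner M (F j) (F k) = 0"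
    and bound: "\<And>n. (\<Sum>k<n. (l2_norm M (F k))\<^sup>2) \<le> B\<^sup>2" and "B \<ge> 0"
  obtains g where "l2_sums M F g" "l2_norm M g \<le> B"
proof -
  define S where "S n x = (\<Sum>k<n. F k x)" for n x
  have S: "S n \<in> L2 M" for n unfolding S_def using F by auto
  have summ: "summable (\<lambda>k. (l2_norm M (F k))\<^sup>2)"
    by (rule summableI_nonneg_bounded[OF _ bound]) simp
  have diff: "(l2_norm M (\<lambda>x. S m x - S n x))\<^sup>2 = (\<Sum>k\<in>{n..<m}. (l2_norm M (F k))\<^sup>2)"
    if "n \<le> m" for m n
  proof -
    have "S m x - S n x = (\<Sum>k\<in>{n..<m}. F k x)" for x
      unfolding S_def using that sum_diff_nat_ivl[of 0 n m "\<lambda>k. F k x"]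
      by (simp add: atLeast0LessThan)
    then show ?thesis using F orth by (simp add: l2_norm_sum_orthogonal)
  qed
  have Cauchy: "\<exists>N. \<forall>m\<ge>N. \<forall>n\<ge>N. l2_norm M (\<lambda>x. S m x - S n x) < e" if "e > 0" for e
  proof -
    from summ that have "\<exists>N. \<forall>m\<ge>N. \<forall>n. norm (\<Sum>k\<in>{m..<n}. (l2_norm M (F k))\<^sup>2) < e\<^sup>2"
      unfolding summable_Cauchy by simp
    then obtain N where N: "\<And>m n. m \<ge> N \<Longrightarrow> norm (\<Sum>k\<in>{m..<n}. (l2_norm M (F k))\<^sup>2) < e\<^sup>2"
      by blast
    have "l2_norm M (\<lambda>x. S m x - S n x) < e" if "m \<ge> N" "n \<ge> N" "n \<le> m" for m n
    proof (rule power_less_imp_less_base[of _ 2])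
      show "(l2_norm M (\<lambda>x. S m x - S n x))\<^sup>2 < e\<^sup>2"
        using N[of n m] that diff[OF that(3)] by simp
    qed (use \<open>e > 0\<close> in simp)
    then have "l2_norm M (\<lambda>x. S m x - S n x) < e" if "m \<ge> N" "n \<ge> N" for m n
      using that by (metis l2_norm_minus_commute nat_le_linear)
    then show ?thesis by blast
  qed
  obtain g where g: "g \<in> L2 M" "(\<lambda>n. l2_norm M (\<lambda>x. S n x - g x)) \<longlonglongrightarrow> 0"
    using l2_complete[of S M] S Cauchy by blast
  have sums: "l2_sums M F g" using F g unfolding l2_sums_def S_def by auto
  moreover have "l2_norm M (\<lambda>x. \<Sum>k<n. F k x) \<le> B" for n
  proof (rule power2_le_imp_le[OF _ \<open>B \<ge> 0\<close>])
    show "(l2_norm M (\<lambda>x. \<Sum>k<n. F k x))\<^sup>2 \<le> B\<^sup>2"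
      using bound[of n] F orth by (simp add: l2_norm_sum_orthogonal)
  qed
  ultimately show thesis using that l2_sums_norm_le[OF sums] by blast
qed

section \<open>Orthogonal sums of oblique projections\<close>

text \<open>
  \<open>Q\<^sub>k\<close> is the adjoint of the projection \<open>P\<^sub>k\<close>. Projections with different indices act on
  orthogonal pieces of the space, and \<open>P Q P = C P\<close> says that the restriction of \<open>P\<close> to its
  initial space is \<open>\<surd>C\<close> times an isometry, so that the range of \<open>P\<close> and its initial space meet at one fixed
  angle. The vector in the common kernel accounts for the eigenvalue \<open>0\<close>.
\<close>

locale oblique_projections =
  fixes M :: "'a measure"
    and P Q :: "nat \<Rightarrow> ('a \<Rightarrow> complex) \<Rightarrow> 'a \<Rightarrow> complex"
    and C :: "nat \<Rightarrow> real" and K :: real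
  assumes P_L2 [simp]: "f \<in> L2 M \<Longrightarrow> P k f \<in> L2 M"
    and Q_L2 [simp]: "f \<in> L2 M \<Longrightarrow> Q k f \<in> L2 M"
    and adjoint: "\<lbrakk>f \<in> L2 M; g \<in> L2 M\<rbrakk> \<Longrightarrow> l2_inner M (P k f) g = l2_inner M f (Q k g)"
    and P_idem: "\<lbrakk>f \<in> L2 M; g \<in> L2 M\<rbrakk> \<Longrightarrow> l2_inner M (P k (P k f)) g = l2_inner M (P k f) g"
    and PQP: "\<lbrakk>f \<in> L2 M; g \<in> L2 M\<rbrakk> \<Longrightarrow>
      l2_inner M (P k (Q k (P k f))) g = of_real (C k) * l2_inner M (P k f) g"
    and orth_PP: "\<lbrakk>f \<in> L2 M; g \<in> L2 M; j \<noteq> k\<rbrakk> \<Longrightarrow> l2_inner M (P j f) (P k g) = 0"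
    and orth_QQ: "\<lbrakk>f \<in> L2 M; g \<in> L2 M; j \<noteq> k\<rbrakk> \<Longrightarrow> l2_inner M (Q j f) (Q k g) = 0"
    and orth_PQ: "\<lbrakk>f \<in> L2 M; g \<in> L2 M; j \<noteq> k\<rbrakk> \<Longrightarrow> l2_inner M (P j f) (Q k g) = 0"
    and P_nonzero: "\<exists>f\<in>L2 M. l2_inner M (P k f) f \<noteq> 0"
    and common_kernel: "\<exists>f\<in>L2 M. \<not> (AE x in M. f x = 0) \<and>
      (\<forall>k. \<forall>h\<in>L2 M. l2_inner M (P k f) h = 0 \<and> l2_inner M (Q k f) h = 0)"
    and C_le: "C k \<le> K"
begin

lemma adjoint': "\<lbrakk>f \<in> L2 M; g \<in> L2 M\<rbrakk> \<Longrightarrow> l2_inner M (Q k f) g = l2_inner M f (P k g)"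
  by (metis adjoint l2_inner_cnj)

lemma orth_QP:
  "\<lbrakk>f \<in> L2 M; g \<in> L2 M; j \<noteq> k\<rbrakk> \<Longrightarrow> l2_inner M (Q j f) (P k g) = 0"
  by (metis orth_PQ l2_inner_cnj complex_cnj_zero)

lemma Q_idem: "\<lbrakk>f \<in> L2 M; g \<in> L2 M\<rbrakk> \<Longrightarrow> l2_inner M (Q k (Q k f)) g = l2_inner M (Q k f) g"
  by (metis P_L2 P_idem Q_L2 adjoint' l2_inner_cnj)

lemma QPQ:
  assumes "f \<in> L2 M" "g \<in> L2 M"
  shows "l2_inner M (Q k (P k (Q k f))) g = of_real (C k) * l2_inner M (Q k f) g"
proof -
  have "l2_inner M (Q k (P k (Q k f))) g = l2_inner M f (P k (Q k (P k g)))"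
    using assms by (simp add: adjoint adjoint')
  also have "\<dots> = of_real (C k) * l2_inner M f (P k g)"
    by (subst (1 2) l2_inner_cnj [symmetric]) (simp add: PQP assms)
  finally show ?thesis using assms by (simp add: adjoint')
qed

lemma dual: "oblique_projections M Q P C K"
proof unfold_locales
  fix k show "\<exists>f\<in>L2 M. l2_inner M (Q k f) f \<noteq> 0"
    using P_nonzero[of k] by (metis adjoint' l2_inner_cnj complex_cnj_zero_iff)
qed (use adjoint' Q_idem QPQ orth_PP orth_QQ orth_QP common_kernel C_le in auto)

text \<open>A nonzero \<open>g\<close> in the range satisfies \<open>\<parallel>g\<parallel>\<^sup>2 = \<langle>g, Q g\<rangle>\<close> and \<open>\<parallel>Q g\<parallel>\<^sup>2 = C \<parallel>g\<parallel>\<^sup>2\<close>.\<close>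

lemma C_ge_1: "C k \<ge> 1"
proof -
  obtain f where f: "f \<in> L2 M" "l2_inner M (P k f) f \<noteq> 0" using P_nonzero by blast
  define g where "g = P k f"
  define a b where "a = l2_norm M g" and "b = l2_norm M (Q k g)"
  have g: "g \<in> L2 M" using f by (simp add: g_def)
  have "a \<noteq> 0"
    using l2_Cauchy_Schwarz[OF g f(1)] f(2) unfolding a_def g_def by auto
  then have a: "a > 0" using l2_norm_nonneg[of M g] unfolding a_def by linarith
  have "of_real (a\<^sup>2) = l2_inner M g (Q k g)"
    unfolding a_def l2_inner_self [symmetric] using P_idem[of f g k] f g
    by (simp add: adjoint flip: g_def)
  then have "cmod (complex_of_real (a\<^sup>2)) \<le> a * b"
    using l2_Cauchy_Schwarz[of g M "Q k g"] g by (simp add: a_def b_def)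
  then have "a \<le> b" using a by (simp add: norm_mult power2_eq_square)
  have "complex_of_real (b\<^sup>2) = l2_inner M (P k (Q k g)) g"
    unfolding b_def l2_inner_self [symmetric] using g by (simp add: adjoint)
  also have "\<dots> = of_real (C k) * of_real (a\<^sup>2)"
    unfolding a_def l2_inner_self [symmetric] using f g by (simp add: g_def PQP)
  finally have "b\<^sup>2 = C k * a\<^sup>2" by (metis of_real_eq_iff of_real_mult)
  moreover have "a\<^sup>2 \<le> b\<^sup>2" using \<open>a \<le> b\<close> a by (intro power_mono) auto
  ultimately show ?thesis using a by simp
qed

lemma K_ge_1: "K \<ge> 1"
  using C_ge_1[of 0] C_le[of 0] by linarith

text \<open>
  The orthogonality of the ranges of the \<open>Q\<^sub>k\<close> makes \<open>V = \<Sum> Q\<^sub>k P\<^sub>k f\<close> satisfy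
  \<open>\<parallel>V\<parallel>\<^sup>2 = \<Sum> C\<^sub>k \<parallel>P\<^sub>k f\<parallel>\<^sup>2\<close>, while \<open>\<langle>f, V\<rangle> = \<Sum> \<parallel>P\<^sub>k f\<parallel>\<^sup>2\<close>; the Cauchy--Schwarz inequality
  then bounds this sum.
\<close>

lemma P_Bessel:
  assumes f: "f \<in> L2 M"
  shows "(\<Sum>k<n. (l2_norm M (P k f))\<^sup>2) \<le> K * (l2_norm M f)\<^sup>2"
proof -
  define s where "s = (\<Sum>k<n. (l2_norm M (P k f))\<^sup>2)"
  define V where "V x = (\<Sum>k<n. Q k (P k f) x)" for x
  have V: "V \<in> L2 M" unfolding V_def using f by auto
  have s0: "s \<ge> 0" unfolding s_def by (intro sum_nonneg) auto
  have "complex_of_real s = (\<Sum>k<n. l2_inner M f (Q k (P k f)))"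
    unfolding s_def of_real_sum l2_inner_self [symmetric] using f by (simp add: adjoint)
  also have "\<dots> = l2_inner M f V" unfolding V_def using f by (subst l2_inner_sum_right) auto
  finally have "cmod (complex_of_real s) \<le> l2_norm M f * l2_norm M V"
    using l2_Cauchy_Schwarz[OF f V] by simp
  then have sV: "s \<le> l2_norm M f * l2_norm M V" using s0 by simp
  have QP: "(l2_norm M (Q k (P k f)))\<^sup>2 = C k * (l2_norm M (P k f))\<^sup>2" for k
  proof -
    have "complex_of_real ((l2_norm M (Q k (P k f)))\<^sup>2) = l2_inner M (P k (Q k (P k f))) (P k f)"
      unfolding l2_inner_self [symmetric] using f by (simp add: adjoint)
    also have "\<dots> = complex_of_real (C k * (l2_norm M (P k f))\<^sup>2)"
      using f by (simp add: PQP l2_inner_self)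
    finally show ?thesis by (simp only: of_real_eq_iff)
  qed
  have "(l2_norm M V)\<^sup>2 = (\<Sum>k<n. (l2_norm M (Q k (P k f)))\<^sup>2)"
    unfolding V_def using f orth_QQ by (intro l2_norm_sum_orthogonal) auto
  also have "\<dots> \<le> K * s"
    unfolding s_def sum_distrib_left QP by (intro sum_mono mult_right_mono C_le) auto
  finally have V2: "(l2_norm M V)\<^sup>2 \<le> K * s" .
  have "s * s \<le> (l2_norm M f * l2_norm M V)\<^sup>2"
    unfolding power2_eq_square using sV s0 by (intro mult_mono) auto
  also have "\<dots> \<le> (l2_norm M f)\<^sup>2 * (K * s)"
    unfolding power_mult_distrib using V2 by (intro mult_left_mono) auto
  finally have "s * s \<le> s * (K * (l2_norm M f)\<^sup>2)" by (simp add: mult_ac)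
  then have "s \<le> K * (l2_norm M f)\<^sup>2"
    using s0 K_ge_1 by (cases "s = 0") (auto simp: mult_le_cancel_left)
  then show ?thesis by (simp add: s_def)
qed

lemma Q_Bessel:
  "f \<in> L2 M \<Longrightarrow> (\<Sum>k<n. (l2_norm M (Q k f))\<^sup>2) \<le> K * (l2_norm M f)\<^sup>2"
  by (rule oblique_projections.P_Bessel[OF dual])

subsection \<open>The skew parts of the blocks\<close>

definition D :: "nat \<Rightarrow> ('a \<Rightarrow> complex) \<Rightarrow> 'a \<Rightarrow> complex" where
  "D k f = (\<lambda>x. Q k f x - P k f x)"

lemma D_L2 [simp]: "f \<in> L2 M \<Longrightarrow> D k f \<in> L2 M"
  unfolding D_def by auto

lemma inner_D: "\<lbrakk>f \<in> L2 M; h \<in> L2 M\<rbrakk> \<Longrightarrow>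
    l2_inner M (D k f) h = l2_inner M (Q k f) h - l2_inner M (P k f) h"
  unfolding D_def by (simp add: l2_inner_diff_left)

lemma inner_D_right: "\<lbrakk>f \<in> L2 M; h \<in> L2 M\<rbrakk> \<Longrightarrow>
    l2_inner M h (D k f) = l2_inner M h (Q k f) - l2_inner M h (P k f)"
  unfolding D_def by (simp add: l2_inner_diff_right)

lemma D_skew: "\<lbrakk>f \<in> L2 M; h \<in> L2 M\<rbrakk> \<Longrightarrow> l2_inner M (D k f) h = - l2_inner M f (D k h)"
  by (simp add: inner_D inner_D_right adjoint adjoint')

lemma D_orth: "\<lbrakk>f \<in> L2 M; h \<in> L2 M; j \<noteq> k\<rbrakk> \<Longrightarrow> l2_inner M (D j f) (D k h) = 0"
  by (simp add: inner_D inner_D_right orth_PP orth_QQ orth_PQ orth_QP)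

lemma D_D_orth: "\<lbrakk>f \<in> L2 M; h \<in> L2 M; j \<noteq> k\<rbrakk> \<Longrightarrow> l2_inner M f (D j (D k h)) = 0"
  using D_orth[of f h j k] by (simp add: D_skew)

text \<open>
  With \<open>P\<^sup>2 = P\<close>, \<open>Q\<^sup>2 = Q\<close>, \<open>P Q P = C P\<close> and \<open>Q P Q = C Q\<close>, expanding \<open>(Q - P)\<^sup>3\<close> leaves only
  multiples of \<open>P\<close> and \<open>Q\<close>.
\<close>

lemma D_cube:
  assumes f: "f \<in> L2 M" and h: "h \<in> L2 M"
  shows "l2_inner M (D k (D k (D k f))) h = - of_real (C k - 1) * l2_inner M (D k f) h"
proof -
  let ?i = "l2_inner M"
  have D2: "?i (D k (D k u)) h = ?i (Q k u) h + ?i (P k u) h - ?i (P k (Q k u)) h - ?i (Q k (P k u)) h"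
    if u: "u \<in> L2 M" for u
  proof -
    have "?i (D k (D k u)) h = - ?i (D k u) (D k h)" using u h by (simp add: D_skew)
    also have "\<dots> = - ?i (Q k u) (Q k h) + ?i (Q k u) (P k h) + ?i (P k u) (Q k h) - ?i (P k u) (P k h)"
      using u h by (simp add: inner_D inner_D_right)
    also have "?i (Q k u) (Q k h) = ?i (P k (Q k u)) h" using u h by (simp add: adjoint)
    also have "?i (Q k u) (P k h) = ?i (Q k u) h" using u h by (simp add: Q_idem flip: adjoint')
    also have "?i (P k u) (Q k h) = ?i (P k u) h" using u h by (simp add: P_idem flip: adjoint)
    also have "?i (P k u) (P k h) = ?i (Q k (P k u)) h" using u h by (simp add: adjoint')
    finally show ?thesis by simp
  qed
  have 1: "?i (Q k (D k f)) h = ?i (Q k f) h - ?i (P k f) (P k h)"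
    using f h by (simp add: adjoint' inner_D) (simp add: Q_idem flip: adjoint')
  have 2: "?i (P k (D k f)) h = ?i (Q k f) (Q k h) - ?i (P k f) h"
    using f h by (simp add: adjoint inner_D) (simp add: P_idem flip: adjoint)
  have "?i (P k (Q k (D k f))) h = ?i (Q k f) (P k (Q k h)) - ?i (P k f) (P k (Q k h))"
    using f h by (simp add: adjoint[of "Q k (D k f)"] adjoint'[of "D k f"] inner_D)
  also have "?i (Q k f) (P k (Q k h)) = ?i (Q k f) (Q k h)"
    using f h by (simp add: Q_idem flip: adjoint')
  also have "?i (P k f) (P k (Q k h)) = C k * ?i (P k f) h"
    using f h PQP[of f h k] by (simp flip: adjoint' adjoint)
  finally have 3: "?i (P k (Q k (D k f))) h = ?i (Q k f) (Q k h) - C k * ?i (P k f) h" .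
  have "?i (Q k (P k (D k f))) h = ?i (Q k f) (Q k (P k h)) - ?i (P k f) (Q k (P k h))"
    using f h by (simp add: adjoint'[of "P k (D k f)"] adjoint[of "D k f"] inner_D)
  also have "?i (Q k f) (Q k (P k h)) = C k * ?i (Q k f) h"
    using f h QPQ[of f h k] by (simp flip: adjoint' adjoint)
  also have "?i (P k f) (Q k (P k h)) = ?i (P k f) (P k h)"
    using f h by (simp add: P_idem flip: adjoint)
  finally have 4: "?i (Q k (P k (D k f))) h = C k * ?i (Q k f) h - ?i (P k f) (P k h)" .
  show ?thesis
    unfolding D2[OF D_L2[OF f]] 1 2 3 4 inner_D[OF f h] by (simp add: algebra_simps)
qed

definition l :: "nat \<Rightarrow> real" where "l k = sqrt (C k - 1)"

lemma l_square: "(l k)\<^sup>2 = C k - 1"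
  unfolding l_def using C_ge_1[of k] by simp

lemma l_nonneg: "l k \<ge> 0"
  unfolding l_def using C_ge_1[of k] by simp

lemma D_cube_l:
  "\<lbrakk>f \<in> L2 M; h \<in> L2 M\<rbrakk> \<Longrightarrow>
    l2_inner M (D k (D k (D k f))) h = - (of_real (l k))\<^sup>2 * l2_inner M (D k f) h"
  by (simp add: D_cube flip: l_square)

lemma D_square_norm:
  assumes "f \<in> L2 M"
  shows "l2_norm M (D k (D k f)) = l k * l2_norm M (D k f)"
proof -
  have "complex_of_real ((l2_norm M (D k (D k f)))\<^sup>2) = - l2_inner M (D k (D k (D k f))) (D k f)"
    unfolding l2_inner_self [symmetric] using assms by (simp add: D_skew[of "D k (D k f)"])
  also have "\<dots> = complex_of_real ((l k * l2_norm M (D k f))\<^sup>2)"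
    using assms by (simp add: D_cube_l l2_inner_self power_mult_distrib)
  finally have "(l2_norm M (D k (D k f)))\<^sup>2 = (l k * l2_norm M (D k f))\<^sup>2"
    by (simp only: of_real_eq_iff)
  then show ?thesis using l_nonneg[of k] by simp
qed

lemma D_Bessel:
  assumes "f \<in> L2 M"
  shows "(\<Sum>k<n. (l2_norm M (D k f))\<^sup>2) \<le> 4 * K * (l2_norm M f)\<^sup>2"
proof -
  have "(l2_norm M (D k f))\<^sup>2 \<le> 2 * (l2_norm M (Q k f))\<^sup>2 + 2 * (l2_norm M (P k f))\<^sup>2" for k
  proof -
    have "l2_norm M (D k f) \<le> l2_norm M (Q k f) + l2_norm M (P k f)"
      using l2_norm_triangle[of "Q k f" M "\<lambda>x. - 1 * P k f x"] assms
      unfolding D_def by (simp add: l2_norm_cmult[of M "-1", simplified] L2_uminus)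
    then have "(l2_norm M (D k f))\<^sup>2 \<le> (l2_norm M (Q k f) + l2_norm M (P k f))\<^sup>2"
      by (intro power_mono) auto
    also have "\<dots> \<le> 2 * (l2_norm M (Q k f))\<^sup>2 + 2 * (l2_norm M (P k f))\<^sup>2"
      using sum_squares_bound[of "l2_norm M (Q k f)" "l2_norm M (P k f)"]
      by (simp add: power2_sum)
    finally show ?thesis .
  qed
  then have "(\<Sum>k<n. (l2_norm M (D k f))\<^sup>2)
      \<le> (\<Sum>k<n. 2 * (l2_norm M (Q k f))\<^sup>2 + 2 * (l2_norm M (P k f))\<^sup>2)"
    by (intro sum_mono)
  also have "\<dots> \<le> 2 * (K * (l2_norm M f)\<^sup>2) + 2 * (K * (l2_norm M f)\<^sup>2)"
    unfolding sum.distrib sum_distrib_left [symmetric]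
    using P_Bessel[OF assms, of n] Q_Bessel[OF assms, of n] by linarith
  finally show ?thesis by simp
qed

subsection \<open>The sum of the projections and its adjoint\<close>

definition L :: "('a \<Rightarrow> complex) \<Rightarrow> 'a \<Rightarrow> complex" where
  "L f = (SOME g. l2_sums M (\<lambda>k. P k f) g)"

definition A :: "('a \<Rightarrow> complex) \<Rightarrow> 'a \<Rightarrow> complex" where
  "A f = (\<lambda>x. l2_adjoint M L f x - L f x)"

lemma P_series:
  assumes f: "f \<in> L2 M"
  obtains g where "l2_sums M (\<lambda>k. P k f) g"
proof -
  have "(\<Sum>k<n. (l2_norm M (P k f))\<^sup>2) \<le> (sqrt K * l2_norm M f)\<^sup>2" for n
    using P_Bessel[OF f, of n] K_ge_1 by (simp add: power_mult_distrib)
  then show thesis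
    using l2_orthogonal_series[of "\<lambda>k. P k f" M "sqrt K * l2_norm M f"] f orth_PP K_ge_1 that
    by force
qed

lemma L_sums: "f \<in> L2 M \<Longrightarrow> l2_sums M (\<lambda>k. P k f) (L f)"
  unfolding L_def by (rule someI_ex [of "l2_sums M (\<lambda>k. P k f)"]) (erule P_series, blast)

lemma L_L2: "f \<in> L2 M \<Longrightarrow> L f \<in> L2 M"
  using L_sums[of f] by (simp add: l2_sums_def)

text \<open>The adjoint is the sum of the \<open>Q\<^sub>k\<close>, which converges because the hypotheses are symmetric in \<open>P\<close> and \<open>Q\<close>.\<close>

lemma adjoint_L:
  assumes f: "f \<in> L2 M"
  shows "l2_adjoint M L f \<in> L2 M \<and>
    (\<forall>h\<in>L2 M. l2_inner M (L h) f = l2_inner M h (l2_adjoint M L f))"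
proof -
  obtain g where g: "l2_sums M (\<lambda>k. Q k f) g"
    using oblique_projections.P_series[OF dual f] by blast
  have "l2_inner M (L h) f = l2_inner M h g" if h: "h \<in> L2 M" for h
  proof -
    have "(\<lambda>k. l2_inner M (P k h) f) sums l2_inner M (L h) f"
      by (rule l2_sums_inner[OF L_sums[OF h] f])
    then have "(\<lambda>k. cnj (l2_inner M (P k h) f)) sums cnj (l2_inner M (L h) f)"
      by (simp only: sums_cnj)
    then have "(\<lambda>k. l2_inner M (Q k f) h) sums l2_inner M f (L h)"
      using f h by (simp add: l2_inner_cnj adjoint')
    moreover have "(\<lambda>k. l2_inner M (Q k f) h) sums l2_inner M g h"
      by (rule l2_sums_inner[OF g h])
    ultimately have "l2_inner M f (L h) = l2_inner M g h" by (rule sums_unique2)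
    then show ?thesis by (metis l2_inner_cnj)
  qed
  moreover have "g \<in> L2 M" using g by (simp add: l2_sums_def)
  ultimately have "\<exists>g. g \<in> L2 M \<and> (\<forall>h\<in>L2 M. l2_inner M (L h) f = l2_inner M h g)" by blast
  then show ?thesis unfolding l2_adjoint_def by (rule someI_ex)
qed

lemma A_L2 [simp]: "f \<in> L2 M \<Longrightarrow> A f \<in> L2 M"
  unfolding A_def using adjoint_L L_L2 by auto

lemma inner_A_sums:
  assumes f: "f \<in> L2 M" and h: "h \<in> L2 M"
  shows "(\<lambda>k. l2_inner M (D k f) h) sums l2_inner M (A f) h"
proof -
  have "(\<lambda>k. cnj (l2_inner M (P k h) f)) sums cnj (l2_inner M (L h) f)"
    using l2_sums_inner[OF L_sums[OF h] f] by (simp only: sums_cnj)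
  then have "(\<lambda>k. l2_inner M (Q k f) h) sums l2_inner M (l2_adjoint M L f) h"
    using adjoint_L[OF f] f h by (simp add: l2_inner_cnj adjoint')
  from sums_diff[OF this l2_sums_inner[OF L_sums[OF f] h]] show ?thesis
    unfolding A_def using adjoint_L[OF f] L_L2[OF f] f h
    by (simp add: inner_D l2_inner_diff_left)
qed

lemma inner_A_D:
  assumes f: "f \<in> L2 M" and h: "h \<in> L2 M"
  shows "l2_inner M (A f) (D k h) = l2_inner M (D k f) (D k h)"
proof -
  have "(\<lambda>j. l2_inner M (D j f) (D k h)) sums (\<Sum>j\<in>{k}. l2_inner M (D j f) (D k h))"
    using f h by (intro sums_finite) (auto simp: D_orth)
  then show ?thesis using inner_A_sums[OF f, of "D k h"] h sums_unique2 by force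
qed

lemma A_eq_scalar_AE:
  assumes "f \<in> L2 M" "\<And>h. h \<in> L2 M \<Longrightarrow> l2_inner M (A f) h = c * l2_inner M f h"
  shows "AE x in M. A f x = c * f x"
  by (rule AE_eq_if_l2_inner_eq) (use assms in \<open>auto simp: l2_inner_cmult_left\<close>)

subsection \<open>Eigenvalues\<close>

definition S :: "complex set" where
  "S = {0} \<union> (\<Union>k. {\<i> * of_real (l k), - \<i> * of_real (l k)})"

lemma plus_square_factor: "c\<^sup>2 + (of_real x)\<^sup>2 = (c - \<i> * of_real x) * (c - (- \<i> * of_real x))"
  by (simp add: algebra_simps power2_eq_square)

lemma nonzero_if_notin_S:
  assumes "c \<notin> S"
  shows "c \<noteq> 0" "c\<^sup>2 + (of_real (l k))\<^sup>2 \<noteq> 0"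
  using assms unfolding S_def plus_square_factor by (auto simp: add_eq_0_iff2)

text \<open>
  If \<open>A f = c f\<close>, then \<open>D\<^sub>k\<^sup>2 f = c D\<^sub>k f\<close> for every \<open>k\<close>, and \<open>D\<^sub>k\<^sup>3 = - l\<^sub>k\<^sup>2 D\<^sub>k\<close> gives
  \<open>(c\<^sup>2 + l\<^sub>k\<^sup>2) D\<^sub>k f = 0\<close>. For \<open>c\<close> outside \<open>S\<close> this makes all \<open>D\<^sub>k f\<close> vanish, hence \<open>A f = 0\<close>.
\<close>

lemma point_spectrum_subset: "l2_point_spectrum M A \<subseteq> S"
proof
  fix c assume "c \<in> l2_point_spectrum M A"
  then obtain f where f: "f \<in> L2 M" "\<not> (AE x in M. f x = 0)" "AE x in M. A f x = c * f x"
    unfolding l2_point_spectrum_def l2_eigenfunction_def by blast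
  show "c \<in> S"
  proof (rule ccontr)
    assume c: "c \<notin> S"
    have Af: "l2_inner M (A f) h = c * l2_inner M f h" if "h \<in> L2 M" for h
      using l2_inner_cong_AE[OF _ that _ that f(3)] f(1) by (auto simp: l2_inner_cmult_left)
    have D0: "l2_inner M (D k f) h = 0" if h: "h \<in> L2 M" for k h
    proof -
      have D2: "l2_inner M (D k (D k f)) u = c * l2_inner M (D k f) u" if u: "u \<in> L2 M" for u
        using inner_A_D[OF f(1) u, of k] Af[of "D k u"] u f(1)
        by (simp add: D_skew[of f] D_skew[of "D k f"])
      have "l2_inner M (D k (D k (D k f))) h = c\<^sup>2 * l2_inner M (D k f) h"
      proof -
        have "l2_inner M (D k f) (D k h) = - (c * l2_inner M (D k f) h)"
          using h f(1) D2[OF h] D_skew[of "D k f" h k] by (metis D_L2 minus_equation_iff)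
        then show ?thesis
          using h f(1) D2[of "D k h"] D_skew[of "D k (D k f)" h k] by (simp add: power2_eq_square)
      qed
      then have "(c\<^sup>2 + (of_real (l k))\<^sup>2) * l2_inner M (D k f) h = 0"
        using D_cube_l[OF f(1) h, of k] by (simp add: distrib_right) (metis add.left_inverse)
      then show ?thesis using nonzero_if_notin_S(2)[OF c, of k] by simp
    qed
    have "l2_inner M f h = 0" if h: "h \<in> L2 M" for h
      using sums_unique2[OF inner_A_sums[OF f(1) h], of 0] D0[OF h] Af[OF h]
        nonzero_if_notin_S(1)[OF c] by simp
    then have "AE x in M. f x = 0"
      using AE_eq_if_l2_inner_eq[of f M "\<lambda>x. 0"] f(1) by simp
    with f(2) show False by blast
  qed
qed

lemma zero_eigenvalue: "0 \<in> l2_point_spectrum M A"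
proof -
  obtain f where f: "f \<in> L2 M" "\<not> (AE x in M. f x = 0)"
    "\<And>k h. h \<in> L2 M \<Longrightarrow> l2_inner M (P k f) h = 0 \<and> l2_inner M (Q k f) h = 0"
    using common_kernel by blast
  have "AE x in M. A f x = 0 * f x"
  proof (rule A_eq_scalar_AE[OF f(1)])
    fix h assume "h \<in> L2 M"
    then show "l2_inner M (A f) h = 0 * l2_inner M f h"
      using inner_A_sums[OF f(1), of h] f(1,3) sums_unique2[OF _ sums_zero] by (simp add: inner_D)
  qed
  with f(1,2) show ?thesis
    unfolding l2_point_spectrum_def l2_eigenfunction_def by blast
qed

text \<open>
  If \<open>p\<close> lies in the range of \<open>P = P\<^sub>k\<close> and \<open>q = Q p\<close>, then \<open>P q = C p\<close> and \<open>Q q = q\<close>, so \<open>Q - P\<close> acts on the plane spanned by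
  \<open>p\<close> and \<open>q\<close>, and \<open>(c - 1) p + q\<close> is an eigenvector for \<open>c\<close> as soon as \<open>c\<^sup>2 = 1 - C\<close>.
\<close>

lemma block_eigenvalue:
  assumes c: "c\<^sup>2 = - (of_real (l k))\<^sup>2" and "c \<noteq> 0"
  shows "c \<in> l2_point_spectrum M A"
proof -
  obtain f where f: "f \<in> L2 M" "l2_inner M (P k f) f \<noteq> 0" using P_nonzero by blast
  define p q where "p = P k f" and "q = Q k p"
  have p: "p \<in> L2 M" and q: "q \<in> L2 M" using f by (simp_all add: p_def q_def)
  define u where "u x = (c - 1) * p x + q x" for x
  have u: "u \<in> L2 M" unfolding u_def using p q by auto
  have iu: "l2_inner M u h = (c - 1) * l2_inner M p h + l2_inner M q h" if "h \<in> L2 M" for h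
    unfolding u_def using p q that by (simp add: l2_inner_add_left l2_inner_cmult_left L2_cmult)
  have Cc: "of_real (C k) = 1 - c\<^sup>2"
    using arg_cong[OF l_square[of k], of complex_of_real] by (simp add: c)
  have PQpq: "l2_inner M p (Q k h) = l2_inner M p h" "l2_inner M q (Q k h) = (1 - c\<^sup>2) * l2_inner M p h"
    "l2_inner M p (P k h) = l2_inner M q h" "l2_inner M q (P k h) = l2_inner M q h"
    if h: "h \<in> L2 M" for h
    using f(1) h p q
    by (simp_all add: p_def q_def P_idem PQP Q_idem Cc flip: adjoint adjoint')
  have Dk: "l2_inner M (D k u) h = c * l2_inner M u h" if h: "h \<in> L2 M" for h
  proof -
    have "l2_inner M (D k u) h = l2_inner M u (P k h) - l2_inner M u (Q k h)"
      using u h by (simp add: inner_D adjoint adjoint')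
    also have "\<dots> = (c - 1) * (l2_inner M q h - l2_inner M p h)
        + (l2_inner M q h - (1 - c\<^sup>2) * l2_inner M p h)"
      using h by (simp add: iu PQpq algebra_simps)
    finally show ?thesis using h by (simp add: iu algebra_simps power2_eq_square)
  qed
  have Dj: "l2_inner M (D j u) h = 0" if h: "h \<in> L2 M" and "j \<noteq> k" for j h
    using u h that(2) f(1) p
    by (simp add: inner_D adjoint adjoint' iu)
      (simp add: p_def q_def orth_PP orth_PQ orth_QP orth_QQ)
  have "AE x in M. A u x = c * u x"
  proof (rule A_eq_scalar_AE[OF u])
    fix h assume h: "h \<in> L2 M"
    have "(\<lambda>j. l2_inner M (D j u) h) sums (\<Sum>j\<in>{k}. l2_inner M (D j u) h)"
      using h by (intro sums_finite) (auto simp: Dj)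
    then show "l2_inner M (A u) h = c * l2_inner M u h"
      using inner_A_sums[OF u h] Dk[OF h] sums_unique2 by force
  qed
  moreover have "\<not> (AE x in M. u x = 0)"
  proof
    assume "AE x in M. u x = 0"
    then have u0: "l2_inner M u h = 0" if "h \<in> L2 M" for h
      using l2_inner_cong_AE[OF u that L2_zero that] by simp
    have "l2_inner M u (Q k f) = (c - 1) * l2_inner M p f + (1 - c\<^sup>2) * l2_inner M p f"
      using f(1) by (simp add: iu PQpq)
    then have "c * (1 - c) * l2_inner M p f = 0"
      using u0[of "Q k f"] f(1) by (simp add: algebra_simps power2_eq_square)
    then have "c = 1" using \<open>c \<noteq> 0\<close> f(2) by (auto simp: p_def)
    then have "(of_real (l k))\<^sup>2 = (-1 :: complex)" using c by (metis minus_equation_iff power_one)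
    then have "(l k)\<^sup>2 = -1" by (metis of_real_1 of_real_eq_iff of_real_minus of_real_power)
    then show False by (metis zero_le_power2 neg_0_le_iff_le not_one_le_zero)
  qed
  ultimately show ?thesis using u unfolding l2_point_spectrum_def l2_eigenfunction_def by blast
qed

lemma point_spectrum: "l2_point_spectrum M A = S"
proof (rule antisym[OF point_spectrum_subset], rule subsetI)
  fix c assume "c \<in> S"
  then have "c = 0 \<or> (\<exists>k. c = \<i> * of_real (l k) \<or> c = - \<i> * of_real (l k))"
    by (auto simp: S_def)
  then have "c = 0 \<or> (\<exists>k. c\<^sup>2 = - (of_real (l k))\<^sup>2)" by (auto simp: power_mult_distrib)
  then show "c \<in> l2_point_spectrum M A" using zero_eigenvalue block_eigenvalue by metis
qed


subsection \<open>The resolvent\<close>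

lemma l_le: "l k \<le> sqrt K"
  unfolding l_def using C_le[of k] C_ge_1[of k] by simp

text \<open>
  On each block \<open>D\<^sup>3 = - l\<^sup>2 D\<close>, so \<open>(D - c)\<^sup>-\<^sup>1\<close> is the polynomial \<open>- 1 / c + a D + b D\<^sup>2\<close> with the
  coefficients below. They are bounded in \<open>k\<close> as long as \<open>c\<close> has positive distance from \<open>S\<close>.
\<close>

lemma resolvent_exists:
  assumes c: "c \<notin> closure S"
  shows "\<exists>R. l2_bounded_operator M R \<and>
     (\<forall>f\<in>L2 M. (AE x in M. A (R f) x - c * R f x = f x) \<and>
                (AE x in M. R (\<lambda>y. A f y - c * f y) x = f x))"
proof -
  obtain \<delta> where \<delta>: "\<delta> > 0" "\<And>s. s \<in> S \<Longrightarrow> \<delta> \<le> cmod (c - s)"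
    using c unfolding closure_approachable dist_norm by (metis norm_minus_commute not_le)
  have "0 \<in> S" by (simp add: S_def)
  then have c0: "cmod c \<ge> \<delta>" using \<delta>(2)[of 0] by simp
  then have cn: "c \<noteq> 0" using \<delta>(1) by auto
  define q where "q k = c\<^sup>2 + (of_real (l k))\<^sup>2" for k
  have q_ge: "cmod (q k) \<ge> \<delta>\<^sup>2" for k
  proof -
    have lS: "\<i> * of_real (l k) \<in> S" "- \<i> * of_real (l k) \<in> S" by (auto simp: S_def)
    then have "\<delta> * \<delta> \<le> cmod (c - \<i> * of_real (l k)) * cmod (c - (- \<i> * of_real (l k)))"
      using \<delta>(1) \<delta>(2)[OF lS(1)] \<delta>(2)[OF lS(2)] by (intro mult_mono) simp_all
    then show ?thesis unfolding q_def plus_square_factor norm_mult by (simp add: power2_eq_square)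
  qed
  have q0: "q k \<noteq> 0" for k
  proof
    assume "q k = 0"
    then show False using q_ge[of k] \<delta>(1) by simp
  qed
  define a b where "a k = - 1 / q k" and "b k = a k / c" for k
  have ab1: "a k = c * b k" for k using cn by (simp add: b_def)
  have ab2: "1 / c + b k * (of_real (l k))\<^sup>2 = - c * a k" for k
    using cn q0[of k] unfolding b_def a_def
    by (simp add: field_simps) (simp add: q_def power2_eq_square algebra_simps)
  have a_le: "cmod (a k) \<le> 1 / \<delta>\<^sup>2" for k
    unfolding a_def norm_divide using q_ge[of k] \<delta>(1) by (simp add: frac_le)
  have b_le: "cmod (b k) \<le> 1 / \<delta>\<^sup>2 / \<delta>" for k
    unfolding b_def norm_divide using a_le[of k] c0 \<delta>(1) by (intro frac_le) auto
  define B where "B = 1 / \<delta>\<^sup>2 + 1 / \<delta>\<^sup>2 / \<delta> * sqrt K"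
  have B0: "B \<ge> 0" unfolding B_def using \<delta>(1) K_ge_1 by simp
  define T where "T k f x = a k * D k f x + b k * D k (D k f) x" for k f x
  have T_L2: "T k f \<in> L2 M" if "f \<in> L2 M" for k f
    unfolding T_def using that by (intro L2_add L2_cmult) auto
  have inner_T: "l2_inner M (T k f) h = a k * l2_inner M (D k f) h + b k * l2_inner M (D k (D k f)) h"
    if "f \<in> L2 M" "h \<in> L2 M" for k f h
    unfolding T_def using that
    by (subst l2_inner_add_left) (auto simp: l2_inner_cmult_left)
  have inner_T': "l2_inner M (T k f) h = - a k * l2_inner M f (D k h) + b k * l2_inner M f (D k (D k h))"
    if "f \<in> L2 M" "h \<in> L2 M" for k f h
    using that by (simp add: inner_T D_skew)
  have T_norm: "l2_norm M (T k f) \<le> B * l2_norm M (D k f)" if f: "f \<in> L2 M" for k f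
  proof -
    have "l2_norm M (T k f) \<le> cmod (a k) * l2_norm M (D k f) + cmod (b k) * (l k * l2_norm M (D k f))"
      using l2_norm_triangle[of "\<lambda>x. a k * D k f x" M "\<lambda>x. b k * D k (D k f) x"] f
      unfolding T_def by (simp add: l2_norm_cmult D_square_norm L2_cmult)
    also have "\<dots> \<le> 1 / \<delta>\<^sup>2 * l2_norm M (D k f) + 1 / \<delta>\<^sup>2 / \<delta> * (sqrt K * l2_norm M (D k f))"
      using a_le[of k] b_le[of k] l_le[of k] l_nonneg[of k] \<delta>(1) K_ge_1
      by (intro add_mono mult_mono) auto
    finally show ?thesis by (simp add: B_def algebra_simps)
  qed
  have T_orth: "l2_inner M (T j f) (T k f) = 0" if f: "f \<in> L2 M" and "j \<noteq> k" for f j k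
  proof -
    have 1: "l2_inner M u (T k f) = 0" if "u \<in> L2 M" "\<And>v. v \<in> L2 M \<Longrightarrow> l2_inner M u (D k v) = 0" for u
      unfolding T_def using that f
      by (subst l2_inner_add_right) (auto simp: l2_inner_cmult_right)
    have "l2_inner M (D j f) (T k f) = 0" "l2_inner M (D j (D j f)) (T k f) = 0"
      using f \<open>j \<noteq> k\<close> by (auto intro!: 1 D_orth)
    then show ?thesis using f by (simp add: inner_T T_L2)
  qed
  define G where "G f = (SOME g. l2_sums M (\<lambda>k. T k f) g \<and> l2_norm M g \<le> B * sqrt (4 * K) * l2_norm M f)" for f
  have G: "l2_sums M (\<lambda>k. T k f) (G f) \<and> l2_norm M (G f) \<le> B * sqrt (4 * K) * l2_norm M f"
    if f: "f \<in> L2 M" for f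
  proof -
    have "(\<Sum>k<n. (l2_norm M (T k f))\<^sup>2) \<le> (B * sqrt (4 * K) * l2_norm M f)\<^sup>2" for n
    proof -
      have "(\<Sum>k<n. (l2_norm M (T k f))\<^sup>2) \<le> (\<Sum>k<n. B\<^sup>2 * (l2_norm M (D k f))\<^sup>2)"
        unfolding power_mult_distrib [symmetric] using T_norm[OF f]
        by (intro sum_mono power_mono) auto
      also have "\<dots> \<le> B\<^sup>2 * (4 * K * (l2_norm M f)\<^sup>2)"
        unfolding sum_distrib_left [symmetric] using D_Bessel[OF f] by (intro mult_left_mono) auto
      finally show ?thesis using K_ge_1 by (simp add: power_mult_distrib)
    qed
    then obtain g where "l2_sums M (\<lambda>k. T k f) g" "l2_norm M g \<le> B * sqrt (4 * K) * l2_norm M f"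
      using l2_orthogonal_series[of "\<lambda>k. T k f" M "B * sqrt (4 * K) * l2_norm M f"]
        T_L2[OF f] T_orth[OF f] B0 K_ge_1 by force
    then show ?thesis unfolding G_def by (intro someI_ex[of "\<lambda>g. l2_sums M (\<lambda>k. T k f) g \<and> l2_norm M g \<le> B * sqrt (4 * K) * l2_norm M f"]) blast
  qed
  have G_L2: "G f \<in> L2 M" if "f \<in> L2 M" for f using G[OF that] by (simp add: l2_sums_def)
  define R where "R f x = - (1 / c) * f x + G f x" for f x
  have R_L2: "R f \<in> L2 M" if "f \<in> L2 M" for f
    unfolding R_def using that G_L2 by (intro L2_add L2_cmult) auto
  have inner_R: "(\<lambda>k. - a k * l2_inner M f (D k h) + b k * l2_inner M f (D k (D k h)))
      sums (l2_inner M (R f) h + l2_inner M f h / c)" if f: "f \<in> L2 M" and h: "h \<in> L2 M" for f h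
  proof -
    have "l2_inner M (R f) h + l2_inner M f h / c = l2_inner M (G f) h"
      unfolding R_def l2_inner_add_left[OF L2_cmult[OF f] G_L2[OF f] h] l2_inner_cmult_left by simp
    then show ?thesis using l2_sums_inner[OF conjunct1[OF G[OF f]] h] f h by (simp add: inner_T')
  qed
  have bounded: "l2_bounded_operator M R"
    unfolding l2_bounded_operator_def
  proof (intro conjI ballI allI)
    fix f g assume f: "f \<in> L2 M" and g: "g \<in> L2 M"
    show "AE x in M. R (\<lambda>y. f y + g y) x = R f x + R g x"
    proof (rule AE_eq_if_l2_inner_eq)
      fix h assume h: "h \<in> L2 M"
      have "(\<lambda>k. - a k * l2_inner M (\<lambda>y. f y + g y) (D k h) + b k * l2_inner M (\<lambda>y. f y + g y) (D k (D k h)))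
          sums (l2_inner M (R f) h + l2_inner M f h / c + (l2_inner M (R g) h + l2_inner M g h / c))"
        using sums_add[OF inner_R[OF f h] inner_R[OF g h]] f g h
        by (simp add: l2_inner_add_left algebra_simps)
      from sums_unique2[OF this inner_R[OF L2_add[OF f g] h]]
      show "l2_inner M (R (\<lambda>y. f y + g y)) h = l2_inner M (\<lambda>x. R f x + R g x) h"
        using f g h by (simp add: l2_inner_add_left R_L2 add_divide_distrib)
    qed (use f g R_L2 in auto)
  next
    fix s f assume f: "f \<in> L2 M"
    show "AE x in M. R (\<lambda>y. s * f y) x = s * R f x"
    proof (rule AE_eq_if_l2_inner_eq)
      fix h assume h: "h \<in> L2 M"
      have "(\<lambda>k. - a k * l2_inner M (\<lambda>y. s * f y) (D k h) + b k * l2_inner M (\<lambda>y. s * f y) (D k (D k h)))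
          sums (s * (l2_inner M (R f) h + l2_inner M f h / c))"
        using sums_mult[OF inner_R[OF f h], of s] by (simp add: l2_inner_cmult_left algebra_simps)
      from sums_unique2[OF this inner_R[OF L2_cmult[OF f] h]]
      show "l2_inner M (R (\<lambda>y. s * f y)) h = l2_inner M (\<lambda>x. s * R f x) h"
        by (simp add: l2_inner_cmult_left algebra_simps)
    qed (use f R_L2 in auto)
  next
    show "\<exists>B'. \<forall>f\<in>L2 M. l2_norm M (R f) \<le> B' * l2_norm M f"
    proof (intro exI ballI)
      fix f assume f: "f \<in> L2 M"
      show "l2_norm M (R f) \<le> (cmod (1 / c) + B * sqrt (4 * K)) * l2_norm M f"
        using l2_norm_triangle[OF L2_cmult[OF f, of "- (1 / c)"] G_L2[OF f]] conjunct2[OF G[OF f]]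
        unfolding R_def l2_norm_cmult[of M "- (1 / c)"] norm_minus_cancel distrib_right
        by linarith
    qed
  qed (use R_L2 in auto)
  have right: "AE x in M. A (R f) x - c * R f x = f x" if f: "f \<in> L2 M" for f
  proof (rule AE_eq_if_l2_inner_eq)
    fix h assume h: "h \<in> L2 M"
    have DR: "l2_inner M (D k (R f)) h = c * (- a k * l2_inner M f (D k h) + b k * l2_inner M f (D k (D k h)))"
      for k
    proof -
      have "(\<lambda>j. - a j * l2_inner M f (D j (D k h)) + b j * l2_inner M f (D j (D j (D k h)))) sums
          (\<Sum>j\<in>{k}. - a j * l2_inner M f (D j (D k h)) + b j * l2_inner M f (D j (D j (D k h))))"
      proof (rule sums_finite)
        fix j assume "j \<notin> {k}"
        then have "j \<noteq> k" by simp
        then show "- a j * l2_inner M f (D j (D k h)) + b j * l2_inner M f (D j (D j (D k h))) = 0"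
          using f h D_D_orth[of f h j k] D_D_orth[of "D j f" h j k] D_skew[of f "D j (D k h)" j]
          by simp
      qed simp
      from sums_unique2[OF this inner_R[OF f, of "D k h"]] h
      have "l2_inner M (R f) (D k h) = - (1 / c) * l2_inner M f (D k h)
          - a k * l2_inner M f (D k (D k h)) + b k * l2_inner M f (D k (D k (D k h)))"
        by (simp add: field_simps)
      also have "l2_inner M f (D k (D k (D k h))) = - (of_real (l k))\<^sup>2 * l2_inner M f (D k h)"
        using D_cube_l[OF f h, of k] f h by (simp add: D_skew minus_equation_iff[of "l2_inner M f _"])
      finally have e: "l2_inner M (R f) (D k h) = - (1 / c) * l2_inner M f (D k h)
          - a k * l2_inner M f (D k (D k h)) + b k * (- (of_real (l k))\<^sup>2 * l2_inner M f (D k h))" .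
      have "l2_inner M (D k (R f)) h = (1 / c + b k * (of_real (l k))\<^sup>2) * l2_inner M f (D k h)
          + a k * l2_inner M f (D k (D k h))"
        unfolding D_skew[OF R_L2[OF f] h, of k] e by (simp add: algebra_simps)
      then show ?thesis unfolding ab2 by (simp add: ab1 algebra_simps)
    qed
    have "(\<lambda>k. l2_inner M (D k (R f)) h) sums (c * (l2_inner M (R f) h + l2_inner M f h / c))"
      unfolding DR by (rule sums_mult[OF inner_R[OF f h]])
    from sums_unique2[OF this inner_A_sums[OF R_L2[OF f] h]]
    show "l2_inner M (\<lambda>x. A (R f) x - c * R f x) h = l2_inner M f h"
      using f h R_L2[OF f] cn
      by (simp add: l2_inner_diff_left l2_inner_cmult_left L2_cmult algebra_simps)
  qed (use f R_L2[OF f] in auto)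
  have left: "AE x in M. R (\<lambda>y. A f y - c * f y) x = f x" if f: "f \<in> L2 M" for f
  proof (rule AE_eq_if_l2_inner_eq)
    define F where "F y = A f y - c * f y" for y
    have F: "F \<in> L2 M" unfolding F_def using f by auto
    fix h assume h: "h \<in> L2 M"
    have iF: "l2_inner M F u = l2_inner M (A f) u - c * l2_inner M f u" if "u \<in> L2 M" for u
      unfolding F_def using f that by (simp add: l2_inner_diff_left l2_inner_cmult_left L2_cmult)
    have "- a k * l2_inner M F (D k h) + b k * l2_inner M F (D k (D k h))
        = 1 / c * l2_inner M (D k f) h" for k
    proof -
      have F1: "l2_inner M F (D k h) = - l2_inner M f (D k (D k h)) - c * l2_inner M f (D k h)"
        using f h by (simp add: iF inner_A_D D_skew)
      have F2: "l2_inner M F (D k (D k h))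
          = (of_real (l k))\<^sup>2 * l2_inner M f (D k h) - c * l2_inner M f (D k (D k h))"
        using f h D_cube_l[OF f h, of k] by (simp add: iF inner_A_D D_skew)
      have "- a k * l2_inner M F (D k h) + b k * l2_inner M F (D k (D k h))
          = (a k - c * b k) * l2_inner M f (D k (D k h))
            + (c * a k + b k * (of_real (l k))\<^sup>2) * l2_inner M f (D k h)"
        unfolding F1 F2 by (simp add: algebra_simps)
      also have "c * a k + b k * (of_real (l k))\<^sup>2 = - (1 / c)"
      proof -
        have "b k * (of_real (l k))\<^sup>2 = - c * a k - 1 / c"
          using ab2[of k] by (simp add: eq_diff_eq add.commute)
        then show ?thesis by simp
      qed
      finally show ?thesis using f h by (simp add: D_skew flip: ab1)
    qed
    from sums_unique2[OF inner_R[OF F h, unfolded this] sums_mult[OF inner_A_sums[OF f h]]]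
    have "l2_inner M (R F) h + l2_inner M F h / c = 1 / c * l2_inner M (A f) h" .
    then have "l2_inner M (R F) h = l2_inner M f h"
      using h cn by (simp add: iF field_simps)
    then show "l2_inner M (R (\<lambda>y. A f y - c * f y)) h = l2_inner M f h"
      by (simp add: F_def [abs_def])
  qed (use f R_L2[OF L2_diff[OF A_L2[OF f] L2_cmult[OF f, of c]]] in auto)
  show ?thesis using bounded right left by blast
qed

text \<open>
  An eigenfunction \<open>e\<close> for \<open>c'\<close> would satisfy \<open>e = (c' - c) R e\<close> for the inverse \<open>R\<close> of \<open>A - c\<close>,
  which bounds \<open>\<bar>c' - c\<bar>\<close> from below.
\<close>

lemma spectrum_supset: "closure S \<subseteq> l2_spectrum M A"
proof
  fix c assume c: "c \<in> closure S"
  show "c \<in> l2_spectrum M A"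
  proof (rule ccontr)
    assume "c \<notin> l2_spectrum M A"
    then obtain R where R: "l2_bounded_operator M R"
      and inv: "\<And>f. f \<in> L2 M \<Longrightarrow> AE x in M. R (\<lambda>y. A f y - c * f y) x = f x"
      unfolding l2_spectrum_def by blast
    obtain B where B: "\<And>f. f \<in> L2 M \<Longrightarrow> l2_norm M (R f) \<le> B * l2_norm M f"
      using R unfolding l2_bounded_operator_def by blast
    have R_L2: "R f \<in> L2 M" if "f \<in> L2 M" for f
      using R that unfolding l2_bounded_operator_def by blast
    obtain c' where c': "c' \<in> S" "dist c' c < 1 / (\<bar>B\<bar> + 1)"
      using c unfolding closure_approachable by (meson abs_ge_zero add_nonneg_pos zero_less_divide_1_iff zero_less_one)
    then obtain e where e: "e \<in> L2 M" "\<not> (AE x in M. e x = 0)" "AE x in M. A e x = c' * e x"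
      using point_spectrum unfolding l2_point_spectrum_def l2_eigenfunction_def by blast
    define u where "u y = A e y - c * e y" for y
    have u: "u \<in> L2 M" unfolding u_def using e by auto
    have "l2_norm M u = l2_norm M (\<lambda>y. (c' - c) * e y)"
    proof -
      have "AE y in M. u y = (c' - c) * e y"
        using e(3) by eventually_elim (simp add: u_def algebra_simps)
      then have "l2_inner M u u = l2_inner M (\<lambda>y. (c' - c) * e y) (\<lambda>y. (c' - c) * e y)"
        using u e by (intro l2_inner_cong_AE) auto
      then have "(l2_norm M u)\<^sup>2 = (l2_norm M (\<lambda>y. (c' - c) * e y))\<^sup>2"
        unfolding l2_inner_self of_real_eq_iff .
      then show ?thesis by simp
    qed
    then have nu: "l2_norm M u = cmod (c' - c) * l2_norm M e" by (simp only: l2_norm_cmult)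
    have ne: "l2_norm M e > 0"
      using e l2_norm_eq_0_iff[of e M] l2_norm_nonneg[of M e] by linarith
    have "l2_inner M e e = l2_inner M (R u) (R u)"
      using inv[OF e(1)] e R_L2[OF u] unfolding u_def [symmetric]
      by (intro l2_inner_cong_AE) (auto elim: eventually_mono)
    then have "(l2_norm M e)\<^sup>2 = (l2_norm M (R u))\<^sup>2"
      unfolding l2_inner_self of_real_eq_iff .
    then have "l2_norm M e = l2_norm M (R u)" by simp
    also have "\<dots> \<le> B * (cmod (c' - c) * l2_norm M e)" using B[OF u] nu by simp
    also have "\<dots> \<le> (\<bar>B\<bar> + 1) * (cmod (c' - c) * l2_norm M e)"
      by (intro mult_right_mono) auto
    also have "\<dots> < (\<bar>B\<bar> + 1) * (1 / (\<bar>B\<bar> + 1) * l2_norm M e)"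
      using c'(2) ne unfolding dist_norm by (intro mult_strict_left_mono mult_strict_right_mono) auto
    also have "\<dots> = l2_norm M e" by simp
    finally show False by simp
  qed
qed

lemma spectrum: "l2_spectrum M A = closure S"
  using spectrum_supset resolvent_exists unfolding l2_spectrum_def by blast


subsection \<open>An orthogonal basis of eigenfunctions\<close>

text \<open>
  Different blocks may share the value \<open>C\<^sub>k\<close>, and then an eigenfunction of \<open>A\<close> need not be one of
  every \<open>D\<^sub>k\<close>. The orthogonal complement of a set of joint eigenfunctions, however, is invariant
  under every \<open>D\<^sub>k\<close>.
\<close>

definition joint_eigenfunctions :: "('a \<Rightarrow> complex) set" where
  "joint_eigenfunctions = {e \<in> L2 M. \<not> (AE x in M. e x = 0) \<and>
     (\<forall>k. \<exists>c. \<forall>h\<in>L2 M. l2_inner M (D k e) h = c * l2_inner M e h)}"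

lemma l2_norm_pos: "\<lbrakk>e \<in> L2 M; \<not> (AE x in M. e x = 0)\<rbrakk> \<Longrightarrow> l2_norm M e > 0"
  using l2_norm_eq_0_iff[of e M] l2_norm_nonneg[of M e] by linarith

lemma joint_eigenfunction_A:
  assumes "e \<in> joint_eigenfunctions"
  shows "\<exists>c. l2_eigenfunction M A c e"
proof -
  have e: "e \<in> L2 M" "\<not> (AE x in M. e x = 0)"
    using assms by (auto simp: joint_eigenfunctions_def)
  have "\<forall>k. \<exists>c. \<forall>h\<in>L2 M. l2_inner M (D k e) h = c * l2_inner M e h"
    using assms by (auto simp: joint_eigenfunctions_def)
  then obtain c where c: "\<And>k h. h \<in> L2 M \<Longrightarrow> l2_inner M (D k e) h = c k * l2_inner M e h"
    by metis
  have ee: "l2_inner M e e \<noteq> 0" using l2_norm_pos[OF e] by (simp add: l2_inner_self)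
  have c0: "c i * c j = 0" if "i \<noteq> j" for i j
  proof -
    have "0 = l2_inner M (D i e) (D j e)" using D_orth[OF e(1) e(1) that] by simp
    also have "\<dots> = c i * l2_inner M e (D j e)" using e(1) by (simp add: c)
    also have "l2_inner M e (D j e) = - (c j * l2_inner M e e)"
      using D_skew[OF e(1) e(1), of j] c[OF e(1), of j] by (metis minus_equation_iff)
    finally show ?thesis using ee by simp
  qed
  obtain i where i: "\<And>j. j \<noteq> i \<Longrightarrow> c j = 0" using c0 by (metis mult_eq_0_iff)
  have "AE x in M. A e x = c i * e x"
  proof (rule A_eq_scalar_AE[OF e(1)])
    fix h assume h: "h \<in> L2 M"
    have "(\<lambda>k. l2_inner M (D k e) h) sums (\<Sum>k\<in>{i}. l2_inner M (D k e) h)"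
      using h i by (intro sums_finite) (auto simp: c)
    from sums_unique2[OF this inner_A_sums[OF e(1) h]]
    show "l2_inner M (A e) h = c i * l2_inner M e h" using h by (simp add: c)
  qed
  then show ?thesis using e unfolding l2_eigenfunction_def by blast
qed

text \<open>
  For \<open>g = D\<^sub>k f\<close> the identity \<open>D\<^sub>k\<^sup>2 g = - l\<^sup>2 g\<close> makes \<open>D\<^sub>k g \<plusminus> i l g\<close> eigenfunctions or zero; if both vanish then so does \<open>l g\<close>.
\<close>

lemma joint_eigenfunction_orthogonal:
  assumes w: "w \<in> L2 M" "\<not> (AE x in M. w x = 0)"
    and E: "E \<subseteq> joint_eigenfunctions" "\<And>e. e \<in> E \<Longrightarrow> l2_inner M w e = 0"
  obtains u where "u \<in> joint_eigenfunctions" "\<And>e. e \<in> E \<Longrightarrow> l2_inner M u e = 0"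
proof (cases "\<forall>k. \<forall>h\<in>L2 M. l2_inner M (D k w) h = 0")
  case True
  then have "w \<in> joint_eigenfunctions"
    unfolding joint_eigenfunctions_def using w by (auto intro!: exI[of _ 0])
  then show thesis using E(2) that by blast
next
  case False
  then obtain k h0 where h0: "h0 \<in> L2 M" "l2_inner M (D k w) h0 \<noteq> 0" by blast
  define g where "g = D k w"
  have g: "g \<in> L2 M" using w by (simp add: g_def)
  have E_L2: "E \<subseteq> L2 M" using E(1) by (auto simp: joint_eigenfunctions_def)
  have D_perp: "l2_inner M (D k v) e = 0"
    if v: "v \<in> L2 M" and eE: "e \<in> E" and perp: "\<And>e. e \<in> E \<Longrightarrow> l2_inner M v e = 0" for v e
  proof -
    obtain c where c: "\<And>h. h \<in> L2 M \<Longrightarrow> l2_inner M (D k e) h = c * l2_inner M e h"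
      using eE E(1) unfolding joint_eigenfunctions_def by blast
    have e: "e \<in> L2 M" using eE E_L2 by blast
    have "l2_inner M v (D k e) = cnj (c * l2_inner M e v)"
      using v by (simp add: l2_inner_cnj flip: c)
    also have "\<dots> = cnj c * l2_inner M v e" by (simp add: l2_inner_cnj)
    finally show ?thesis using v eE perp e by (simp add: D_skew)
  qed
  have g_perp: "l2_inner M g e = 0" if "e \<in> E" for e
    unfolding g_def using w(1) that E(2) by (rule D_perp)
  have D2g: "l2_inner M (D k (D k g)) h = - (of_real (l k))\<^sup>2 * l2_inner M g h" if "h \<in> L2 M" for h
    unfolding g_def by (rule D_cube_l[OF w(1) that])
  define u where "u \<sigma> x = D k g x + \<sigma> * g x" for \<sigma> :: complex and x
  have u: "u \<sigma> \<in> L2 M" for \<sigma> unfolding u_def using g by auto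
  have iu: "l2_inner M (u \<sigma>) h = l2_inner M (D k g) h + \<sigma> * l2_inner M g h" if "h \<in> L2 M" for \<sigma> h
    unfolding u_def using g that by (subst l2_inner_add_left) (auto simp: l2_inner_cmult_left)
  have u_perp: "l2_inner M (u \<sigma>) e = 0" if "e \<in> E" for \<sigma> e
    using that E_L2 D_perp[OF g that g_perp] g_perp[OF that] by (subst iu) auto
  have u_joint: "u \<sigma> \<in> joint_eigenfunctions"
    if "\<sigma>\<^sup>2 = - (of_real (l k))\<^sup>2" "\<not> (AE x in M. u \<sigma> x = 0)" for \<sigma>
  proof -
    have "\<exists>c. \<forall>h\<in>L2 M. l2_inner M (D j (u \<sigma>)) h = c * l2_inner M (u \<sigma>) h" for j
    proof (cases "j = k")
      case True
      have "l2_inner M (D k (u \<sigma>)) h = \<sigma> * l2_inner M (u \<sigma>) h" if h: "h \<in> L2 M" for h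
      proof -
        have "l2_inner M (D k (u \<sigma>)) h = - l2_inner M (D k g) (D k h) - \<sigma> * l2_inner M g (D k h)"
          using u h by (simp add: D_skew[of "u \<sigma>"] iu)
        also have "\<dots> = l2_inner M (D k (D k g)) h + \<sigma> * l2_inner M (D k g) h"
          using g h by (simp add: D_skew[of "D k g"] D_skew[of g])
        also have "\<dots> = \<sigma> * l2_inner M (u \<sigma>) h"
          using h \<open>\<sigma>\<^sup>2 = _\<close>
          by (simp add: iu D2g power2_eq_square distrib_left flip: mult.assoc)
        finally show ?thesis .
      qed
      with True show ?thesis by blast
    next
      case False
      have "l2_inner M (D j (u \<sigma>)) h = 0 * l2_inner M (u \<sigma>) h" if h: "h \<in> L2 M" for h
        using u h False g w(1) D_orth[of w h k j] D_orth[of g h k j]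
        by (simp add: D_skew[of "u \<sigma>"] iu) (simp add: g_def)
      then show ?thesis by blast
    qed
    then show ?thesis using that(2) u unfolding joint_eigenfunctions_def by blast
  qed
  define \<sigma> where "\<sigma> = \<i> * complex_of_real (l k)"
  have \<sigma>2: "\<sigma>\<^sup>2 = - (of_real (l k))\<^sup>2" "(-\<sigma>)\<^sup>2 = - (of_real (l k))\<^sup>2"
    by (simp_all add: \<sigma>_def power_mult_distrib)
  have "\<not> (AE x in M. u \<sigma> x = 0) \<or> \<not> (AE x in M. u (-\<sigma>) x = 0)"
  proof (rule ccontr)
    assume "\<not> ?thesis"
    then have "AE x in M. u \<sigma> x = 0" "AE x in M. u (-\<sigma>) x = 0" by auto
    then have 0: "l2_inner M (u \<sigma>) h = 0" "l2_inner M (u (-\<sigma>)) h = 0" if "h \<in> L2 M" for h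
      using l2_inner_cong_AE[OF u that L2_zero that] by auto
    have "\<sigma> \<noteq> 0"
    proof
      assume "\<sigma> = 0"
      then have "l2_inner M (D k g) w = 0" using 0(1)[OF w(1)] w(1) by (simp add: iu)
      then have "l2_inner M g g = 0" using g w(1) by (simp add: D_skew g_def)
      then have "l2_norm M g = 0" by (simp add: l2_inner_self)
      then show False using l2_Cauchy_Schwarz[OF g h0(1)] h0(2) by (simp add: g_def)
    qed
    moreover have "2 * \<sigma> * l2_inner M g h0 = 0" using 0[OF h0(1)] h0(1) by (simp add: iu)
    ultimately show False using h0(2) by (simp add: g_def)
  qed
  then show thesis using u_joint \<sigma>2 u_perp that by blast
qed

text \<open>
  A maximal orthogonal set of joint eigenfunctions spans a dense subspace: what remains of \<open>f\<close> after
  subtracting its orthogonal expansion is orthogonal to the set, so it would otherwise provide one more joint eigenfunction. By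
  Bessel's inequality only countably many coefficients of \<open>f\<close> are nonzero, so the expansion is a series.
\<close>

lemma eigenfunction_basis:
  "\<exists>E. l2_orthogonal_basis M E \<and> (\<forall>e\<in>E. \<exists>c. l2_eigenfunction M A c e)"
proof -
  define \<E> where "\<E> = {E. E \<subseteq> joint_eigenfunctions \<and> (\<forall>e\<in>E. \<forall>e'\<in>E. e \<noteq> e' \<longrightarrow> l2_inner M e e' = 0)}"
  have "\<exists>E\<in>\<E>. \<forall>X\<in>\<E>. E \<subseteq> X \<longrightarrow> X = E"
  proof (rule subset_Zorn')
    fix \<C> assume chain: "subset.chain \<E> \<C>"
    then have sub: "\<C> \<subseteq> \<E>" and lin: "\<And>X Y. X \<in> \<C> \<Longrightarrow> Y \<in> \<C> \<Longrightarrow> X \<subseteq> Y \<or> Y \<subseteq> X"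
      by (auto simp: subset_chain_def)
    have "l2_inner M e e' = 0" if ee: "e \<in> \<Union>\<C>" "e' \<in> \<Union>\<C>" "e \<noteq> e'" for e e'
    proof -
      obtain X Y where "X \<in> \<C>" "Y \<in> \<C>" "e \<in> X" "e' \<in> Y" using ee by blast
      then obtain Z where "Z \<in> \<C>" "e \<in> Z" "e' \<in> Z" using lin[of X Y] by blast
      then show ?thesis using sub ee(3) unfolding \<E>_def by blast
    qed
    then show "\<Union>\<C> \<in> \<E>" using sub unfolding \<E>_def by blast
  qed
  then obtain E where E: "E \<in> \<E>" and maxi: "\<And>X. X \<in> \<E> \<Longrightarrow> E \<subseteq> X \<Longrightarrow> X = E" by blast
  have Ej: "E \<subseteq> joint_eigenfunctions"
    and orth: "\<And>e e'. e \<in> E \<Longrightarrow> e' \<in> E \<Longrightarrow> e \<noteq> e' \<Longrightarrow> l2_inner M e e' = 0"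
    using E by (auto simp: \<E>_def)
  have E_L2: "e \<in> L2 M" and E_n0: "\<not> (AE x in M. e x = 0)" if "e \<in> E" for e
    using that Ej by (auto simp: joint_eigenfunctions_def)
  have npos: "l2_norm M e > 0" if "e \<in> E" for e using l2_norm_pos E_L2 E_n0 that by blast
  have dense: "\<exists>F c. finite F \<and> F \<subseteq> E \<and> l2_norm M (\<lambda>x. f x - (\<Sum>e\<in>F. c e * e x)) < \<epsilon>"
    if f: "f \<in> L2 M" and "\<epsilon> > 0" for f \<epsilon>
  proof -
    define c where "c e = l2_inner M f e / of_real ((l2_norm M e)\<^sup>2)" for e
    define u where "u e x = c e * e x" for e x
    have u: "u e \<in> L2 M" if "e \<in> E" for e unfolding u_def using E_L2[OF that] by auto
    have u_orth: "l2_inner M (u e) e' = 0" if "e \<in> E" "e' \<in> E" "e \<noteq> e'" for e e'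
      unfolding u_def l2_inner_cmult_left using orth[OF that] by simp
    have u_orth': "l2_inner M (u e) (u e') = 0" if "e \<in> E" "e' \<in> E" "e \<noteq> e'" for e e'
      unfolding u_def[of e'] l2_inner_cmult_right using u_orth[OF that] by simp
    have u_e: "l2_inner M (u e) e = l2_inner M f e" if "e \<in> E" for e
      unfolding u_def l2_inner_cmult_left c_def using npos[OF that] by (simp add: l2_inner_self)
    have fu: "l2_inner M f (u e) = of_real ((l2_norm M (u e))\<^sup>2)" if "e \<in> E" for e
    proof -
      have "l2_inner M v (u e) = cnj (c e) * l2_inner M v e" for v
        unfolding u_def l2_inner_cmult_right ..
      then show ?thesis unfolding l2_inner_self [symmetric] using u_e[OF that] by simp
    qed
    have Bessel: "(\<Sum>e\<in>F. (l2_norm M (u e))\<^sup>2) \<le> (l2_norm M f)\<^sup>2" if "finite F" "F \<subseteq> E" for F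
    proof -
      define v where "v x = (\<Sum>e\<in>F. u e x)" for x
      have v: "v \<in> L2 M" unfolding v_def using u that by auto
      have "(l2_norm M v)\<^sup>2 = (\<Sum>e\<in>F. (l2_norm M (u e))\<^sup>2)"
        unfolding v_def using that by (intro l2_norm_sum_orthogonal u u_orth') auto
      moreover have "l2_inner M f v = of_real (\<Sum>e\<in>F. (l2_norm M (u e))\<^sup>2)"
        unfolding v_def using that u f fu
        by (subst l2_inner_sum_right) (auto intro!: sum.cong)
      moreover have "0 \<le> (l2_norm M (\<lambda>x. f x - v x))\<^sup>2" by simp
      ultimately show ?thesis unfolding l2_norm_diff_square[OF f v] by simp
    qed
    have "(\<lambda>e. (l2_norm M (u e))\<^sup>2) summable_on E"
      by (rule nonneg_bdd_above_summable_on) (auto intro!: bdd_aboveI2 Bessel)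
    then have "countable {e\<in>E. (l2_norm M (u e))\<^sup>2 \<noteq> 0}"
      by (rule summable_countable_real)
    moreover define B where "B = {e\<in>E. (l2_norm M (u e))\<^sup>2 \<noteq> 0}"
    ultimately have B: "countable B" "B \<subseteq> E" by auto
    have notB: "l2_inner M f e = 0" if "e \<in> E" "e \<notin> B" for e
    proof -
      have "cmod (c e) * l2_norm M e = 0"
        using that unfolding B_def u_def l2_norm_cmult by simp
      then show ?thesis using npos[OF that(1)] by (simp add: c_def)
    qed
    define N where "N = to_nat_on B ` B"
    define b where "b = from_nat_into B"
    have bB: "b n \<in> B" if "n \<in> N" for n using that B(1) by (auto simp: N_def b_def)
    have b_inj: "inj_on b N"
      unfolding N_def b_def using B(1) by (auto intro!: inj_onI)
    define T where "T n = (if n \<in> N then u (b n) else (\<lambda>x. 0))" for n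
    have T: "T n \<in> L2 M" for n unfolding T_def using u bB B(2) by auto
    have T_orth: "l2_inner M (T m) (T n) = 0" if "m \<noteq> n" for m n
      unfolding T_def using that bB B(2) inj_onD[OF b_inj] by (auto intro!: u_orth')
    have sum_T: "(\<Sum>k<n. F (T k)) = (\<Sum>e\<in>b ` ({..<n} \<inter> N). F (u e))"
      if "F (\<lambda>x. 0) = 0" for n and F :: "('a \<Rightarrow> complex) \<Rightarrow> 'b::comm_monoid_add"
    proof -
      have "(\<Sum>k<n. F (T k)) = (\<Sum>k\<in>{..<n} \<inter> N. F (T k))"
        using that by (intro sum.mono_neutral_right) (auto simp: T_def)
      also have "\<dots> = (\<Sum>k\<in>{..<n} \<inter> N. F (u (b k)))"
        by (intro sum.cong) (auto simp: T_def)
      also have "\<dots> = (\<Sum>e\<in>b ` ({..<n} \<inter> N). F (u e))"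
        using b_inj by (subst sum.reindex) (auto intro: inj_on_subset)
      finally show ?thesis .
    qed
    have sub: "b ` ({..<n} \<inter> N) \<subseteq> E" for n using bB B(2) by auto
    have "(\<Sum>k<n. (l2_norm M (T k))\<^sup>2) \<le> (l2_norm M f)\<^sup>2" for n
      using sum_T[of "\<lambda>v. (l2_norm M v)\<^sup>2" n] Bessel[OF _ sub[of n]] by simp
    then obtain g where sums: "l2_sums M T g"
      using l2_orthogonal_series[of T M "l2_norm M f"] T T_orth by force
    have g: "g \<in> L2 M" using sums by (simp add: l2_sums_def)
    have ge: "l2_inner M g e = l2_inner M f e" if e: "e \<in> E" for e
    proof (cases "e \<in> B")
      case True
      define m where "m = to_nat_on B e"
      have m: "m \<in> N" "b m = e" using True B(1) by (auto simp: m_def N_def b_def)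
      have "(\<lambda>n. l2_inner M (T n) e) sums (\<Sum>n\<in>{m}. l2_inner M (T n) e)"
      proof (rule sums_finite)
        fix n assume "n \<notin> {m}"
        then show "l2_inner M (T n) e = 0"
          using bB B(2) e m inj_onD[OF b_inj, of n m] by (auto simp: T_def intro!: u_orth)
      qed simp
      from sums_unique2[OF this l2_sums_inner[OF sums E_L2[OF e]]]
      show ?thesis using m u_e[OF e] by (simp add: T_def)
    next
      case False
      have "l2_inner M (T n) e = 0" for n
        using bB B(2) e False by (auto simp: T_def intro!: u_orth)
      then show ?thesis
        using sums_unique2[OF l2_sums_inner[OF sums E_L2[OF e]] , of 0] notB[OF e False] by simp
    qed
    have "AE x in M. f x - g x = 0"
    proof (rule ccontr)
      assume n0: "\<not> (AE x in M. f x - g x = 0)"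
      have "l2_inner M (\<lambda>x. f x - g x) e = 0" if "e \<in> E" for e
        using ge[OF that] E_L2[OF that] f g by (simp add: l2_inner_diff_left)
      then obtain w where w: "w \<in> joint_eigenfunctions" "\<And>e. e \<in> E \<Longrightarrow> l2_inner M w e = 0"
        using joint_eigenfunction_orthogonal[OF L2_diff[OF f g] n0 Ej] by blast
      have "insert w E \<in> \<E>"
        unfolding \<E>_def using w Ej orth by auto (metis complex_cnj_zero l2_inner_cnj)
      then have "w \<in> E" using maxi by blast
      then have "l2_inner M w w = 0" using w(2) by blast
      then have "l2_norm M w = 0" by (simp add: l2_inner_self)
      then show False using npos[OF \<open>w \<in> E\<close>] by simp
    qed
    then have fg: "AE x in M. f x = g x" by simp
    have "(\<lambda>n. l2_norm M (\<lambda>x. (\<Sum>k<n. T k x) - g x)) \<longlonglongrightarrow> 0"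
      using sums by (simp add: l2_sums_def)
    then obtain n where n: "l2_norm M (\<lambda>x. (\<Sum>k<n. T k x) - g x) < \<epsilon>"
      using order_tendstoD(2)[OF _ \<open>\<epsilon> > 0\<close>] by (force simp: eventually_sequentially)
    define F where "F = b ` ({..<n} \<inter> N)"
    have "l2_norm M (\<lambda>x. f x - (\<Sum>e\<in>F. c e * e x)) = l2_norm M (\<lambda>x. (\<Sum>k<n. T k x) - g x)"
    proof -
      have "(\<Sum>k<n. T k x) = (\<Sum>e\<in>F. c e * e x)" for x
        using sum_T[of "\<lambda>v. v x" n] by (simp add: F_def u_def)
      then have eq: "l2_norm M (\<lambda>x. (\<Sum>k<n. T k x) - g x) = l2_norm M (\<lambda>x. g x - (\<Sum>e\<in>F. c e * e x))"
        by (simp add: l2_norm_minus_commute[of M g])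
      have sL2: "(\<lambda>x. \<Sum>e\<in>F. c e * e x) \<in> L2 M"
        using sub[of n] unfolding F_def by (intro L2_sum L2_cmult E_L2) auto
      have "l2_inner M (\<lambda>x. f x - (\<Sum>e\<in>F. c e * e x)) (\<lambda>x. f x - (\<Sum>e\<in>F. c e * e x))
          = l2_inner M (\<lambda>x. g x - (\<Sum>e\<in>F. c e * e x)) (\<lambda>x. g x - (\<Sum>e\<in>F. c e * e x))"
        using fg by (intro l2_inner_cong_AE L2_diff f g sL2) auto
      then have "(l2_norm M (\<lambda>x. f x - (\<Sum>e\<in>F. c e * e x)))\<^sup>2
          = (l2_norm M (\<lambda>x. g x - (\<Sum>e\<in>F. c e * e x)))\<^sup>2"
        unfolding l2_inner_self of_real_eq_iff .
      then show ?thesis unfolding eq by simp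
    qed
    then show ?thesis using n sub[of n] by (intro exI[of _ F] exI[of _ c]) (auto simp: F_def)
  qed
  have "l2_orthogonal_basis M E"
    unfolding l2_orthogonal_basis_def using E_L2 E_n0 orth dense by auto
  then show ?thesis using Ej joint_eigenfunction_A by blast
qed

end

section \<open>Integral operators with Schur kernels\<close>

definition kernel_op :: "'a measure \<Rightarrow> ('a \<Rightarrow> 'a \<Rightarrow> complex) \<Rightarrow> ('a \<Rightarrow> complex) \<Rightarrow> 'a \<Rightarrow> complex" where
  "kernel_op \<nu> K g z = (\<integral>w. K z w * g w \<partial>\<nu>)"

definition kernel_comp ::
  "'a measure \<Rightarrow> ('a \<Rightarrow> 'a \<Rightarrow> complex) \<Rightarrow> ('a \<Rightarrow> 'a \<Rightarrow> complex) \<Rightarrow> 'a \<Rightarrow> 'a \<Rightarrow> complex" where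
  "kernel_comp \<nu> K K' z w = (\<integral>u. K z u * K' u w \<partial>\<nu>)"

definition kernel_adjoint :: "('a \<Rightarrow> 'a \<Rightarrow> complex) \<Rightarrow> 'a \<Rightarrow> 'a \<Rightarrow> complex" where
  "kernel_adjoint K z w = cnj (K w z)"

text \<open>
  The weight \<open>h\<close> is the same for rows and columns of the kernels. This makes the class of Schur
  kernels closed under adjoints and compositions.
\<close>

locale schur_weight = sigma_finite_measure \<nu> for \<nu> :: "'a measure" +
  fixes h :: "'a \<Rightarrow> real"
  assumes h_measurable [measurable]: "h \<in> borel_measurable \<nu>"
    and h_pos: "x \<in> space \<nu> \<Longrightarrow> h x > 0"
begin

sublocale pair: pair_sigma_finite \<nu> \<nu> ..

definition schur_kernel :: "('a \<Rightarrow> 'a \<Rightarrow> complex) \<Rightarrow> real \<Rightarrow> bool" where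
  "schur_kernel K B \<longleftrightarrow> B \<ge> 0 \<and> case_prod K \<in> borel_measurable (\<nu> \<Otimes>\<^sub>M \<nu>) \<and>
     (\<forall>z\<in>space \<nu>. (\<integral>\<^sup>+w. ennreal (norm (K z w)) * ennreal (h w) \<partial>\<nu>) \<le> ennreal B * ennreal (h z)) \<and>
     (\<forall>w\<in>space \<nu>. (\<integral>\<^sup>+z. ennreal (norm (K z w)) * ennreal (h z) \<partial>\<nu>) \<le> ennreal B * ennreal (h w))"

lemma schur_kernelD:
  assumes "schur_kernel K B"
  shows "B \<ge> 0" "case_prod K \<in> borel_measurable (\<nu> \<Otimes>\<^sub>M \<nu>)"
    "\<And>z. z \<in> space \<nu> \<Longrightarrow> (\<integral>\<^sup>+w. ennreal (norm (K z w)) * ennreal (h w) \<partial>\<nu>) \<le> ennreal B * ennreal (h z)"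
    "\<And>w. w \<in> space \<nu> \<Longrightarrow> (\<integral>\<^sup>+z. ennreal (norm (K z w)) * ennreal (h z) \<partial>\<nu>) \<le> ennreal B * ennreal (h w)"
  using assms unfolding schur_kernel_def by auto

lemma schur_kernel_adjoint:
  assumes "schur_kernel K B"
  shows "schur_kernel (kernel_adjoint K) B"
proof -
  note [measurable] = schur_kernelD(2)[OF assms]
  have "(\<lambda>(z, w). cnj (case_prod K (w, z))) \<in> borel_measurable (\<nu> \<Otimes>\<^sub>M \<nu>)" by measurable
  then show ?thesis
    using schur_kernelD[OF assms] unfolding schur_kernel_def kernel_adjoint_def by simp
qed

lemma kernel_measurable:
  assumes "schur_kernel K B" "z \<in> space \<nu>"
  shows "(\<lambda>w. K z w) \<in> borel_measurable \<nu>" "(\<lambda>w. K w z) \<in> borel_measurable \<nu>"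
  using schur_kernelD(2)[OF assms(1)] assms(2) by measurable

text \<open>
  The Cauchy--Schwarz inequality for the factors \<open>(\<bar>K\<bar> h)\<^sup>1\<^sup>/\<^sup>2\<close> and \<open>(\<bar>K\<bar> / h)\<^sup>1\<^sup>/\<^sup>2 g\<close> uses the bound on the
  rows of the kernel; after integration over \<open>z\<close> the bound on the columns applies.
\<close>

lemma schur_test:
  assumes K: "schur_kernel K B" and g [measurable]: "g \<in> borel_measurable \<nu>"
  shows "(\<integral>\<^sup>+z. (\<integral>\<^sup>+w. ennreal (norm (K z w)) * g w \<partial>\<nu>)\<^sup>2 \<partial>\<nu>)
    \<le> ennreal (B\<^sup>2) * (\<integral>\<^sup>+w. (g w)\<^sup>2 \<partial>\<nu>)"
proof -
  note [measurable] = schur_kernelD(2)[OF K]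
  have B: "B \<ge> 0" by (rule schur_kernelD(1)[OF K])
  define v where "v z w = ennreal (norm (K z w)) * ennreal (1 / h w) * (g w)\<^sup>2" for z w
  have v_meas [measurable]: "case_prod v \<in> borel_measurable (\<nu> \<Otimes>\<^sub>M \<nu>)"
    unfolding v_def by measurable
  have row: "(\<integral>\<^sup>+w. ennreal (norm (K z w)) * g w \<partial>\<nu>)\<^sup>2
      \<le> ennreal B * ennreal (h z) * (\<integral>\<^sup>+w. v z w \<partial>\<nu>)" if z: "z \<in> space \<nu>" for z
  proof -
    note [measurable] = kernel_measurable(1)[OF K z]
    have "(\<integral>\<^sup>+w. ennreal (norm (K z w)) * g w \<partial>\<nu>)\<^sup>2
        = (\<integral>\<^sup>+w. ennreal (sqrt (norm (K z w) * h w)) * (ennreal (sqrt (norm (K z w) / h w)) * g w) \<partial>\<nu>)\<^sup>2"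
    proof (intro arg_cong[of _ _ "\<lambda>x. x\<^sup>2"] nn_integral_cong)
      fix w assume w: "w \<in> space \<nu>"
      have "sqrt (norm (K z w) * h w) * sqrt (norm (K z w) / h w) = norm (K z w)"
        using h_pos[OF w] by (simp add: real_sqrt_mult [symmetric] power2_eq_square [symmetric])
      then show "ennreal (norm (K z w)) * g w
        = ennreal (sqrt (norm (K z w) * h w)) * (ennreal (sqrt (norm (K z w) / h w)) * g w)"
        using h_pos[OF w] by (simp add: mult.assoc [symmetric] ennreal_mult [symmetric])
    qed
    also have "\<dots> \<le> (\<integral>\<^sup>+w. (ennreal (sqrt (norm (K z w) * h w)))\<^sup>2 \<partial>\<nu>)
        * (\<integral>\<^sup>+w. (ennreal (sqrt (norm (K z w) / h w)) * g w)\<^sup>2 \<partial>\<nu>)"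
      by (rule Cauchy_Schwarz_nn_integral) measurable
    also have "(\<integral>\<^sup>+w. (ennreal (sqrt (norm (K z w) * h w)))\<^sup>2 \<partial>\<nu>)
        = (\<integral>\<^sup>+w. ennreal (norm (K z w)) * ennreal (h w) \<partial>\<nu>)"
      using h_pos by (intro nn_integral_cong) (simp add: ennreal_power less_imp_le ennreal_mult)
    also have "(\<integral>\<^sup>+w. (ennreal (sqrt (norm (K z w) / h w)) * g w)\<^sup>2 \<partial>\<nu>) = (\<integral>\<^sup>+w. v z w \<partial>\<nu>)"
      using h_pos unfolding v_def
      by (intro nn_integral_cong)
        (simp add: power_mult_distrib ennreal_power less_imp_le ennreal_mult [symmetric])
    finally show ?thesis
      by (rule order_trans) (intro mult_right_mono schur_kernelD(3)[OF K z], simp)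
  qed
  have "(\<integral>\<^sup>+z. (\<integral>\<^sup>+w. ennreal (norm (K z w)) * g w \<partial>\<nu>)\<^sup>2 \<partial>\<nu>)
      \<le> (\<integral>\<^sup>+z. ennreal B * ennreal (h z) * (\<integral>\<^sup>+w. v z w \<partial>\<nu>) \<partial>\<nu>)"
    by (intro nn_integral_mono row)
  also have "\<dots> = (\<integral>\<^sup>+z. \<integral>\<^sup>+w. ennreal B * ennreal (h z) * v z w \<partial>\<nu> \<partial>\<nu>)"
    by (intro nn_integral_cong, subst nn_integral_cmult) measurable
  also have "\<dots> = (\<integral>\<^sup>+w. \<integral>\<^sup>+z. ennreal B * ennreal (h z) * v z w \<partial>\<nu> \<partial>\<nu>)"
    by (rule pair.Fubini') measurable
  also have "\<dots> \<le> (\<integral>\<^sup>+w. ennreal (B\<^sup>2) * (g w)\<^sup>2 \<partial>\<nu>)"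
  proof (rule nn_integral_mono)
    fix w assume w: "w \<in> space \<nu>"
    note [measurable] = kernel_measurable(2)[OF K w]
    have "(\<integral>\<^sup>+z. ennreal B * ennreal (h z) * v z w \<partial>\<nu>)
        = (\<integral>\<^sup>+z. (ennreal B * ennreal (1 / h w) * (g w)\<^sup>2) * (ennreal (norm (K z w)) * ennreal (h z)) \<partial>\<nu>)"
      unfolding v_def by (intro nn_integral_cong) (simp add: mult_ac)
    also have "\<dots> = (ennreal B * ennreal (1 / h w) * (g w)\<^sup>2) * (\<integral>\<^sup>+z. ennreal (norm (K z w)) * ennreal (h z) \<partial>\<nu>)"
      by (rule nn_integral_cmult) measurable
    also have "\<dots> \<le> (ennreal B * ennreal (1 / h w) * (g w)\<^sup>2) * (ennreal B * ennreal (h w))"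
      by (intro mult_left_mono schur_kernelD(4)[OF K w]) auto
    also have "\<dots> = (ennreal B * ennreal B) * (ennreal (1 / h w) * ennreal (h w)) * (g w)\<^sup>2"
      by (simp add: mult_ac)
    also have "\<dots> = ennreal (B\<^sup>2) * (g w)\<^sup>2"
      using h_pos[OF w] B by (simp add: ennreal_mult [symmetric] power2_eq_square)
    finally show "(\<integral>\<^sup>+z. ennreal B * ennreal (h z) * v z w \<partial>\<nu>) \<le> ennreal (B\<^sup>2) * (g w)\<^sup>2" .
  qed
  also have "\<dots> = ennreal (B\<^sup>2) * (\<integral>\<^sup>+w. (g w)\<^sup>2 \<partial>\<nu>)" by (rule nn_integral_cmult) measurable
  finally show ?thesis .
qed

text \<open>
  The operator with the kernel \<open>\<bar>K\<bar>\<close> on nonnegative functions. It is bounded together with \<open>K\<close>, and this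
  supplies the absolute convergence for every exchange of integrals below.
\<close>

definition abs_op :: "('a \<Rightarrow> 'a \<Rightarrow> complex) \<Rightarrow> ('a \<Rightarrow> ennreal) \<Rightarrow> 'a \<Rightarrow> ennreal" where
  "abs_op K g z = (\<integral>\<^sup>+w. ennreal (norm (K z w)) * g w \<partial>\<nu>)"

lemma abs_op_measurable [measurable]:
  assumes "schur_kernel K B" "g \<in> borel_measurable \<nu>"
  shows "abs_op K g \<in> borel_measurable \<nu>"
  using schur_kernelD(2)[OF assms(1)] assms(2) unfolding abs_op_def by measurable

lemma abs_op_square_finite:
  assumes "schur_kernel K B" "g \<in> borel_measurable \<nu>" "(\<integral>\<^sup>+w. (g w)\<^sup>2 \<partial>\<nu>) < \<infinity>"
  shows "(\<integral>\<^sup>+z. (abs_op K g z)\<^sup>2 \<partial>\<nu>) < \<infinity>"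
  unfolding abs_op_def using schur_test[OF assms(1,2)] assms(3)
  by (auto simp: ennreal_mult_less_top intro: le_less_trans)

lemma abs_op_finite_AE:
  assumes "schur_kernel K B" "g \<in> borel_measurable \<nu>" "(\<integral>\<^sup>+w. (g w)\<^sup>2 \<partial>\<nu>) < \<infinity>"
  shows "AE z in \<nu>. abs_op K g z < \<infinity>"
proof -
  have "AE z in \<nu>. (abs_op K g z)\<^sup>2 \<noteq> \<infinity>"
    using abs_op_square_finite[OF assms] abs_op_measurable[OF assms(1,2)]
    by (intro nn_integral_PInf_AE) auto
  then show ?thesis by eventually_elim (auto simp: power_eq_top_ennreal less_top)
qed

lemma L2_abs:
  assumes "g \<in> L2 \<nu>"
  shows "(\<lambda>w. ennreal (norm (g w))) \<in> borel_measurable \<nu>"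
    "(\<integral>\<^sup>+w. (ennreal (norm (g w)))\<^sup>2 \<partial>\<nu>) < \<infinity>"
  using L2_nn_integral_finite[OF assms] L2_measurable[OF assms] by (auto simp: ennreal_power)

lemma kernel_op_measurable:
  assumes "schur_kernel K B" "g \<in> borel_measurable \<nu>"
  shows "kernel_op \<nu> K g \<in> borel_measurable \<nu>"
  using schur_kernelD(2)[OF assms(1)] assms(2) unfolding kernel_op_def by measurable

lemma kernel_op_integrable_AE:
  assumes K: "schur_kernel K B" and g: "g \<in> L2 \<nu>"
  shows "AE z in \<nu>. integrable \<nu> (\<lambda>w. K z w * g w)"
  using abs_op_finite_AE[OF K L2_abs[OF g]] AE_space
proof eventually_elim
  case (elim z)
  note [measurable] = kernel_measurable(1)[OF K elim(2)] L2_measurable[OF g]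
  show ?case
    using elim(1) unfolding abs_op_def
    by (intro integrableI_bounded) (auto simp: norm_mult ennreal_mult)
qed

lemma norm_kernel_op_le: "ennreal (norm (kernel_op \<nu> K g z)) \<le> abs_op K (\<lambda>w. ennreal (norm (g w))) z"
proof (cases "integrable \<nu> (\<lambda>w. K z w * g w)")
  case True
  then show ?thesis
    using integral_norm_bound_ennreal[OF True]
    by (simp add: kernel_op_def abs_op_def norm_mult ennreal_mult)
next
  case False
  then show ?thesis by (simp add: kernel_op_def not_integrable_integral_eq)
qed

lemma kernel_op_L2:
  assumes K: "schur_kernel K B" and g: "g \<in> L2 \<nu>"
  shows "kernel_op \<nu> K g \<in> L2 \<nu>"
proof (rule L2I_bounded)
  show "kernel_op \<nu> K g \<in> borel_measurable \<nu>"
    by (rule kernel_op_measurable[OF K L2_measurable[OF g]])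
  have "(\<integral>\<^sup>+z. ennreal ((cmod (kernel_op \<nu> K g z))\<^sup>2) \<partial>\<nu>)
      \<le> (\<integral>\<^sup>+z. (abs_op K (\<lambda>w. ennreal (norm (g w))) z)\<^sup>2 \<partial>\<nu>)"
    unfolding ennreal_power [OF norm_ge_zero, symmetric]
    by (intro nn_integral_mono power_mono norm_kernel_op_le) auto
  also have "\<dots> < \<infinity>" by (rule abs_op_square_finite[OF K L2_abs[OF g]])
  finally show "(\<integral>\<^sup>+z. ennreal ((cmod (kernel_op \<nu> K g z))\<^sup>2) \<partial>\<nu>) < \<infinity>" .
qed

lemma kernel_op_cong_AE:
  assumes K: "schur_kernel K B" and z: "z \<in> space \<nu>"
    and f: "f \<in> borel_measurable \<nu>" "g \<in> borel_measurable \<nu>" "AE w in \<nu>. f w = g w"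
  shows "kernel_op \<nu> K f z = kernel_op \<nu> K g z"
  unfolding kernel_op_def
proof (rule integral_cong_AE)
  show "AE w in \<nu>. K z w * f w = K z w * g w" using f(3) by eventually_elim simp
qed (use f kernel_measurable(1)[OF K z] in auto)

lemma kernel_op_adjoint:
  assumes K: "schur_kernel K B" and f: "f \<in> L2 \<nu>" and g: "g \<in> L2 \<nu>"
  shows "l2_inner \<nu> (kernel_op \<nu> K f) g = l2_inner \<nu> f (kernel_op \<nu> (kernel_adjoint K) g)"
proof -
  note [measurable] = schur_kernelD(2)[OF K] L2_measurable[OF f] L2_measurable[OF g]
  define F where "F z w = K z w * f w * cnj (g z)" for z w
  have [measurable]: "case_prod F \<in> borel_measurable (\<nu> \<Otimes>\<^sub>M \<nu>)" unfolding F_def by measurable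
  have "(\<integral>\<^sup>+p. ennreal (norm (case_prod F p)) \<partial>(\<nu> \<Otimes>\<^sub>M \<nu>))
      = (\<integral>\<^sup>+z. \<integral>\<^sup>+w. ennreal (norm (F z w)) \<partial>\<nu> \<partial>\<nu>)"
    by (subst nn_integral_fst [symmetric]) auto
  also have "\<dots> = (\<integral>\<^sup>+z. abs_op K (\<lambda>w. ennreal (norm (f w))) z * ennreal (norm (g z)) \<partial>\<nu>)"
  proof (rule nn_integral_cong)
    fix z assume z: "z \<in> space \<nu>"
    note [measurable] = kernel_measurable(1)[OF K z]
    show "(\<integral>\<^sup>+w. ennreal (norm (F z w)) \<partial>\<nu>) = abs_op K (\<lambda>w. ennreal (norm (f w))) z * ennreal (norm (g z))"
      unfolding abs_op_def F_def
      by (subst nn_integral_multc [symmetric]) (auto simp: norm_mult ennreal_mult)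
  qed
  also have "\<dots> < \<infinity>"
  proof -
    have "(\<integral>\<^sup>+z. abs_op K (\<lambda>w. ennreal (norm (f w))) z * ennreal (norm (g z)) \<partial>\<nu>)\<^sup>2
      \<le> (\<integral>\<^sup>+z. (abs_op K (\<lambda>w. ennreal (norm (f w))) z)\<^sup>2 \<partial>\<nu>) * (\<integral>\<^sup>+z. (ennreal (norm (g z)))\<^sup>2 \<partial>\<nu>)"
      by (intro Cauchy_Schwarz_nn_integral abs_op_measurable[OF K] L2_abs f g)
    also have "\<dots> < \<infinity>"
      using abs_op_square_finite[OF K L2_abs[OF f]] L2_abs(2)[OF g] by (simp add: ennreal_mult_less_top)
    finally show ?thesis by (simp add: power_less_top_ennreal)
  qed
  finally have int: "integrable (\<nu> \<Otimes>\<^sub>M \<nu>) (case_prod F)" by (intro integrableI_bounded) auto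
  have "l2_inner \<nu> (kernel_op \<nu> K f) g = (\<integral>z. \<integral>w. F z w \<partial>\<nu> \<partial>\<nu>)"
    unfolding l2_inner_def kernel_op_def F_def by simp
  also have "\<dots> = (\<integral>w. \<integral>z. F z w \<partial>\<nu> \<partial>\<nu>)" by (rule pair.Fubini_integral[OF int, symmetric])
  also have "\<dots> = l2_inner \<nu> f (kernel_op \<nu> (kernel_adjoint K) g)"
    unfolding l2_inner_def kernel_op_def
    by (intro Bochner_Integration.integral_cong refl)
      (simp add: F_def kernel_adjoint_def mult_ac flip: Bochner_Integration.integral_cnj integral_mult_right_zero)
  finally show ?thesis .
qed

lemma abs_comp_le:
  assumes K: "schur_kernel K B" and K': "schur_kernel K' B'" and z: "z \<in> space \<nu>"
  shows "(\<integral>\<^sup>+w. (\<integral>\<^sup>+u. ennreal (norm (K z u)) * ennreal (norm (K' u w)) \<partial>\<nu>) * ennreal (h w) \<partial>\<nu>)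
    \<le> ennreal (B * B') * ennreal (h z)"
proof -
  note [measurable] = schur_kernelD(2)[OF K'] kernel_measurable(1)[OF K z]
  have "(\<integral>\<^sup>+w. (\<integral>\<^sup>+u. ennreal (norm (K z u)) * ennreal (norm (K' u w)) \<partial>\<nu>) * ennreal (h w) \<partial>\<nu>)
      = (\<integral>\<^sup>+w. \<integral>\<^sup>+u. ennreal (norm (K z u)) * ennreal (norm (K' u w)) * ennreal (h w) \<partial>\<nu> \<partial>\<nu>)"
    by (intro nn_integral_cong, subst nn_integral_multc) measurable
  also have "\<dots> = (\<integral>\<^sup>+u. \<integral>\<^sup>+w. ennreal (norm (K z u)) * ennreal (norm (K' u w)) * ennreal (h w) \<partial>\<nu> \<partial>\<nu>)"
    by (rule pair.Fubini') measurable
  also have "\<dots> \<le> (\<integral>\<^sup>+u. ennreal B' * (ennreal (norm (K z u)) * ennreal (h u)) \<partial>\<nu>)"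
  proof (rule nn_integral_mono)
    fix u assume u: "u \<in> space \<nu>"
    note [measurable] = kernel_measurable(1)[OF K' u]
    have "(\<integral>\<^sup>+w. ennreal (norm (K z u)) * ennreal (norm (K' u w)) * ennreal (h w) \<partial>\<nu>)
        = ennreal (norm (K z u)) * (\<integral>\<^sup>+w. ennreal (norm (K' u w)) * ennreal (h w) \<partial>\<nu>)"
      unfolding mult.assoc by (rule nn_integral_cmult) measurable
    also have "\<dots> \<le> ennreal (norm (K z u)) * (ennreal B' * ennreal (h u))"
      by (intro mult_left_mono schur_kernelD(3)[OF K' u]) auto
    finally show "(\<integral>\<^sup>+w. ennreal (norm (K z u)) * ennreal (norm (K' u w)) * ennreal (h w) \<partial>\<nu>)
        \<le> ennreal B' * (ennreal (norm (K z u)) * ennreal (h u))" by (simp add: mult_ac)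
  qed
  also have "\<dots> = ennreal B' * (\<integral>\<^sup>+u. ennreal (norm (K z u)) * ennreal (h u) \<partial>\<nu>)"
    by (rule nn_integral_cmult) measurable
  also have "\<dots> \<le> ennreal B' * (ennreal B * ennreal (h z))"
    by (intro mult_left_mono schur_kernelD(3)[OF K z]) auto
  finally show ?thesis
    using schur_kernelD(1)[OF K] schur_kernelD(1)[OF K'] by (simp add: ennreal_mult mult_ac)
qed

lemma norm_kernel_comp_le:
  "ennreal (norm (kernel_comp \<nu> K K' z w))
    \<le> (\<integral>\<^sup>+u. ennreal (norm (K z u)) * ennreal (norm (K' u w)) \<partial>\<nu>)"
proof (cases "integrable \<nu> (\<lambda>u. K z u * K' u w)")
  case True
  then show ?thesis
    using integral_norm_bound_ennreal[OF True]
    by (simp add: kernel_comp_def norm_mult ennreal_mult)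
next
  case False
  then show ?thesis by (simp add: kernel_comp_def not_integrable_integral_eq)
qed

lemma kernel_comp_measurable:
  assumes "schur_kernel K B" "schur_kernel K' B'"
  shows "case_prod (kernel_comp \<nu> K K') \<in> borel_measurable (\<nu> \<Otimes>\<^sub>M \<nu>)"
proof -
  note [measurable] = schur_kernelD(2)[OF assms(1)] schur_kernelD(2)[OF assms(2)]
  show ?thesis unfolding kernel_comp_def by measurable
qed

lemma schur_kernel_comp:
  assumes K: "schur_kernel K B" and K': "schur_kernel K' B'"
  shows "schur_kernel (kernel_comp \<nu> K K') (B * B')"
proof -
  have row: "(\<integral>\<^sup>+w. ennreal (norm (kernel_comp \<nu> L L' z w)) * ennreal (h w) \<partial>\<nu>) \<le> ennreal (b * b') * ennreal (h z)"
    if "schur_kernel L b" "schur_kernel L' b'" "z \<in> space \<nu>" for L L' b b' z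
    by (rule order_trans[OF _ abs_comp_le[OF that]])
      (intro nn_integral_mono mult_right_mono norm_kernel_comp_le, simp)
  have "norm (kernel_comp \<nu> K K' z w) = norm (kernel_comp \<nu> (kernel_adjoint K') (kernel_adjoint K) w z)" for z w
  proof -
    have "kernel_comp \<nu> (kernel_adjoint K') (kernel_adjoint K) w z = cnj (kernel_comp \<nu> K K' z w)"
      unfolding kernel_comp_def kernel_adjoint_def
      by (subst Bochner_Integration.integral_cnj [symmetric]) (simp add: mult.commute)
    then show ?thesis by simp
  qed
  then have "(\<integral>\<^sup>+z. ennreal (norm (kernel_comp \<nu> K K' z w)) * ennreal (h z) \<partial>\<nu>) \<le> ennreal (B * B') * ennreal (h w)"
    if "w \<in> space \<nu>" for w
    using row[OF schur_kernel_adjoint[OF K'] schur_kernel_adjoint[OF K] that] by (simp add: mult.commute)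
  then show ?thesis
    using row[OF K K'] kernel_comp_measurable[OF K K'] schur_kernelD(1)[OF K] schur_kernelD(1)[OF K']
    unfolding schur_kernel_def by auto
qed

lemma kernel_comp_integrable_AE:
  assumes K: "schur_kernel K B" and K': "schur_kernel K' B'" and z: "z \<in> space \<nu>"
  shows "AE w in \<nu>. integrable \<nu> (\<lambda>u. K z u * K' u w)"
proof -
  note [measurable] = schur_kernelD(2)[OF K'] kernel_measurable(1)[OF K z]
  have "AE w in \<nu>. (\<integral>\<^sup>+u. ennreal (norm (K z u)) * ennreal (norm (K' u w)) \<partial>\<nu>) * ennreal (h w) \<noteq> \<infinity>"
    using abs_comp_le[OF K K' z] by (intro nn_integral_PInf_AE) (auto simp: top_unique ennreal_mult_eq_top_iff)
  then show ?thesis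
    using AE_space
  proof eventually_elim
    case (elim w)
    then have "(\<integral>\<^sup>+u. ennreal (norm (K z u)) * ennreal (norm (K' u w)) \<partial>\<nu>) < \<infinity>"
      using h_pos[of w] by (auto simp: ennreal_mult_eq_top_iff less_top)
    then show ?case
      using kernel_measurable(2)[OF K' elim(2)]
      by (intro integrableI_bounded) (auto simp: norm_mult ennreal_mult)
  qed
qed

lemma kernel_op_comp:
  assumes K: "schur_kernel K B" and K': "schur_kernel K' B'" and g: "g \<in> L2 \<nu>"
  shows "AE z in \<nu>. kernel_op \<nu> K (kernel_op \<nu> K' g) z = kernel_op \<nu> (kernel_comp \<nu> K K') g z"
proof -
  note [measurable] = schur_kernelD(2)[OF K'] L2_measurable[OF g]
  define G where "G = abs_op K' (\<lambda>w. ennreal (norm (g w)))"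
  have "AE z in \<nu>. abs_op K G z < \<infinity>"
    unfolding G_def by (rule abs_op_finite_AE[OF K abs_op_measurable[OF K' L2_abs(1)[OF g]]
        abs_op_square_finite[OF K' L2_abs[OF g]]])
  then show ?thesis using AE_space
  proof eventually_elim
    case (elim z)
    note [measurable] = kernel_measurable(1)[OF K elim(2)]
    define F where "F u w = K z u * K' u w * g w" for u w
    have [measurable]: "case_prod F \<in> borel_measurable (\<nu> \<Otimes>\<^sub>M \<nu>)" unfolding F_def by measurable
    have "(\<integral>\<^sup>+p. ennreal (norm (case_prod F p)) \<partial>(\<nu> \<Otimes>\<^sub>M \<nu>))
        = (\<integral>\<^sup>+u. \<integral>\<^sup>+w. ennreal (norm (F u w)) \<partial>\<nu> \<partial>\<nu>)"
      by (subst nn_integral_fst [symmetric]) auto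
    also have "\<dots> = abs_op K G z"
      unfolding abs_op_def[of K]
    proof (rule nn_integral_cong)
      fix u assume u: "u \<in> space \<nu>"
      note [measurable] = kernel_measurable(1)[OF K' u]
      show "(\<integral>\<^sup>+w. ennreal (norm (F u w)) \<partial>\<nu>) = ennreal (norm (K z u)) * G u"
        unfolding G_def abs_op_def F_def
        by (subst nn_integral_cmult [symmetric]) (auto simp: norm_mult ennreal_mult mult.assoc)
    qed
    finally have int: "integrable (\<nu> \<Otimes>\<^sub>M \<nu>) (case_prod F)"
      using elim(1) by (intro integrableI_bounded) auto
    have "kernel_op \<nu> K (kernel_op \<nu> K' g) z = (\<integral>u. \<integral>w. F u w \<partial>\<nu> \<partial>\<nu>)"
      unfolding kernel_op_def F_def by (simp add: mult.assoc)
    also have "\<dots> = (\<integral>w. \<integral>u. F u w \<partial>\<nu> \<partial>\<nu>)" by (rule pair.Fubini_integral[OF int, symmetric])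
    also have "\<dots> = kernel_op \<nu> (kernel_comp \<nu> K K') g z"
      unfolding kernel_op_def kernel_comp_def F_def by simp
    finally show ?case .
  qed
qed

lemma kernel_op_cong_kernel:
  assumes "schur_kernel K B" "schur_kernel K' B'" "g \<in> borel_measurable \<nu>" "z \<in> space \<nu>"
    and "AE w in \<nu>. K z w = c * K' z w"
  shows "kernel_op \<nu> K g z = c * kernel_op \<nu> K' g z"
proof -
  have "kernel_op \<nu> K g z = (\<integral>w. c * (K' z w * g w) \<partial>\<nu>)"
    unfolding kernel_op_def
  proof (rule integral_cong_AE)
    show "AE w in \<nu>. K z w * g w = c * (K' z w * g w)" using assms(5) by eventually_elim simp
  qed (use assms(3) kernel_measurable(1)[OF assms(1,4)] kernel_measurable(1)[OF assms(2,4)] in auto)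
  then show ?thesis by (simp add: kernel_op_def)
qed

text \<open>
  The identity for the kernels may be checked under the assumption that the integral converges
  absolutely, because this is the case for almost every \<open>w\<close>. The same holds for the triple product.
\<close>

lemma kernel_op_idempotent:
  assumes K: "schur_kernel K B" and g: "g \<in> L2 \<nu>"
    and idem: "\<And>z w. \<lbrakk>z \<in> space \<nu>; w \<in> space \<nu>; integrable \<nu> (\<lambda>u. K z u * K u w)\<rbrakk>
      \<Longrightarrow> (\<integral>u. K z u * K u w \<partial>\<nu>) = K z w"
  shows "AE z in \<nu>. kernel_op \<nu> K (kernel_op \<nu> K g) z = kernel_op \<nu> K g z"
  using kernel_op_comp[OF K K g] AE_space
proof eventually_elim
  case (elim z)
  have "AE w in \<nu>. kernel_comp \<nu> K K z w = 1 * K z w"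
    using kernel_comp_integrable_AE[OF K K elim(2)] AE_space
    by eventually_elim (simp add: kernel_comp_def idem[OF elim(2)])
  from kernel_op_cong_kernel[OF schur_kernel_comp[OF K K] K L2_measurable[OF g] elim(2) this]
  show ?case using elim(1) by simp
qed

text \<open>
  For fixed \<open>z\<close>, the integral over \<open>w\<close> of the absolute values, weighted with \<open>h\<close>, is finite by three
  applications of the Schur bound; since \<open>h\<close> is positive, almost every \<open>w\<close> gives a finite integral.
\<close>

lemma kernel_triple_integrable_AE:
  assumes K: "schur_kernel K B" and K': "schur_kernel K' B'" and K'': "schur_kernel K'' B''"
    and z: "z \<in> space \<nu>"
  shows "AE w in \<nu>. integrable (\<nu> \<Otimes>\<^sub>M \<nu>) (\<lambda>(u, v). K z u * (K' u v * K'' v w))"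
proof -
  note [measurable] = schur_kernelD(2)[OF K'] schur_kernelD(2)[OF K''] kernel_measurable(1)[OF K z]
  define T where "T u w = (\<integral>\<^sup>+v. ennreal (norm (K' u v)) * ennreal (norm (K'' v w)) \<partial>\<nu>)" for u w
  have [measurable]: "case_prod T \<in> borel_measurable (\<nu> \<Otimes>\<^sub>M \<nu>)" unfolding T_def by measurable
  have "(\<integral>\<^sup>+w. (\<integral>\<^sup>+u. ennreal (norm (K z u)) * T u w \<partial>\<nu>) * ennreal (h w) \<partial>\<nu>)
      = (\<integral>\<^sup>+w. \<integral>\<^sup>+u. ennreal (norm (K z u)) * T u w * ennreal (h w) \<partial>\<nu> \<partial>\<nu>)"
    by (intro nn_integral_cong, subst nn_integral_multc) measurable
  also have "\<dots> = (\<integral>\<^sup>+u. \<integral>\<^sup>+w. ennreal (norm (K z u)) * T u w * ennreal (h w) \<partial>\<nu> \<partial>\<nu>)"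
    by (rule pair.Fubini') measurable
  also have "\<dots> \<le> (\<integral>\<^sup>+u. ennreal (B' * B'') * (ennreal (norm (K z u)) * ennreal (h u)) \<partial>\<nu>)"
  proof (rule nn_integral_mono)
    fix u assume u: "u \<in> space \<nu>"
    note [measurable] = kernel_measurable(1)[OF K' u]
    have "(\<integral>\<^sup>+w. ennreal (norm (K z u)) * T u w * ennreal (h w) \<partial>\<nu>)
        = ennreal (norm (K z u)) * (\<integral>\<^sup>+w. T u w * ennreal (h w) \<partial>\<nu>)"
      unfolding mult.assoc using u by (intro nn_integral_cmult) measurable
    also have "\<dots> \<le> ennreal (norm (K z u)) * (ennreal (B' * B'') * ennreal (h u))"
      unfolding T_def by (intro mult_left_mono abs_comp_le[OF K' K'' u]) auto
    finally show "(\<integral>\<^sup>+w. ennreal (norm (K z u)) * T u w * ennreal (h w) \<partial>\<nu>)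
        \<le> ennreal (B' * B'') * (ennreal (norm (K z u)) * ennreal (h u))" by (simp add: mult_ac)
  qed
  also have "\<dots> = ennreal (B' * B'') * (\<integral>\<^sup>+u. ennreal (norm (K z u)) * ennreal (h u) \<partial>\<nu>)"
    by (rule nn_integral_cmult) measurable
  also have "\<dots> \<le> ennreal (B' * B'') * (ennreal B * ennreal (h z))"
    by (intro mult_left_mono schur_kernelD(3)[OF K z]) auto
  also have "\<dots> < \<infinity>" by (simp add: ennreal_mult_less_top)
  finally have "AE w in \<nu>. (\<integral>\<^sup>+u. ennreal (norm (K z u)) * T u w \<partial>\<nu>) * ennreal (h w) \<noteq> \<infinity>"
    by (intro nn_integral_PInf_AE) auto
  then show ?thesis
    using AE_space
  proof eventually_elim
    case (elim w)
    note [measurable] = kernel_measurable(2)[OF K'' elim(2)]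
    have fin: "(\<integral>\<^sup>+u. ennreal (norm (K z u)) * T u w \<partial>\<nu>) < \<infinity>"
      using elim h_pos[of w] by (auto simp: ennreal_mult_eq_top_iff less_top)
    have meas: "(\<lambda>(u, v). K z u * (K' u v * K'' v w)) \<in> borel_measurable (\<nu> \<Otimes>\<^sub>M \<nu>)" by measurable
    have "(\<integral>\<^sup>+p. ennreal (norm (case p of (u, v) \<Rightarrow> K z u * (K' u v * K'' v w))) \<partial>(\<nu> \<Otimes>\<^sub>M \<nu>))
        = (\<integral>\<^sup>+u. \<integral>\<^sup>+v. ennreal (norm (K z u * (K' u v * K'' v w))) \<partial>\<nu> \<partial>\<nu>)"
      using meas by (subst nn_integral_fst [symmetric]) auto
    also have "\<dots> = (\<integral>\<^sup>+u. ennreal (norm (K z u)) * T u w \<partial>\<nu>)"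
    proof (rule nn_integral_cong)
      fix u assume u: "u \<in> space \<nu>"
      note [measurable] = kernel_measurable(1)[OF K' u]
      show "(\<integral>\<^sup>+v. ennreal (norm (K z u * (K' u v * K'' v w))) \<partial>\<nu>) = ennreal (norm (K z u)) * T u w"
        unfolding T_def
        by (subst nn_integral_cmult [symmetric]) (auto simp: norm_mult ennreal_mult)
    qed
    finally show ?case using fin meas by (intro integrableI_bounded) auto
  qed
qed

lemma kernel_op_triple:
  assumes K: "schur_kernel K B" and g: "g \<in> L2 \<nu>"
    and triple: "\<And>z w. \<lbrakk>z \<in> space \<nu>; w \<in> space \<nu>;
        integrable (\<nu> \<Otimes>\<^sub>M \<nu>) (\<lambda>(u, v). K z u * (kernel_adjoint K u v * K v w))\<rbrakk>
      \<Longrightarrow> (\<integral>(u, v). K z u * (kernel_adjoint K u v * K v w) \<partial>(\<nu> \<Otimes>\<^sub>M \<nu>)) = c * K z w"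
  shows "AE z in \<nu>. kernel_op \<nu> K (kernel_op \<nu> (kernel_adjoint K) (kernel_op \<nu> K g)) z
    = c * kernel_op \<nu> K g z"
proof -
  define K' where "K' = kernel_adjoint K"
  have K': "schur_kernel K' B" unfolding K'_def by (rule schur_kernel_adjoint[OF K])
  note KK = schur_kernel_comp[OF K' K]
  show ?thesis
    unfolding K'_def [symmetric] using kernel_op_comp[OF K KK g] AE_space
  proof eventually_elim
    case (elim z)
    have "kernel_op \<nu> K (kernel_op \<nu> K' (kernel_op \<nu> K g)) z
        = kernel_op \<nu> K (kernel_op \<nu> (kernel_comp \<nu> K' K) g) z"
      using L2_measurable[OF g]
      by (intro kernel_op_cong_AE[OF K elim(2)] kernel_op_comp[OF K' K g]
          kernel_op_measurable[OF KK] kernel_op_measurable[OF K'] kernel_op_measurable[OF K])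
    also have "\<dots> = kernel_op \<nu> (kernel_comp \<nu> K (kernel_comp \<nu> K' K)) g z" by (rule elim(1))
    also have "\<dots> = c * kernel_op \<nu> K g z"
    proof (rule kernel_op_cong_kernel[OF schur_kernel_comp[OF K KK] K L2_measurable[OF g] elim(2)])
      show "AE w in \<nu>. kernel_comp \<nu> K (kernel_comp \<nu> K' K) z w = c * K z w"
        using kernel_triple_integrable_AE[OF K K' K elim(2)] AE_space
      proof eventually_elim
        case (elim w)
        have "kernel_comp \<nu> K (kernel_comp \<nu> K' K) z w = (\<integral>u. \<integral>v. K z u * (K' u v * K v w) \<partial>\<nu> \<partial>\<nu>)"
          unfolding kernel_comp_def by simp
        also have "\<dots> = (\<integral>(u, v). K z u * (K' u v * K v w) \<partial>(\<nu> \<Otimes>\<^sub>M \<nu>))"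
          using pair.integral_fst'[OF elim(1)] by simp
        also have "\<dots> = c * K z w"
          using elim triple[of z w] \<open>z \<in> space \<nu>\<close> unfolding K'_def by simp
        finally show ?case .
      qed
    qed
    finally show ?case .
  qed
qed

end

section \<open>An integral over a line\<close>

lemma einterval_UNIV: "einterval (-\<infinity>) \<infinity> = UNIV"
  by (auto simp: einterval_def)

lemma integral_real_line_FTC:
  fixes f F :: "real \<Rightarrow> complex"
  assumes "\<And>x. (F has_vector_derivative f x) (at x)" "continuous_on UNIV f"
    and "integrable lborel f" "(F \<longlongrightarrow> A) at_bot" "(F \<longlongrightarrow> B) at_top"
  shows "integral\<^sup>L lborel f = B - A"
proof -
  have "(LBINT x=-\<infinity>..\<infinity>. f x) = B - A"
    using assms
    by (intro interval_integral_FTC_integrable[where F = F])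
      (auto simp: ereal_tendsto_simps einterval_UNIV set_integrable_def continuous_on_eq_continuous_at)
  then show ?thesis
    by (simp add: interval_lebesgue_integral_def einterval_UNIV set_lebesgue_integral_def)
qed

lemma DERIV_arctan_affine:
  fixes a c :: real
  assumes a: "a > 0"
  shows "((\<lambda>s. arctan ((s - c) / a)) has_real_derivative a / (a\<^sup>2 + (s - c)\<^sup>2)) (at s)"
proof -
  have "1 + ((s - c) / a)\<^sup>2 = (a\<^sup>2 + (s - c)\<^sup>2) / a\<^sup>2"
    using a by (simp add: field_simps)
  then have "inverse (1 + ((s - c) / a)\<^sup>2) * (1 / a) = a / (a\<^sup>2 + (s - c)\<^sup>2)"
    using a by (simp add: power2_eq_square)
  moreover have "((\<lambda>s. arctan ((s - c) / a)) has_real_derivative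
      inverse (1 + ((s - c) / a)\<^sup>2) * (1 / a)) (at s)"
    using a by (auto intro!: derivative_eq_intros)
  ultimately show ?thesis by simp
qed

lemma arctan_affine_tendsto:
  fixes a c :: real
  assumes "a > 0"
  shows "((\<lambda>s. arctan ((s - c) / a)) \<longlongrightarrow> pi / 2) at_top"
    and "((\<lambda>s. arctan ((s - c) / a)) \<longlongrightarrow> - (pi / 2)) at_bot"
proof -
  have "filterlim (\<lambda>s. (s - c) / a) at_top at_top" "filterlim (\<lambda>s. (s - c) / a) at_bot at_bot"
    using assms by real_asymp+
  then show "((\<lambda>s. arctan ((s - c) / a)) \<longlongrightarrow> pi / 2) at_top"
    "((\<lambda>s. arctan ((s - c) / a)) \<longlongrightarrow> - (pi / 2)) at_bot"
    by (auto intro: filterlim_compose[OF tendsto_arctan_at_top] filterlim_compose[OF tendsto_arctan_at_bot])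
qed

lemma
  fixes a c :: real
  assumes a: "a > 0"
  shows integrable_Cauchy_density: "integrable lborel (\<lambda>s. 1 / (a\<^sup>2 + (s - c)\<^sup>2))"
    and integral_Cauchy_density: "(LBINT s. 1 / (a\<^sup>2 + (s - c)\<^sup>2)) = pi / a"
proof -
  let ?f = "\<lambda>s. 1 / (a\<^sup>2 + (s - c)\<^sup>2)" and ?F = "\<lambda>s. arctan ((s - c) / a) / a"
  have pos: "a\<^sup>2 + (s - c)\<^sup>2 > 0" for s using a by (simp add: add_pos_nonneg)
  have deriv: "(?F has_real_derivative ?f s) (at s)" for s
    using DERIV_cdivide[OF DERIV_arctan_affine[OF a, of c s], of a] a by simp
  have cont: "isCont ?f s" for s
    using pos[of s] by (intro continuous_intros) auto
  have lim: "(?F \<longlongrightarrow> - (pi / 2) / a) at_bot" "(?F \<longlongrightarrow> pi / 2 / a) at_top"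
    using a by (intro tendsto_divide tendsto_const arctan_affine_tendsto; simp)+
  have "set_integrable lborel (einterval (-\<infinity>) \<infinity>) ?f"
    "(LBINT s=-\<infinity>..\<infinity>. ?f s) = pi / 2 / a - (- (pi / 2) / a)"
    using lim deriv cont pos
    by (intro interval_integral_FTC_nonneg[where F = ?F]; auto simp: ereal_tendsto_simps less_imp_le)+
  then show "integrable lborel ?f" "(LBINT s. ?f s) = pi / a"
    by (simp_all add: set_integrable_def einterval_UNIV interval_lebesgue_integral_def
        set_lebesgue_integral_def)
qed

lemma Complex_nonzero: "a > 0 \<Longrightarrow> Complex a t \<noteq> 0"
  by (auto simp: complex_eq_iff)

lemma norm_Complex_ge: "a > 0 \<Longrightarrow> a \<le> cmod (Complex a t)"
  using complex_Re_le_cmod[of "Complex a t"] by simp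

lemma continuous_Complex_line: "continuous_on UNIV (\<lambda>s::real. Complex a (b * s + c))"
  unfolding complex_eq by (simp add: Complex_eq) (intro continuous_intros)

text \<open>The factors \<open>1 / \<bar>Z\<bar>\<close> beyond the second are bounded.\<close>

lemma integrable_power_product:
  fixes a b s1 s2 :: real
  assumes a: "a > 0" and b: "b > 0" and mn: "m + n \<ge> 2"
  shows "integrable lborel (\<lambda>s. 1 / (Complex a (s - s1) ^ m * Complex b (s2 - s) ^ n))"
proof -
  define d where "d = min a b"
  have d: "d > 0" "d \<le> a" "d \<le> b" using a b by (auto simp: d_def)
  have [measurable]: "(\<lambda>s. Complex a (s - s1)) \<in> borel_measurable borel"
    "(\<lambda>s. Complex b (s2 - s)) \<in> borel_measurable borel"
    using continuous_Complex_line[of a 1 "-s1"] continuous_Complex_line[of b "-1" s2]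
    by (auto intro!: borel_measurable_continuous_onI)
  show ?thesis
  proof (rule Bochner_Integration.integrable_bound)
    show "integrable lborel (\<lambda>s. (1 / d) ^ (m + n - 2) * (1 / (d\<^sup>2 + (s - s1)\<^sup>2) + 1 / (d\<^sup>2 + (s - s2)\<^sup>2)))"
      by (intro integrable_mult_right Bochner_Integration.integrable_add
          integrable_Cauchy_density d(1))
    show "AE s in lborel. norm (1 / (Complex a (s - s1) ^ m * Complex b (s2 - s) ^ n))
        \<le> norm ((1 / d) ^ (m + n - 2) * (1 / (d\<^sup>2 + (s - s1)\<^sup>2) + 1 / (d\<^sup>2 + (s - s2)\<^sup>2)))"
    proof (rule AE_I2)
      fix s :: real
      define x y where "x = cmod (Complex a (s - s1))" and "y = cmod (Complex b (s2 - s))"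
      have x: "x > 0" "d \<le> x" and y: "y > 0" "d \<le> y"
        using norm_Complex_ge[OF a, of "s - s1"] norm_Complex_ge[OF b, of "s2 - s"] a b d
        unfolding x_def y_def by linarith+
      have x2: "1 / x\<^sup>2 \<le> 1 / (d\<^sup>2 + (s - s1)\<^sup>2)" and y2: "1 / y\<^sup>2 \<le> 1 / (d\<^sup>2 + (s - s2)\<^sup>2)"
        unfolding x_def y_def cmod_def using d a b
        by (auto intro!: divide_left_mono power_mono add_pos_nonneg mult_pos_pos
            simp: power2_commute[of s s2])
      define w where "w = min x y"
      have w: "w > 0" "d \<le> w" "w \<le> x" "w \<le> y" using x y by (auto simp: w_def)
      have "norm (1 / (Complex a (s - s1) ^ m * Complex b (s2 - s) ^ n)) = 1 / (x ^ m * y ^ n)"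
        by (simp add: norm_divide norm_mult norm_power x_def y_def)
      also have "\<dots> \<le> 1 / (w ^ m * w ^ n)"
        using w by (intro divide_left_mono mult_mono power_mono) auto
      also have "\<dots> = (1 / w) ^ (m + n - 2) * (1 / w\<^sup>2)"
      proof -
        have "w ^ m * w ^ n = w ^ (m + n - 2) * w\<^sup>2"
          using mn by (metis le_add_diff_inverse2 power_add)
        then show ?thesis by (simp add: power_divide)
      qed
      also have "\<dots> \<le> (1 / d) ^ (m + n - 2) * (1 / w\<^sup>2)"
        using w d by (intro mult_right_mono power_mono frac_le) auto
      also have "1 / w\<^sup>2 \<le> 1 / x\<^sup>2 + 1 / y\<^sup>2"
        using x y by (auto simp: w_def min_def)
      also have "\<dots> \<le> 1 / (d\<^sup>2 + (s - s1)\<^sup>2) + 1 / (d\<^sup>2 + (s - s2)\<^sup>2)"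
        using x2 y2 by linarith
      finally have le: "norm (1 / (Complex a (s - s1) ^ m * Complex b (s2 - s) ^ n))
          \<le> (1 / d) ^ (m + n - 2) * (1 / (d\<^sup>2 + (s - s1)\<^sup>2) + 1 / (d\<^sup>2 + (s - s2)\<^sup>2))"
        using d by (simp add: mult_left_mono)
      then show "norm (1 / (Complex a (s - s1) ^ m * Complex b (s2 - s) ^ n))
          \<le> norm ((1 / d) ^ (m + n - 2) * (1 / (d\<^sup>2 + (s - s1)\<^sup>2) + 1 / (d\<^sup>2 + (s - s2)\<^sup>2)))"
        unfolding real_norm_def by (rule order_trans[OF _ abs_ge_self])
    qed
  qed measurable
qed

lemma tendsto_inverse_Complex_line:
  assumes "\<sigma> \<noteq> 0" "n > 0"
  shows "((\<lambda>s::real. 1 / Complex a (\<sigma> * s + c) ^ n) \<longlongrightarrow> 0) at_top"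
    "((\<lambda>s::real. 1 / Complex a (\<sigma> * s + c) ^ n) \<longlongrightarrow> 0) at_bot"
proof -
  have le: "\<bar>\<sigma> * s + c\<bar> \<le> cmod (Complex a (\<sigma> * s + c))" for s
    using abs_Im_le_cmod[of "Complex a (\<sigma> * s + c)"] by simp
  have lim: "filterlim (\<lambda>s. \<bar>\<sigma> * s + c\<bar>) at_top at_top" "filterlim (\<lambda>s. \<bar>\<sigma> * s + c\<bar>) at_top at_bot"
    using assms by (cases "\<sigma> > 0"; real_asymp; fail)+
  have "((\<lambda>s::real. 1 / Complex a (\<sigma> * s + c) ^ n) \<longlongrightarrow> 0) F"
    if "filterlim (\<lambda>s. \<bar>\<sigma> * s + c\<bar>) at_top F" for F
  proof -
    have "filterlim (\<lambda>s. Complex a (\<sigma> * s + c)) at_infinity F"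
      by (rule filterlim_norm_at_top_imp_at_infinity, rule filterlim_at_top_mono[OF that])
        (use le in simp)
    then have "((\<lambda>s. inverse (Complex a (\<sigma> * s + c))) \<longlongrightarrow> 0) F"
      by (rule filterlim_compose[OF tendsto_inverse_0])
    from tendsto_power[OF this, of n] show ?thesis
      using assms(2) by (simp add: field_simps power_0_left)
  qed
  from this[OF lim(1)] this[OF lim(2)] 
  show "((\<lambda>s::real. 1 / Complex a (\<sigma> * s + c) ^ n) \<longlongrightarrow> 0) at_top"
    "((\<lambda>s::real. 1 / Complex a (\<sigma> * s + c) ^ n) \<longlongrightarrow> 0) at_bot" .
qed

lemma integral_inverse_power_line:
  assumes a: "a > 0" and \<sigma>: "\<sigma> \<noteq> 0" and n: "n \<ge> 2"
    and int: "integrable lborel (\<lambda>s. 1 / Complex a (\<sigma> * s + c) ^ n)"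
  shows "(LBINT s. 1 / Complex a (\<sigma> * s + c) ^ n) = 0"
proof -
  obtain k where k: "n = Suc (Suc k)" using n by (metis Suc_le_D numeral_2_eq_2 le_SucE Suc_le_mono)
  define e where "e = \<i> / (of_nat (Suc k) * of_real \<sigma>)"
  have nz: "Complex a (\<sigma> * s + c) \<noteq> 0" for s using a by (rule Complex_nonzero)
  have vd: "((\<lambda>s. Complex a (\<sigma> * s + c)) has_vector_derivative \<i> * of_real \<sigma>) (at s)" for s
    unfolding Complex_eq by (auto intro!: derivative_eq_intros)
  have "((\<lambda>s. e * inverse (Complex a (\<sigma> * s + c) ^ Suc k)) has_vector_derivative
      1 / Complex a (\<sigma> * s + c) ^ n) (at s)" for s
  proof -
    have fd: "((\<lambda>z. e * inverse (z ^ Suc k)) has_field_derivative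
        e * (- (of_nat (Suc k) * Complex a (\<sigma> * s + c) ^ k) *
           inverse ((Complex a (\<sigma> * s + c) ^ Suc k) * (Complex a (\<sigma> * s + c) ^ Suc k))))
        (at (Complex a (\<sigma> * s + c)))"
      by (rule derivative_eq_intros refl | use nz[of s] in \<open>simp add: algebra_simps\<close>)+
    have "(\<i> * of_real \<sigma>) * (e * (- (of_nat (Suc k) * Complex a (\<sigma> * s + c) ^ k) *
           inverse ((Complex a (\<sigma> * s + c) ^ Suc k) * (Complex a (\<sigma> * s + c) ^ Suc k))))
        = 1 / Complex a (\<sigma> * s + c) ^ n"
      using nz[of s] \<sigma> unfolding e_def k by (simp add: field_simps del: of_nat_Suc)
    with field_vector_diff_chain_at[OF vd fd] show ?thesis by (simp add: o_def)
  qed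
  moreover have "continuous_on UNIV (\<lambda>s. 1 / Complex a (\<sigma> * s + c) ^ n)"
    using nz by (intro continuous_intros continuous_Complex_line) auto
  moreover have "((\<lambda>s. e * inverse (Complex a (\<sigma> * s + c) ^ Suc k)) \<longlongrightarrow> e * 0) at_bot"
      "((\<lambda>s. e * inverse (Complex a (\<sigma> * s + c) ^ Suc k)) \<longlongrightarrow> e * 0) at_top"
    unfolding inverse_eq_divide
    by (intro tendsto_mult_left tendsto_inverse_Complex_line \<sigma>; simp)+
  ultimately show ?thesis
    using integral_real_line_FTC[OF _ _ int] by fastforce
qed

lemma integral_inverse_product_line:
  fixes a b s1 s2 :: real
  assumes a: "a > 0" and b: "b > 0"
  shows "(LBINT s. 1 / (Complex a (s - s1) * Complex b (s2 - s))) = 2 * of_real pi / Complex (a + b) (s2 - s1)"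
proof -
  define E where "E = Complex (a + b) (s2 - s1)"
  have E: "E \<noteq> 0" using Complex_nonzero[of "a + b"] a b by (simp add: E_def)
  \<comment> \<open>The antiderivative of \<open>(1 / x + 1 / y) / E\<close>, where \<open>x\<close> and \<open>y\<close> are the two factors and \<open>E\<close> is their sum.\<close>
  define F where "F s = (of_real (arctan ((s - s1) / a) + arctan ((s - s2) / b))
      + \<i> * of_real ((ln (b\<^sup>2 + (s - s2)\<^sup>2) - ln (a\<^sup>2 + (s - s1)\<^sup>2)) / 2)) / E" for s
  have nz: "Complex a (s - s1) \<noteq> 0" "Complex b (s2 - s) \<noteq> 0" for s
    using Complex_nonzero[OF a] Complex_nonzero[OF b] by auto
  have pos: "a\<^sup>2 + (s - s1)\<^sup>2 > 0" "b\<^sup>2 + (s - s2)\<^sup>2 > 0" for s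
    using a b by (simp_all add: add_pos_nonneg)
  have inv1: "1 / Complex a (s - s1) = of_real (a / (a\<^sup>2 + (s - s1)\<^sup>2)) - \<i> * of_real ((s - s1) / (a\<^sup>2 + (s - s1)\<^sup>2))" for s
    unfolding inverse_eq_divide [symmetric] complex_inverse
    by (simp add: complex_eq_iff minus_divide_left del: divide_minus_left)
  have inv2: "1 / Complex b (s2 - s) = of_real (b / (b\<^sup>2 + (s - s2)\<^sup>2)) + \<i> * of_real ((s - s2) / (b\<^sup>2 + (s - s2)\<^sup>2))" for s
    unfolding inverse_eq_divide [symmetric] complex_inverse
    by (simp add: complex_eq_iff power2_commute[of s2 s] minus_divide_left del: divide_minus_left)
  have deriv: "(F has_vector_derivative 1 / (Complex a (s - s1) * Complex b (s2 - s))) (at s)" for s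
  proof -
    have 1: "((\<lambda>s. arctan ((s - s1) / a) + arctan ((s - s2) / b)) has_real_derivative
        a / (a\<^sup>2 + (s - s1)\<^sup>2) + b / (b\<^sup>2 + (s - s2)\<^sup>2)) (at s)"
      by (intro DERIV_add DERIV_arctan_affine a b)
    have 2: "((\<lambda>s. (ln (b\<^sup>2 + (s - s2)\<^sup>2) - ln (a\<^sup>2 + (s - s1)\<^sup>2)) / 2) has_real_derivative
        (s - s2) / (b\<^sup>2 + (s - s2)\<^sup>2) - (s - s1) / (a\<^sup>2 + (s - s1)\<^sup>2)) (at s)"
    proof -
      have ln: "((\<lambda>s. ln (d\<^sup>2 + (s - c)\<^sup>2)) has_real_derivative 2 * ((s - c) / (d\<^sup>2 + (s - c)\<^sup>2))) (at s)"
        if "d > 0" for d c :: real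
      proof -
        have "d\<^sup>2 + (s - c)\<^sup>2 > 0" using that by (simp add: add_pos_nonneg)
        then show ?thesis by (auto intro!: derivative_eq_intros)
      qed
      have eq: "(2 * u - 2 * v) / 2 = u - v" for u v :: real by simp
      show ?thesis
        by (rule DERIV_cong[OF DERIV_cdivide[OF DERIV_diff[OF ln[OF b] ln[OF a]]] eq])
    qed
    have "(F has_vector_derivative (of_real (a / (a\<^sup>2 + (s - s1)\<^sup>2) + b / (b\<^sup>2 + (s - s2)\<^sup>2))
        + \<i> * of_real ((s - s2) / (b\<^sup>2 + (s - s2)\<^sup>2) - (s - s1) / (a\<^sup>2 + (s - s1)\<^sup>2))) / E) (at s)"
      unfolding F_def
      by (intro has_vector_derivative_divide has_vector_derivative_add has_vector_derivative_mult_right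
          has_vector_derivative_of_real 1 2)
    also have "(of_real (a / (a\<^sup>2 + (s - s1)\<^sup>2) + b / (b\<^sup>2 + (s - s2)\<^sup>2))
        + \<i> * of_real ((s - s2) / (b\<^sup>2 + (s - s2)\<^sup>2) - (s - s1) / (a\<^sup>2 + (s - s1)\<^sup>2))) / E
        = (1 / Complex a (s - s1) + 1 / Complex b (s2 - s)) / E"
      unfolding inv1 inv2 by (simp add: algebra_simps)
    also have "\<dots> = 1 / (Complex a (s - s1) * Complex b (s2 - s))"
    proof -
      have "E = Complex a (s - s1) + Complex b (s2 - s)" by (simp add: E_def complex_eq_iff)
      then have "1 / Complex a (s - s1) + 1 / Complex b (s2 - s)
          = E / (Complex a (s - s1) * Complex b (s2 - s))"
        using nz[of s] by (simp add: add_frac_eq add.commute)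
      then show ?thesis using E by simp
    qed
    finally show ?thesis .
  qed
  have "continuous_on UNIV (\<lambda>s. 1 / (Complex a (s - s1) * Complex b (s2 - s)))"
    using nz continuous_Complex_line[of a 1 "-s1"] continuous_Complex_line[of b "-1" s2]
    by (intro continuous_intros) auto
  moreover have "integrable lborel (\<lambda>s. 1 / (Complex a (s - s1) * Complex b (s2 - s)))"
    using integrable_power_product[OF a b, of 1 1 s1 s2] by simp
  moreover have "(F \<longlongrightarrow> (of_real (pi / 2 + pi / 2) + \<i> * of_real 0) / E) at_top"
    unfolding F_def
  proof (intro tendsto_intros)
    show "((\<lambda>s. arctan ((s - s1) / a)) \<longlongrightarrow> pi / 2) at_top" by (rule arctan_affine_tendsto[OF a])
    show "((\<lambda>s. arctan ((s - s2) / b)) \<longlongrightarrow> pi / 2) at_top" by (rule arctan_affine_tendsto[OF b])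
    show "((\<lambda>s. (ln (b\<^sup>2 + (s - s2)\<^sup>2) - ln (a\<^sup>2 + (s - s1)\<^sup>2)) / 2) \<longlongrightarrow> 0) at_top"
      by real_asymp
  qed (use E in auto)
  moreover have "(F \<longlongrightarrow> (of_real (- (pi / 2) + - (pi / 2)) + \<i> * of_real 0) / E) at_bot"
    unfolding F_def
  proof (intro tendsto_intros)
    show "((\<lambda>s. arctan ((s - s1) / a)) \<longlongrightarrow> - (pi / 2)) at_bot" by (rule arctan_affine_tendsto[OF a])
    show "((\<lambda>s. arctan ((s - s2) / b)) \<longlongrightarrow> - (pi / 2)) at_bot" by (rule arctan_affine_tendsto[OF b])
    show "((\<lambda>s. (ln (b\<^sup>2 + (s - s2)\<^sup>2) - ln (a\<^sup>2 + (s - s1)\<^sup>2)) / 2) \<longlongrightarrow> 0) at_bot"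
      by real_asymp
  qed (use E in auto)
  ultimately have "(LBINT s. 1 / (Complex a (s - s1) * Complex b (s2 - s)))
      = (of_real (pi / 2 + pi / 2) + \<i> * of_real 0) / E
        - (of_real (- (pi / 2) + - (pi / 2)) + \<i> * of_real 0) / E"
    using deriv by (intro integral_real_line_FTC)
  also have "\<dots> = 2 * of_real pi / E" by (simp flip: diff_divide_distrib)
  finally show ?thesis by (simp add: E_def)
qed

text \<open>
  The sum of the two factors does not depend on \<open>s\<close>. Multiplying the integral by it lowers one of the two
  exponents at a time, which is Pascal's recursion; a term with only one factor left
  has an antiderivative that vanishes at both ends.
\<close>

lemma integral_power_product:
  fixes a b s1 s2 :: real
  assumes a: "a > 0" and b: "b > 0"
  shows "(LBINT s. 1 / (Complex a (s - s1) ^ Suc p * Complex b (s2 - s) ^ Suc q))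
    = 2 * of_real pi * of_nat ((p + q) choose p) / Complex (a + b) (s2 - s1) ^ Suc (p + q)"
proof -
  define X Y where "X s = Complex a (s - s1)" and "Y s = Complex b (s2 - s)" for s
  define E where "E = Complex (a + b) (s2 - s1)"
  have XY: "X s + Y s = E" for s by (simp add: X_def Y_def E_def complex_eq_iff)
  have E: "E \<noteq> 0" using Complex_nonzero[of "a + b"] a b by (simp add: E_def)
  have nz: "X s \<noteq> 0" "Y s \<noteq> 0" for s
    using Complex_nonzero[OF a] Complex_nonzero[OF b] by (auto simp: X_def Y_def)
  define I where "I p q = (LBINT s. 1 / (X s ^ p * Y s ^ q))" for p q
  have int: "integrable lborel (\<lambda>s. 1 / (X s ^ p * Y s ^ q))" if "p + q \<ge> 2" for p q
    unfolding X_def Y_def by (rule integrable_power_product[OF a b that])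
  have I0: "I (Suc (Suc p)) 0 = 0" "I 0 (Suc (Suc p)) = 0" for p
    using integral_inverse_power_line[OF a, of 1 "Suc (Suc p)" "- s1"]
      integral_inverse_power_line[OF b, of "-1" "Suc (Suc p)" s2] int[of "Suc (Suc p)" 0] int[of 0 "Suc (Suc p)"]
    by (simp_all add: I_def X_def Y_def)
  have I11: "I 1 1 = 2 * of_real pi / E"
    using integral_inverse_product_line[OF a b] by (simp add: I_def X_def Y_def E_def)
  have rec: "E * I (Suc p) (Suc q) = I p (Suc q) + I (Suc p) q" if "p + q \<ge> 1" for p q
  proof -
    have "E * I (Suc p) (Suc q) = (LBINT s. E * (1 / (X s ^ Suc p * Y s ^ Suc q)))"
      unfolding I_def by (rule integral_mult_right_zero [symmetric])
    also have "\<dots> = (LBINT s. 1 / (X s ^ p * Y s ^ Suc q) + 1 / (X s ^ Suc p * Y s ^ q))"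
    proof (rule Bochner_Integration.integral_cong[OF refl])
      fix s
      show "E * (1 / (X s ^ Suc p * Y s ^ Suc q))
          = 1 / (X s ^ p * Y s ^ Suc q) + 1 / (X s ^ Suc p * Y s ^ q)"
        unfolding XY[of s, symmetric] using nz[of s] by (simp add: field_simps)
    qed
    also have "\<dots> = I p (Suc q) + I (Suc p) q"
      unfolding I_def using that by (intro Bochner_Integration.integral_add int) auto
    finally show ?thesis .
  qed
  have "I (Suc p) (Suc q) = 2 * of_real pi * of_nat ((p + q) choose p) / E ^ Suc (p + q)"
  proof (induction "p + q" arbitrary: p q)
    case 0
    then show ?case using I11 by simp
  next
    case (Suc n)
    have "E * I (Suc p) (Suc q) = 2 * of_real pi * of_nat ((p + q) choose p) / E ^ (p + q)"
    proof (cases p)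
      case 0
      then obtain q' where q: "q = Suc q'" using Suc by (cases q) auto
      show ?thesis using rec[of p q] Suc.hyps(1)[of p q'] Suc.hyps(2) 0 q I0(2)[of q'] by simp
    next
      case p: (Suc p')
      show ?thesis
      proof (cases q)
        case 0
        then show ?thesis
          using rec[of p q] Suc.hyps(1)[of p' q] Suc.hyps(2) p I0(1)[of p'] by simp
      next
        case q: (Suc q')
        have "E * I (Suc p) (Suc q) = I (Suc p') (Suc q) + I (Suc p) (Suc q')"
          using rec[of p q] p q by simp
        also have "\<dots> = 2 * of_real pi * (of_nat ((p' + q) choose p') + of_nat ((p + q') choose p)) / E ^ (p + q)"
          using Suc.hyps(1)[of p' q] Suc.hyps(1)[of p q'] Suc.hyps(2) p q
          by (simp add: add_divide_distrib distrib_left)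
        also have "of_nat ((p' + q) choose p') + of_nat ((p + q') choose p)
            = (of_nat ((p + q) choose p) :: complex)"
          using p q by (simp flip: of_nat_add)
        finally show ?thesis .
      qed
    qed
    then show ?case using E by (simp add: field_simps)
  qed
  then show ?thesis unfolding I_def X_def Y_def E_def .
qed

section \<open>Laplace transforms\<close>

definition half_line :: "real measure" where
  "half_line = restrict_space lborel {0<..}"

lemma space_half_line [simp]: "space half_line = {0<..}"
  by (simp add: half_line_def space_restrict_space)

lemma sets_half_line [measurable_cong]: "sets half_line = sets (restrict_space borel {0<..})"
  unfolding half_line_def by (simp add: sets_restrict_space)

lemma sigma_finite_half_line: "sigma_finite_measure half_line"
  unfolding half_line_def
  by (intro sigma_finite_measure_restrict_space lborel.sigma_finite_measure_axioms) auto

lemma half_line_measurableI: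
  "f \<in> borel_measurable borel \<Longrightarrow> f \<in> borel_measurable half_line"
  unfolding half_line_def by (intro measurable_restrict_space1) simp

lemma nn_integral_half_line:
  "(\<integral>\<^sup>+x. f x \<partial>half_line) = (\<integral>\<^sup>+x. f x * indicator {0<..} x \<partial>lborel)"
  unfolding half_line_def by (rule nn_integral_restrict_space) simp

lemma integral_half_line:
  fixes f :: "real \<Rightarrow> 'b::{banach, second_countable_topology}"
  shows "(\<integral>x. f x \<partial>half_line) = (LBINT x:{0<..}. f x)"
  unfolding half_line_def set_lebesgue_integral_def by (subst integral_restrict_space) auto

lemma integrable_half_line:
  fixes f :: "real \<Rightarrow> 'b::{banach, second_countable_topology}"
  shows "integrable half_line f \<longleftrightarrow> set_integrable lborel {0<..} f"
  unfolding half_line_def set_integrable_def by (subst integrable_restrict_space) auto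

lemma einterval_0_infinity: "einterval 0 \<infinity> = {0<..}"
  by (auto simp: einterval_def zero_ereal_def)

lemma nn_integral_Gamma_half_line:
  assumes "a > 0"
  shows "(\<integral>\<^sup>+x. ennreal (x powr (a - 1) * exp (- x)) \<partial>half_line) = ennreal (Gamma a)"
proof -
  have "(\<integral>\<^sup>+x. ennreal (x powr (a - 1) * exp (- x)) \<partial>half_line)
      = (\<integral>\<^sup>+x. ennreal (indicator {0..} x * x powr (a - 1) / exp x) \<partial>lborel)"
    unfolding nn_integral_half_line
    by (intro nn_integral_cong) (auto simp: indicator_def exp_minus field_simps)
  then show ?thesis by (simp add: Gamma_conv_nn_integral_real[OF assms])
qed

text \<open>The substitution \<open>x = (t / \<kappa>)\<^bsup>1/\<gamma>\<^esup>\<close> turns the integral into the Gamma integral at \<open>a / \<gamma>\<close>.\<close>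

lemma nn_integral_powr_exp_powr:
  fixes a \<gamma> \<kappa> :: real
  assumes a: "a > 0" and \<gamma>: "\<gamma> > 0" and \<kappa>: "\<kappa> > 0"
  shows "(\<integral>\<^sup>+x. ennreal (x powr (a - 1) * exp (- (\<kappa> * x powr \<gamma>))) \<partial>half_line)
    = ennreal (Gamma (a / \<gamma>) / \<gamma> * \<kappa> powr (- a / \<gamma>))"
proof -
  define f where "f x = x powr (a - 1) * exp (- (\<kappa> * x powr \<gamma>))" for x
  define g where "g x = (x / \<kappa>) powr (1 / \<gamma>)" for x
  define g' where "g' x = 1 / \<gamma> * (x / \<kappa>) powr (1 / \<gamma> - 1) * (1 / \<kappa>)" for x
  define c where "c = 1 / \<gamma> * \<kappa> powr (- a / \<gamma>)"
  have c: "c \<ge> 0" using \<gamma> by (simp add: c_def)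
  have ag: "a / \<gamma> > 0" using a \<gamma> by simp
  have eq: "f (g x) * g' x = c * (x powr (a / \<gamma> - 1) * exp (- x))" if "x > 0" for x
  proof -
    have 1: "(x / \<kappa>) powr (1 / \<gamma>) > 0" using that \<kappa> by simp
    have "f (g x) = (x / \<kappa>) powr ((a - 1) / \<gamma>) * exp (- x)"
      unfolding f_def g_def using that \<kappa> \<gamma> by (simp add: powr_powr)
    then have "f (g x) * g' x = (x / \<kappa>) powr ((a - 1) / \<gamma> + (1 / \<gamma> - 1)) * exp (- x) / \<gamma> / \<kappa>"
      unfolding powr_add g'_def by simp
    also have "(a - 1) / \<gamma> + (1 / \<gamma> - 1) = a / \<gamma> - 1" using \<gamma> by (simp add: field_simps)
    also have "(x / \<kappa>) powr (a / \<gamma> - 1) = x powr (a / \<gamma> - 1) * \<kappa> powr (- a / \<gamma>) * \<kappa>"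
      using that \<kappa> by (simp add: powr_divide powr_diff powr_minus_divide)
    finally show ?thesis using \<kappa> by (simp add: c_def)
  qed
  have nn: "(\<integral>\<^sup>+x. ennreal (f (g x) * g' x) \<partial>half_line) = ennreal (c * Gamma (a / \<gamma>))"
  proof -
    have "(\<integral>\<^sup>+x. ennreal (f (g x) * g' x) \<partial>half_line)
        = (\<integral>\<^sup>+x. ennreal c * ennreal (x powr (a / \<gamma> - 1) * exp (- x)) \<partial>half_line)"
      using c by (intro nn_integral_cong) (auto simp: eq ennreal_mult)
    also have "\<dots> = ennreal (c * Gamma (a / \<gamma>))"
      by (subst nn_integral_cmult)
        (auto intro!: half_line_measurableI
          simp only: nn_integral_Gamma_half_line[OF ag] ennreal_mult'[OF c], measurable)
    finally show ?thesis .
  qed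
  have fm: "f \<in> borel_measurable borel" "g \<in> borel_measurable borel" "g' \<in> borel_measurable borel"
    unfolding f_def g_def g'_def by measurable
  have fg_nonneg: "f (g x) * g' x \<ge> 0" for x
    unfolding f_def g_def g'_def using \<gamma> \<kappa> by (intro mult_nonneg_nonneg) auto
  have int: "integrable half_line (\<lambda>x. f (g x) * g' x)"
    using nn fm fg_nonneg by (intro integrableI_nonneg) (auto intro!: half_line_measurableI)
  have val: "(\<integral>x. f (g x) * g' x \<partial>half_line) = c * Gamma (a / \<gamma>)"
    using nn fm fg_nonneg c ag
    by (subst integral_eq_nn_integral) (auto intro!: half_line_measurableI)
  have deriv: "DERIV g x :> g' x" if "0 < ereal x" for x
    unfolding g_def g'_def using that \<kappa>
    by (auto intro!: derivative_eq_intros simp: powr_diff zero_ereal_def)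
  have contf: "isCont f (g x)" if "0 < ereal x" for x
  proof -
    have "g x > 0" using that \<kappa> by (simp add: g_def zero_ereal_def)
    then show ?thesis unfolding f_def by (intro continuous_intros) auto
  qed
  have contg': "isCont g' x" if "0 < ereal x" for x
    unfolding g'_def using that \<kappa> by (intro continuous_intros) (auto simp: zero_ereal_def)
  have f_nonneg: "0 \<le> f (g x)" and g'_nonneg: "0 \<le> g' x" for x
    using \<gamma> \<kappa> by (auto simp: f_def g'_def)
  have lim0: "((ereal \<circ> g \<circ> real_of_ereal) \<longlongrightarrow> 0) (at_right 0)"
  proof -
    have "(g \<longlongrightarrow> 0) (at_right 0)"
      unfolding g_def
    proof (rule tendsto_zero_powrI[where b = "1 / \<gamma>"])
      show "((\<lambda>x. x / \<kappa>) \<longlongrightarrow> 0) (at_right 0)" using \<kappa> by (auto intro!: tendsto_eq_intros)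
      show "\<forall>\<^sub>F x in at_right 0. 0 \<le> x / \<kappa>"
        using eventually_at_right_less[of 0] by eventually_elim (use \<kappa> in simp)
    qed (use \<gamma> in \<open>auto intro: tendsto_const\<close>)
    then show ?thesis unfolding zero_ereal_def ereal_tendsto_simps .
  qed
  have lim_infty: "((ereal \<circ> g \<circ> real_of_ereal) \<longlongrightarrow> \<infinity>) (at_left \<infinity>)"
  proof -
    have "filterlim g at_top at_top" unfolding g_def using \<gamma> \<kappa> by real_asymp
    then show ?thesis unfolding ereal_tendsto_simps .
  qed
  have integrable_fg: "set_integrable lborel (einterval 0 \<infinity>) (\<lambda>x. f (g x) * g' x)"
    using int by (simp add: integrable_half_line einterval_0_infinity)
  have "0 < (\<infinity>::ereal)" by simp
  note subst = interval_integral_substitution_nonneg[OF this deriv contf contg' f_nonneg g'_nonneg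
      lim0 lim_infty integrable_fg]
  have intf: "integrable half_line f" and valf: "(\<integral>x. f x \<partial>half_line) = c * Gamma (a / \<gamma>)"
    using val subst unfolding integrable_half_line integral_half_line einterval_0_infinity
    by (simp_all add: interval_lebesgue_integral_def einterval_0_infinity zero_ereal_def [symmetric])
  have "(\<integral>\<^sup>+x. ennreal (f x) \<partial>half_line) = ennreal (c * Gamma (a / \<gamma>))"
    unfolding valf [symmetric] by (rule nn_integral_eq_integral[OF intf]) (simp add: f_def)
  then show ?thesis by (simp add: f_def c_def mult.commute)
qed

lemma nn_integral_powr_exp:
  assumes "a > 0" "X > 0"
  shows "(\<integral>\<^sup>+t. ennreal (t powr (a - 1) * exp (- (X * t))) \<partial>half_line) = ennreal (Gamma a * X powr (- a))"
proof -
  have "(\<integral>\<^sup>+t. ennreal (t powr (a - 1) * exp (- (X * t))) \<partial>half_line)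
      = (\<integral>\<^sup>+t. ennreal (t powr (a - 1) * exp (- (X * t powr 1))) \<partial>half_line)"
    by (intro nn_integral_cong) simp
  then show ?thesis using nn_integral_powr_exp_powr[OF assms(1) zero_less_one assms(2)] by simp
qed

lemma complex_Laplace_integrable:
  assumes X: "Re X > 0"
  shows "integrable half_line (\<lambda>t. of_real t ^ n * exp (- (of_real t * X)))"
proof (rule integrableI_bounded)
  show "(\<lambda>t. of_real t ^ n * exp (- (of_real t * X))) \<in> borel_measurable half_line"
    by (intro half_line_measurableI borel_measurable_continuous_onI continuous_intros)
  have "(\<integral>\<^sup>+t. ennreal (norm (of_real t ^ n * exp (- (of_real t * X)))) \<partial>half_line)
      = (\<integral>\<^sup>+t. ennreal (t powr (real (Suc n) - 1) * exp (- (Re X * t))) \<partial>half_line)"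
    by (intro nn_integral_cong) (auto simp: norm_mult norm_power powr_realpow mult.commute)
  also have "\<dots> = ennreal (Gamma (real (Suc n)) * Re X powr (- real (Suc n)))"
    using X by (intro nn_integral_powr_exp) auto
  finally show "(\<integral>\<^sup>+t. ennreal (norm (of_real t ^ n * exp (- (of_real t * X)))) \<partial>half_line) < \<infinity>"
    by simp
qed

text \<open>
  The derivative of \<open>t\<^sup>n e\<^bsup>- t X\<^esup>\<close> integrates to minus its value at \<open>0\<close>, which relates the integrals for consecutive \<open>n\<close>.
\<close>

lemma complex_Laplace:
  assumes X: "Re X > 0"
  shows "(\<integral>t. of_real t ^ n * exp (- (of_real t * X)) \<partial>half_line) = fact n / X ^ Suc n"
proof -
  have X0: "X \<noteq> 0" using X by auto
  define J where "J n = (\<integral>t. of_real t ^ n * exp (- (of_real t * X)) \<partial>half_line)" for n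
  define F where "F n t = of_real t ^ n * exp (- (of_real t * X))" for n and t :: real
  have int: "integrable half_line (F n)" for n
    unfolding F_def by (rule complex_Laplace_integrable[OF X])
  have lim: "(F n \<longlongrightarrow> 0) at_top" for n
  proof (rule tendsto_norm_zero_cancel)
    have "((\<lambda>t. t ^ n / exp (t * Re X)) \<longlongrightarrow> 0) at_top"
    proof -
      have "filterlim (\<lambda>t. t * Re X) at_top at_top"
        using X by (intro filterlim_at_top_mult_tendsto_pos[OF tendsto_const] filterlim_ident) auto
      from filterlim_compose[OF tendsto_power_div_exp_0[of n] this]
      have "((\<lambda>t. (t * Re X) ^ n / exp (t * Re X)) \<longlongrightarrow> 0) at_top" .
      from tendsto_mult_left[OF this, of "1 / Re X ^ n"] show ?thesis
        using X by (simp add: power_mult_distrib)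
    qed
    moreover have "\<forall>\<^sub>F t in at_top. t ^ n / exp (t * Re X) = norm (F n t)"
      using eventually_ge_at_top[of 0]
      by eventually_elim (simp add: F_def norm_mult norm_power divide_inverse flip: exp_minus)
    ultimately show "((\<lambda>t. norm (F n t)) \<longlongrightarrow> 0) at_top"
      by (rule Lim_transform_eventually)
  qed
  have FTC: "(\<integral>t. G' t \<partial>half_line) = - G 0"
    if "\<And>t. (G has_vector_derivative G' t) (at t)" "continuous_on UNIV G'" "integrable half_line G'"
      "(G \<longlongrightarrow> 0) at_top" for G G' :: "real \<Rightarrow> complex"
  proof -
    have "isCont G 0" using that(1)[of 0] has_vector_derivative_continuous by blast
    then have "(G \<longlongrightarrow> G 0) (at_right 0)" by (simp add: continuous_within filterlim_at_split)
    then have "(LBINT t=0..\<infinity>. G' t) = 0 - G 0"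
      using that
      by (intro interval_integral_FTC_integrable[where F = G])
        (auto simp: ereal_tendsto_simps zero_ereal_def einterval_0_infinity[unfolded zero_ereal_def] integrable_half_line
          continuous_on_eq_continuous_at)
    then show ?thesis
      unfolding integral_half_line
      by (simp add: interval_lebesgue_integral_def einterval_0_infinity)
  qed
  have vd: "((\<lambda>t. exp (- (of_real t * X))) has_vector_derivative - X * exp (- (of_real t * X))) (at t)" for t
  proof -
    have "((\<lambda>z. exp (- (z * X))) has_field_derivative - X * exp (- (of_real t * X))) (at (of_real t))"
      by (auto intro!: derivative_eq_intros)
    then show ?thesis by (rule has_vector_derivative_real_field)
  qed
  have J0: "X * J 0 = 1"
  proof -
    have "(\<integral>t. - X * F 0 t \<partial>half_line) = - F 0 0"
      using int[of 0] vd lim[of 0] unfolding F_def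
      by (intro FTC) (auto intro!: continuous_intros)
    then show ?thesis by (simp add: J_def F_def)
  qed
  have JS: "X * J (Suc n) = of_nat (Suc n) * J n" for n
  proof -
    have "(\<integral>t. of_nat (Suc n) * F n t - X * F (Suc n) t \<partial>half_line) = - F (Suc n) 0"
    proof (rule FTC)
      fix t
      have "((\<lambda>z. z ^ Suc n * exp (- (z * X))) has_field_derivative of_nat (Suc n) * F n t - X * F (Suc n) t)
          (at (of_real t))"
        unfolding F_def by (rule derivative_eq_intros refl | simp add: algebra_simps)+
      then show "(F (Suc n) has_vector_derivative of_nat (Suc n) * F n t - X * F (Suc n) t) (at t)"
        unfolding F_def by (rule has_vector_derivative_real_field)
      show "integrable half_line (\<lambda>t. of_nat (Suc n) * F n t - X * F (Suc n) t)"
        using int by (intro Bochner_Integration.integrable_diff integrable_mult_right) auto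
      show "continuous_on UNIV (\<lambda>t. of_nat (Suc n) * F n t - X * F (Suc n) t)"
        unfolding F_def by (intro continuous_intros)
    qed (rule lim)
    moreover have "J n = (\<integral>t. F n t \<partial>half_line)" for n by (simp add: J_def F_def)
    moreover have "F (Suc n) 0 = 0" by (simp add: F_def)
    ultimately show ?thesis using int[of n] int[of "Suc n"] by (simp del: of_nat_Suc)
  qed
  have "J n = fact n / X ^ Suc n"
  proof (induction n)
    case 0
    then show ?case using J0 X0 by (simp add: field_simps)
  next
    case (Suc n)
    have "J (Suc n) = of_nat (Suc n) * J n / X"
      using JS[of n] X0 by (simp add: nonzero_eq_divide_eq mult.commute del: of_nat_Suc)
    then show ?case by (simp add: Suc.IH mult_ac del: of_nat_Suc)
  qed
  then show ?thesis by (simp add: J_def)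
qed

text \<open>
  Writing \<open>1 / (X + W)\<^sup>N\<close> as a Laplace integral reduces its integral over \<open>y\<close> to that of
  \<open>exp (- \<xi> W)\<close>, which in the applications is a power of \<open>\<xi>\<close> by homogeneity.
\<close>

lemma nn_integral_inverse_power:
  assumes "sigma_finite_measure \<omega>" and W: "W \<in> borel_measurable \<omega>" "\<And>y. y \<in> space \<omega> \<Longrightarrow> W y \<ge> 0"
    and Laplace: "\<And>\<xi>. \<xi> > 0 \<Longrightarrow> (\<integral>\<^sup>+y. ennreal (exp (- (\<xi> * W y))) \<partial>\<omega>) = ennreal (D * \<xi> powr (- p))"
    and D: "D \<ge> 0" and N: "p < N" "N > 0" and X: "X > 0"
  shows "(\<integral>\<^sup>+y. ennreal ((X + W y) powr (- N)) \<partial>\<omega>)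
    = ennreal (D * Gamma (N - p) / Gamma N * X powr (p - N))"
proof -
  interpret pair_sigma_finite \<omega> half_line
    using assms(1) sigma_finite_half_line by (simp add: pair_sigma_finite_def)
  note [measurable] = W(1)
  have id [measurable]: "(\<lambda>x. x) \<in> borel_measurable half_line" by (rule half_line_measurableI) simp
  have "ennreal (Gamma N) * (\<integral>\<^sup>+y. ennreal ((X + W y) powr (- N)) \<partial>\<omega>)
      = (\<integral>\<^sup>+y. ennreal (Gamma N * (X + W y) powr (- N)) \<partial>\<omega>)"
    using N(2) by (subst nn_integral_cmult [symmetric]) (auto simp: ennreal_mult)
  also have "\<dots> = (\<integral>\<^sup>+y. \<integral>\<^sup>+t. ennreal (t powr (N - 1) * exp (- ((X + W y) * t))) \<partial>half_line \<partial>\<omega>)"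
    using N(2) W(2) X
    by (intro nn_integral_cong) (subst nn_integral_powr_exp, auto intro: add_pos_nonneg)
  also have "\<dots> = (\<integral>\<^sup>+t. \<integral>\<^sup>+y. ennreal (t powr (N - 1) * exp (- ((X + W y) * t))) \<partial>\<omega> \<partial>half_line)"
    by (rule Fubini' [symmetric]) measurable
  also have "\<dots> = (\<integral>\<^sup>+t. ennreal D * ennreal (t powr ((N - p) - 1) * exp (- (X * t))) \<partial>half_line)"
  proof (rule nn_integral_cong)
    fix t assume "t \<in> space half_line"
    then have t: "t > 0" by simp
    have "(\<integral>\<^sup>+y. ennreal (t powr (N - 1) * exp (- ((X + W y) * t))) \<partial>\<omega>)
        = (\<integral>\<^sup>+y. ennreal (t powr (N - 1) * exp (- (X * t))) * ennreal (exp (- (t * W y))) \<partial>\<omega>)"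
      by (intro nn_integral_cong) (simp add: ennreal_mult [symmetric] exp_add [symmetric] algebra_simps)
    also have "\<dots> = ennreal (t powr (N - 1) * exp (- (X * t))) * ennreal (D * t powr (- p))"
      by (subst nn_integral_cmult) (auto simp: Laplace[OF t])
    also have "\<dots> = ennreal D * ennreal (t powr ((N - p) - 1) * exp (- (X * t)))"
    proof -
      have "t powr ((N - p) - 1) = t powr (N - 1) * t powr (- p)"
        by (simp add: powr_add [symmetric] algebra_simps)
      then show ?thesis using D by (simp add: ennreal_mult [symmetric] algebra_simps)
    qed
    finally show "(\<integral>\<^sup>+y. ennreal (t powr (N - 1) * exp (- ((X + W y) * t))) \<partial>\<omega>)
      = ennreal D * ennreal (t powr ((N - p) - 1) * exp (- (X * t)))" .
  qed
  also have "\<dots> = ennreal D * ennreal (Gamma (N - p) * X powr (- (N - p)))"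
    using N X by (subst nn_integral_cmult) (auto simp: nn_integral_powr_exp)
  finally have eq: "ennreal (Gamma N) * (\<integral>\<^sup>+y. ennreal ((X + W y) powr (- N)) \<partial>\<omega>)
      = ennreal (D * (Gamma (N - p) * X powr (p - N)))"
    using D by (simp add: ennreal_mult')
  have G: "Gamma N > 0" using N(2) by simp
  have "ennreal (1 / Gamma N) * (ennreal (Gamma N) * (\<integral>\<^sup>+y. ennreal ((X + W y) powr (- N)) \<partial>\<omega>))
      = ennreal (1 / Gamma N * (D * (Gamma (N - p) * X powr (p - N))))"
    unfolding eq using G by (subst ennreal_mult') auto
  moreover have "ennreal (1 / Gamma N) * ennreal (Gamma N) = 1"
    using G by (simp add: ennreal_mult' [symmetric])
  ultimately show ?thesis by (simp add: mult.assoc [symmetric])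
qed

text \<open>
  The same identity for complex \<open>X\<close>, where an integral exponent on the right-hand side avoids
  complex powers. The real case, applied to \<open>Re X\<close>, justifies the exchange of the integrals.
\<close>

lemma integral_complex_inverse_power:
  assumes \<omega>: "sigma_finite_measure \<omega>" and W: "W \<in> borel_measurable \<omega>" "\<And>y. y \<in> space \<omega> \<Longrightarrow> W y \<ge> 0"
    and Laplace: "\<And>\<xi>. \<xi> > 0 \<Longrightarrow>
      (\<integral>\<^sup>+y. ennreal (exp (- (\<xi> * W y))) \<partial>\<omega>) = ennreal (D * \<xi> powr (- (real (Suc n) - real (Suc m))))"
    and D: "D \<ge> 0" and X: "Re X > 0"
  shows "(\<integral>y. 1 / (X + of_real (W y)) ^ Suc n \<partial>\<omega>) = of_real (D * fact m / fact n) / X ^ Suc m"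
proof -
  interpret pair_sigma_finite \<omega> half_line
    using \<omega> sigma_finite_half_line by (simp add: pair_sigma_finite_def)
  note [measurable] = W(1)
  have id [measurable]: "(\<lambda>x. x) \<in> borel_measurable half_line" by (rule half_line_measurableI) simp
  define f where "f y t = of_real t ^ n * exp (- (of_real t * (X + of_real (W y))))" for y and t :: real
  have meas [measurable]: "(\<lambda>(y, t). f y t) \<in> borel_measurable (\<omega> \<Otimes>\<^sub>M half_line)"
    unfolding f_def by measurable
  have ReXW: "Re (X + of_real (W y)) > 0" if "y \<in> space \<omega>" for y
    using X W(2)[OF that] by simp
  have norm_f: "norm (f y t) = t powr (real (Suc n) - 1) * exp (- ((Re X + W y) * t))"
    if "t > 0" for y t
    using that by (simp add: f_def norm_mult norm_power powr_realpow mult.commute)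
  have "(\<integral>\<^sup>+z. ennreal (norm (case z of (y, t) \<Rightarrow> f y t)) \<partial>(\<omega> \<Otimes>\<^sub>M half_line))
      = (\<integral>\<^sup>+y. \<integral>\<^sup>+t. ennreal (norm (f y t)) \<partial>half_line \<partial>\<omega>)"
    by (subst M2.nn_integral_fst [symmetric]) auto
  also have "\<dots> = (\<integral>\<^sup>+y. ennreal (Gamma (real (Suc n))) * ennreal ((Re X + W y) powr (- real (Suc n))) \<partial>\<omega>)"
  proof (rule nn_integral_cong)
    fix y assume y: "y \<in> space \<omega>"
    have "(\<integral>\<^sup>+t. ennreal (norm (f y t)) \<partial>half_line)
        = (\<integral>\<^sup>+t. ennreal (t powr (real (Suc n) - 1) * exp (- ((Re X + W y) * t))) \<partial>half_line)"
      by (intro nn_integral_cong) (auto simp: norm_f)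
    also have "\<dots> = ennreal (Gamma (real (Suc n)) * (Re X + W y) powr (- real (Suc n)))"
      using ReXW[OF y] by (intro nn_integral_powr_exp) auto
    finally show "(\<integral>\<^sup>+t. ennreal (norm (f y t)) \<partial>half_line)
        = ennreal (Gamma (real (Suc n))) * ennreal ((Re X + W y) powr (- real (Suc n)))"
      by (simp only: ennreal_mult' [OF less_imp_le [OF Gamma_real_pos [OF of_nat_0_less_iff [THEN iffD2, OF zero_less_Suc]]]])
  qed
  also have "\<dots> < \<infinity>"
    using nn_integral_inverse_power[OF \<omega> W Laplace D, where N = "real (Suc n)" and X = "Re X"] X
    by (subst nn_integral_cmult) (auto simp: ennreal_mult_less_top)
  finally have int: "integrable (\<omega> \<Otimes>\<^sub>M half_line) (\<lambda>(y, t). f y t)"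
    by (intro integrableI_bounded) auto
  have inner: "(\<integral>t. f y t \<partial>half_line) = fact n / (X + of_real (W y)) ^ Suc n" if "y \<in> space \<omega>" for y
    unfolding f_def by (rule complex_Laplace[OF ReXW[OF that]])
  have "(\<integral>y. fact n / (X + of_real (W y)) ^ Suc n \<partial>\<omega>) = (\<integral>y. \<integral>t. f y t \<partial>half_line \<partial>\<omega>)"
    by (intro Bochner_Integration.integral_cong) (simp_all add: inner)
  also have "\<dots> = (\<integral>t. \<integral>y. f y t \<partial>\<omega> \<partial>half_line)"
    by (rule Fubini_integral[OF int, symmetric])
  also have "\<dots> = (\<integral>t. of_real D * (of_real t ^ m * exp (- (of_real t * X))) \<partial>half_line)"
  proof (rule Bochner_Integration.integral_cong[OF refl])
    fix t assume "t \<in> space half_line"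
    then have t: "t > 0" by simp
    have "(\<integral>y. exp (- (t * W y)) \<partial>\<omega>) = D * t powr (- (real (Suc n) - real (Suc m)))"
      using Laplace[OF t] D by (subst integral_eq_nn_integral) auto
    also have "t powr (- (real (Suc n) - real (Suc m))) = t ^ m / t ^ n"
      using t by (simp add: powr_diff powr_realpow)
    finally have "(\<integral>y. exp (- (t * W y)) \<partial>\<omega>) = D * (t ^ m / t ^ n)" .
    then have "(\<integral>y. of_real (exp (- (t * W y))) \<partial>\<omega>) = complex_of_real (D * (t ^ m / t ^ n))"
      by (simp only: integral_complex_of_real)
    moreover have "f y t = (of_real t ^ n * exp (- (of_real t * X))) * of_real (exp (- (t * W y)))" for y
      unfolding f_def by (simp add: exp_of_real [symmetric] exp_add [symmetric] algebra_simps)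
    ultimately show "(\<integral>y. f y t \<partial>\<omega>) = of_real D * (of_real t ^ m * exp (- (of_real t * X)))"
      using t by simp
  qed
  also have "\<dots> = of_real D * (fact m / X ^ Suc m)"
    by (subst integral_mult_right_zero) (simp only: complex_Laplace[OF X])
  finally have "fact n * (\<integral>y. 1 / (X + of_real (W y)) ^ Suc n \<partial>\<omega>) = of_real D * (fact m / X ^ Suc m)"
    by (subst integral_mult_right_zero [symmetric]) simp
  then have "(\<integral>y. 1 / (X + of_real (W y)) ^ Suc n \<partial>\<omega>) = of_real D * (fact m / X ^ Suc m) / fact n"
    by (metis nonzero_mult_div_cancel_left fact_nonzero)
  then show ?thesis
    by (simp add: mult.commute)
qed

section \<open>The kernels of the Fourier modes\<close>

text \<open>
  This separates the radial variables of two points from their \<open>s\<close>-coordinates, so that the latter can be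
  integrated first.
\<close>

lemma distr_pair_swap_middle:
  assumes "sigma_finite_measure A" "sigma_finite_measure B" "sigma_finite_measure C" "sigma_finite_measure D"
  shows "distr ((A \<Otimes>\<^sub>M B) \<Otimes>\<^sub>M (C \<Otimes>\<^sub>M D)) ((A \<Otimes>\<^sub>M C) \<Otimes>\<^sub>M (B \<Otimes>\<^sub>M D))
      (\<lambda>p. ((fst (fst p), fst (snd p)), (snd (fst p), snd (snd p))))
    = (A \<Otimes>\<^sub>M C) \<Otimes>\<^sub>M (B \<Otimes>\<^sub>M D)"
    (is "distr ?N ?T ?\<pi> = ?T")
proof (rule measure_eqI)
  interpret A: sigma_finite_measure A by fact
  interpret B: sigma_finite_measure B by fact
  interpret C: sigma_finite_measure C by fact
  interpret D: sigma_finite_measure D by fact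
  interpret BC: pair_sigma_finite B C ..
  interpret CD: pair_sigma_finite C D ..
  interpret BD: pair_sigma_finite B D ..
  have CD: "sigma_finite_measure (C \<Otimes>\<^sub>M D)" "sigma_finite_measure (B \<Otimes>\<^sub>M D)" by unfold_locales
  fix X assume "X \<in> sets (distr ?N ?T ?\<pi>)"
  then have [measurable]: "X \<in> sets ?T" by simp
  have "emeasure (distr ?N ?T ?\<pi>) X = (\<integral>\<^sup>+p. indicator X p \<partial>distr ?N ?T ?\<pi>)"
    by (subst nn_integral_indicator) auto
  also have "\<dots> = (\<integral>\<^sup>+p. indicator X (?\<pi> p) \<partial>?N)"
    by (subst nn_integral_distr) auto
  also have "\<dots> = (\<integral>\<^sup>+ab. \<integral>\<^sup>+cd. indicator X (?\<pi> (ab, cd)) \<partial>(C \<Otimes>\<^sub>M D) \<partial>(A \<Otimes>\<^sub>M B))"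
    by (rule sigma_finite_measure.nn_integral_fst[OF CD(1), symmetric]) measurable
  also have "\<dots> = (\<integral>\<^sup>+a. \<integral>\<^sup>+b. \<integral>\<^sup>+cd. indicator X (?\<pi> ((a, b), cd)) \<partial>(C \<Otimes>\<^sub>M D) \<partial>B \<partial>A)"
    by (rule B.nn_integral_fst[symmetric])
      (intro sigma_finite_measure.borel_measurable_nn_integral[OF CD(1)], measurable)
  also have "\<dots> = (\<integral>\<^sup>+a. \<integral>\<^sup>+b. \<integral>\<^sup>+c. \<integral>\<^sup>+d. indicator X ((a, c), (b, d)) \<partial>D \<partial>C \<partial>B \<partial>A)"
  proof (intro nn_integral_cong)
    fix a b assume [measurable]: "a \<in> space A" "b \<in> space B"
    show "(\<integral>\<^sup>+cd. indicator X (?\<pi> ((a, b), cd)) \<partial>(C \<Otimes>\<^sub>M D)) = (\<integral>\<^sup>+c. \<integral>\<^sup>+d. indicator X ((a, c), (b, d)) \<partial>D \<partial>C)"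
      by (subst D.nn_integral_fst[symmetric]) auto
  qed
  also have "\<dots> = (\<integral>\<^sup>+a. \<integral>\<^sup>+c. \<integral>\<^sup>+b. \<integral>\<^sup>+d. indicator X ((a, c), (b, d)) \<partial>D \<partial>B \<partial>C \<partial>A)"
  proof (intro nn_integral_cong)
    fix a assume [measurable]: "a \<in> space A"
    show "(\<integral>\<^sup>+b. \<integral>\<^sup>+c. \<integral>\<^sup>+d. indicator X ((a, c), (b, d)) \<partial>D \<partial>C \<partial>B)
        = (\<integral>\<^sup>+c. \<integral>\<^sup>+b. \<integral>\<^sup>+d. indicator X ((a, c), (b, d)) \<partial>D \<partial>B \<partial>C)"
      by (rule BC.Fubini'[symmetric]) measurable
  qed
  also have "\<dots> = (\<integral>\<^sup>+a. \<integral>\<^sup>+c. \<integral>\<^sup>+bd. indicator X ((a, c), bd) \<partial>(B \<Otimes>\<^sub>M D) \<partial>C \<partial>A)"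
  proof (intro nn_integral_cong)
    fix a c assume [measurable]: "a \<in> space A" "c \<in> space C"
    show "(\<integral>\<^sup>+b. \<integral>\<^sup>+d. indicator X ((a, c), (b, d)) \<partial>D \<partial>B) = (\<integral>\<^sup>+bd. indicator X ((a, c), bd) \<partial>(B \<Otimes>\<^sub>M D))"
      by (subst D.nn_integral_fst[symmetric]) auto
  qed
  also have "\<dots> = (\<integral>\<^sup>+ac. \<integral>\<^sup>+bd. indicator X (ac, bd) \<partial>(B \<Otimes>\<^sub>M D) \<partial>(A \<Otimes>\<^sub>M C))"
    by (rule C.nn_integral_fst)
      (intro sigma_finite_measure.borel_measurable_nn_integral[OF CD(2)], measurable)
  also have "\<dots> = (\<integral>\<^sup>+p. indicator X p \<partial>?T)"
    by (rule sigma_finite_measure.nn_integral_fst[OF CD(2)]) measurable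
  also have "\<dots> = emeasure ?T X" by (subst nn_integral_indicator) auto
  finally show "emeasure (distr ?N ?T ?\<pi>) X = emeasure ?T X" .
qed simp

text \<open>
  A Fourier coefficient of a function on the hypersurface is a function of \<open>(\<alpha>, s)\<close> with \<open>\<alpha> > 0\<close>, and
  is square-integrable for \<open>\<alpha>\<^sup>r d\<alpha> ds\<close>.
\<close>

definition radial_measure :: "real \<Rightarrow> real measure" where
  "radial_measure r = density half_line (\<lambda>\<alpha>. ennreal (\<alpha> powr r))"

definition profile_measure :: "real \<Rightarrow> (real \<times> real) measure" where
  "profile_measure r = radial_measure r \<Otimes>\<^sub>M lborel"

lemma space_radial_measure [simp]: "space (radial_measure r) = {0<..}"
  by (simp add: radial_measure_def)

lemma space_profile_measure: "space (profile_measure r) = {0<..} \<times> UNIV"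
  by (simp add: profile_measure_def space_pair_measure)

lemma powr_half_line [measurable]: "(\<lambda>x. x powr a) \<in> borel_measurable half_line"
  by (intro half_line_measurableI) measurable

lemma sigma_finite_radial_measure: "sigma_finite_measure (radial_measure r)"
  unfolding radial_measure_def
  by (subst sigma_finite_measure.sigma_finite_iff_density_finite[OF sigma_finite_half_line]) auto

lemma radial_id_measurable: "(\<lambda>x. x) \<in> borel_measurable (radial_measure r)"
  unfolding radial_measure_def by (simp add: half_line_measurableI)

lemma radial_measurableI:
  "f \<in> borel_measurable borel \<Longrightarrow> f \<in> borel_measurable (radial_measure r)"
  using measurable_compose[OF radial_id_measurable] by auto

lemma profile_id_measurable: "(\<lambda>x. x) \<in> borel_measurable (profile_measure r)"
proof -
  have "(\<lambda>x. (fst x, snd x)) \<in> profile_measure r \<rightarrow>\<^sub>M borel \<Otimes>\<^sub>M borel"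
    unfolding profile_measure_def
    by (intro measurable_Pair measurable_compose[OF measurable_fst radial_id_measurable]
        measurable_compose[OF measurable_snd]) auto
  then show ?thesis by (simp add: borel_prod)
qed

lemma profile_measurableI:
  "f \<in> borel_measurable borel \<Longrightarrow> f \<in> borel_measurable (profile_measure r)"
  using measurable_compose[OF profile_id_measurable] by auto

lemma profile_pair_id_measurable:
  "(\<lambda>x. x) \<in> borel_measurable (profile_measure r \<Otimes>\<^sub>M profile_measure r)"
proof -
  have "(\<lambda>x. (fst x, snd x)) \<in> profile_measure r \<Otimes>\<^sub>M profile_measure r \<rightarrow>\<^sub>M borel \<Otimes>\<^sub>M borel"
    by (intro measurable_Pair measurable_compose[OF measurable_fst profile_id_measurable]
        measurable_compose[OF measurable_snd profile_id_measurable])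
  then show ?thesis by (simp add: borel_prod)
qed

lemma nn_integral_radial:
  assumes [measurable]: "f \<in> borel_measurable half_line"
  shows "(\<integral>\<^sup>+x. f x \<partial>radial_measure r) = (\<integral>\<^sup>+x. ennreal (x powr r) * f x \<partial>half_line)"
  unfolding radial_measure_def by (subst nn_integral_density) auto

lemma radial_Laplace:
  assumes "b + r + 1 > 0" "\<gamma> > 0" "\<kappa> > 0"
  shows "(\<integral>\<^sup>+x. ennreal (x powr b * exp (- (\<kappa> * x powr \<gamma>))) \<partial>radial_measure r)
    = ennreal (Gamma ((b + r + 1) / \<gamma>) / \<gamma> * \<kappa> powr (- ((b + r + 1) / \<gamma>)))"
proof -
  have "(\<integral>\<^sup>+x. ennreal (x powr b * exp (- (\<kappa> * x powr \<gamma>))) \<partial>radial_measure r)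
      = (\<integral>\<^sup>+x. ennreal (x powr r) * ennreal (x powr b * exp (- (\<kappa> * x powr \<gamma>))) \<partial>half_line)"
    by (rule nn_integral_radial) measurable
  also have "\<dots> = (\<integral>\<^sup>+x. ennreal (x powr ((b + r + 1) - 1) * exp (- (\<kappa> * x powr \<gamma>))) \<partial>half_line)"
    by (intro nn_integral_cong) (simp add: ennreal_mult [symmetric] powr_add mult_ac)
  also have "\<dots> = ennreal (Gamma ((b + r + 1) / \<gamma>) / \<gamma> * \<kappa> powr (- ((b + r + 1) / \<gamma>)))"
    using nn_integral_powr_exp_powr[OF assms] by (simp only: minus_divide_left)
  finally show ?thesis .
qed

text \<open>The exponent of \<open>X\<close> is forced by the scaling \<open>x \<mapsto> X\<^bsup>1/\<gamma>\<^esup> x\<close>.\<close>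

lemma radial_inverse_power:
  assumes b: "b + r + 1 > 0" and \<gamma>: "\<gamma> > 0" and \<kappa>: "\<kappa> > 0" and N: "(b + r + 1) / \<gamma> < N"
  obtains c where "c \<ge> 0" "\<And>X. X > 0 \<Longrightarrow>
    (\<integral>\<^sup>+x. ennreal (x powr b * (X + \<kappa> * x powr \<gamma>) powr (- N)) \<partial>radial_measure r)
      = ennreal (c * X powr ((b + r + 1) / \<gamma> - N))"
proof -
  define p where "p = (b + r + 1) / \<gamma>"
  define D where "D = Gamma p / \<gamma> * \<kappa> powr (- p)"
  have p: "p > 0" using b \<gamma> by (simp add: p_def)
  have N0: "N > 0" "p < N" using p N by (auto simp: p_def)
  have D: "D \<ge> 0" using p \<gamma> by (simp add: D_def less_imp_le)
  define \<omega> where "\<omega> = density (radial_measure r) (\<lambda>x. ennreal (x powr b))"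
  have m [measurable]: "(\<lambda>x. x powr a) \<in> borel_measurable (radial_measure r)" for a
    by (intro radial_measurableI) measurable
  have \<omega>: "sigma_finite_measure \<omega>"
    unfolding \<omega>_def
    by (subst sigma_finite_measure.sigma_finite_iff_density_finite[OF sigma_finite_radial_measure]) auto
  have dens: "(\<integral>\<^sup>+x. ennreal (f x) \<partial>\<omega>) = (\<integral>\<^sup>+x. ennreal (x powr b * f x) \<partial>radial_measure r)"
    if "f \<in> borel_measurable borel" "\<And>x. f x \<ge> 0" for f
    unfolding \<omega>_def using that
    by (subst nn_integral_density) (auto simp: ennreal_mult intro!: radial_measurableI)
  have "(\<integral>\<^sup>+x. ennreal ((X + \<kappa> * x powr \<gamma>) powr (- N)) \<partial>\<omega>)
      = ennreal (D * Gamma (N - p) / Gamma N * X powr (p - N))" if X: "X > 0" for X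
  proof (rule nn_integral_inverse_power[OF \<omega> _ _ _ D N0(2) N0(1) X])
    show "(\<lambda>x. \<kappa> * x powr \<gamma>) \<in> borel_measurable \<omega>" by (simp add: \<omega>_def)
    show "0 \<le> \<kappa> * y powr \<gamma>" for y using \<kappa> by simp
    fix \<xi> :: real assume \<xi>: "\<xi> > 0"
    have "(\<integral>\<^sup>+y. ennreal (exp (- (\<xi> * (\<kappa> * y powr \<gamma>)))) \<partial>\<omega>)
        = (\<integral>\<^sup>+x. ennreal (x powr b * exp (- ((\<xi> * \<kappa>) * x powr \<gamma>))) \<partial>radial_measure r)"
      by (subst dens) (auto simp: mult.assoc)
    also have "\<dots> = ennreal (Gamma p / \<gamma> * (\<xi> * \<kappa>) powr (- p))"
      unfolding p_def using \<xi> \<kappa> by (intro radial_Laplace b \<gamma>) simp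
    finally show "(\<integral>\<^sup>+y. ennreal (exp (- (\<xi> * (\<kappa> * y powr \<gamma>)))) \<partial>\<omega>) = ennreal (D * \<xi> powr (- p))"
      using \<xi> \<kappa> by (simp add: D_def powr_mult mult_ac)
  qed
  then have "(\<integral>\<^sup>+x. ennreal (x powr b * (X + \<kappa> * x powr \<gamma>) powr (- N)) \<partial>radial_measure r)
      = ennreal (D * Gamma (N - p) / Gamma N * X powr (p - N))" if "X > 0" for X
    using that by (subst dens[symmetric]) auto
  moreover have "D * Gamma (N - p) / Gamma N \<ge> 0"
    using D N0 by (simp add: less_imp_le)
  ultimately show thesis using that unfolding p_def by blast
qed

lemma powr_uminus_of_nat: "x > 0 \<Longrightarrow> x powr (- real n) = 1 / x ^ n"
  by (simp only: powr_minus_divide powr_realpow)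

lemma nn_integral_line_power_le:
  assumes a: "a > 0"
  shows "(\<integral>\<^sup>+t. ennreal (1 / cmod (Complex a (t - s)) ^ (k + 2)) \<partial>lborel) \<le> ennreal (pi * a powr (- real (k + 1)))"
proof -
  have "(\<integral>\<^sup>+t. ennreal (1 / cmod (Complex a (t - s)) ^ (k + 2)) \<partial>lborel)
      \<le> (\<integral>\<^sup>+t. ennreal (1 / a ^ k * (1 / (a\<^sup>2 + (t - s)\<^sup>2))) \<partial>lborel)"
  proof (intro nn_integral_mono ennreal_leI)
    fix t
    have "1 / cmod (Complex a (t - s)) ^ (k + 2) = 1 / cmod (Complex a (t - s)) ^ k * (1 / (a\<^sup>2 + (t - s)\<^sup>2))"
      by (simp add: power_add cmod_def)
    also have "\<dots> \<le> 1 / a ^ k * (1 / (a\<^sup>2 + (t - s)\<^sup>2))"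
      using a norm_Complex_ge[OF a, of "t - s"]
      by (intro mult_right_mono divide_left_mono power_mono) (auto intro!: mult_pos_pos zero_less_power)
    finally show "1 / cmod (Complex a (t - s)) ^ (k + 2) \<le> 1 / a ^ k * (1 / (a\<^sup>2 + (t - s)\<^sup>2))" .
  qed
  also have "\<dots> = ennreal (1 / a ^ k * (pi / a))"
  proof -
    have "integrable lborel (\<lambda>t. 1 / a ^ k * (1 / (a\<^sup>2 + (t - s)\<^sup>2)))"
      by (rule integrable_mult_right[OF integrable_Cauchy_density[OF a]])
    then show ?thesis
      using a unfolding integral_Cauchy_density[OF a, of s, symmetric] integral_mult_right_zero[symmetric]
      by (intro nn_integral_eq_integral) auto
  qed
  also have "1 / a ^ k * (pi / a) = pi * a powr (- real (k + 1))"
    using powr_uminus_of_nat[OF a, of "k + 1"] by simp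
  finally show ?thesis .
qed

locale leray_parameters =
  fixes \<gamma> r :: real
  assumes \<gamma>: "\<gamma> > 1" and r_gt: "-1 < r" and r_lt: "r < 2 * \<gamma> - 1"
begin

abbreviation "\<rho> \<equiv> radial_measure r"
abbreviation "\<nu> \<equiv> profile_measure r"

text \<open>
  The weight \<open>\<alpha>\<^bsup>-\<eta>\<^esup>\<close> with this exponent makes the measure \<open>\<alpha>\<^sup>r d\<alpha>\<close> invariant under dilations up to
  the square of the weight, that is, \<open>\<alpha>\<^bsup>-2\<eta>\<^esup> \<alpha>\<^sup>r d\<alpha> = d\<alpha> / \<alpha>\<close>.
\<close>

definition "\<eta> = (r + 1) / 2"

lemma \<eta>: "0 < \<eta>" "\<eta> < \<gamma>" using r_gt r_lt by (auto simp: \<eta>_def)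

definition weight :: "real \<times> real \<Rightarrow> real" where
  "weight z = fst z powr (- \<eta>)"

definition normalization :: "nat \<Rightarrow> real" where
  "normalization k = \<gamma> ^ (k + 2) * (real k + 1) / (2 * pi)"

definition expo :: "nat \<Rightarrow> real" where
  "expo k = (\<gamma> - 1) * (real k + 1) - r"

text \<open>
  Points of the profile space are pairs \<open>(\<alpha>, s)\<close>. The factor \<open>\<alpha>\<^bsup>-r\<^esup>\<close> in the second variable turns the integral with
  respect to \<open>ds d\<alpha>\<close> into one with respect to \<open>\<alpha>\<^sup>r ds d\<alpha>\<close>.
\<close>

definition mode_kernel :: "nat \<Rightarrow> real \<times> real \<Rightarrow> real \<times> real \<Rightarrow> complex" where
  "mode_kernel k z w = of_real (normalization k * fst z ^ k * fst w powr expo k)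
     / Complex (fst z powr \<gamma> + (\<gamma> - 1) * fst w powr \<gamma>) (snd w - snd z) ^ (k + 2)"

lemma normalization_pos: "normalization k > 0"
  using \<gamma> by (simp add: normalization_def)

lemma mode_kernel_borel: "(\<lambda>p. mode_kernel k (fst p) (snd p)) \<in> borel_measurable borel"
proof -
  have [measurable]: "(\<lambda>p::(real \<times> real) \<times> (real \<times> real). fst (fst p)) \<in> borel_measurable borel"
    "(\<lambda>p::(real \<times> real) \<times> (real \<times> real). snd (fst p)) \<in> borel_measurable borel"
    "(\<lambda>p::(real \<times> real) \<times> (real \<times> real). fst (snd p)) \<in> borel_measurable borel"
    "(\<lambda>p::(real \<times> real) \<times> (real \<times> real). snd (snd p)) \<in> borel_measurable borel"
    by (auto intro!: borel_measurable_continuous_onI continuous_intros)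
  show ?thesis unfolding mode_kernel_def Complex_eq by measurable
qed

lemma mode_kernel_measurable: "case_prod (mode_kernel k) \<in> borel_measurable (\<nu> \<Otimes>\<^sub>M \<nu>)"
  using measurable_compose[OF profile_pair_id_measurable mode_kernel_borel] by (simp add: split_def)

lemma weight_measurable: "weight \<in> borel_measurable \<nu>"
proof -
  have [measurable]: "(fst :: real \<times> real \<Rightarrow> real) \<in> borel_measurable borel"
    by (intro borel_measurable_continuous_onI continuous_intros)
  show ?thesis unfolding weight_def by (intro profile_measurableI) measurable
qed

lemma sigma_finite_profile: "sigma_finite_measure \<nu>"
proof -
  interpret pair_sigma_finite \<rho> lborel
    using sigma_finite_radial_measure lborel.sigma_finite_measure_axioms by (simp add: pair_sigma_finite_def)
  show ?thesis unfolding profile_measure_def by unfold_locales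
qed

sublocale schur_weight \<nu> weight
proof -
  interpret sigma_finite_measure \<nu> by (rule sigma_finite_profile)
  show "schur_weight \<nu> weight"
    by unfold_locales (auto simp: weight_measurable weight_def space_profile_measure)
qed

lemma nn_integral_profile:
  assumes "f \<in> borel_measurable \<nu>"
  shows "(\<integral>\<^sup>+z. f z \<partial>\<nu>) = (\<integral>\<^sup>+\<alpha>. \<integral>\<^sup>+s. f (\<alpha>, s) \<partial>lborel \<partial>\<rho>)"
  using assms unfolding profile_measure_def by (subst lborel.nn_integral_fst) auto

lemma norm_mode_kernel:
  assumes "\<alpha> > 0" "\<beta> > 0"
  shows "norm (mode_kernel k (\<alpha>, s) (\<beta>, t)) = normalization k * \<alpha> ^ k * \<beta> powr expo k
    * (1 / cmod (Complex (\<alpha> powr \<gamma> + (\<gamma> - 1) * \<beta> powr \<gamma>) (t - s)) ^ (k + 2))"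
  using assms normalization_pos[of k] unfolding mode_kernel_def
  by (simp add: norm_divide norm_mult norm_power del: of_real_mult)

text \<open>
  After the integration over \<open>s\<close>, the kernel with respect to \<open>d\<alpha>\<close> is homogeneous of degree \<open>-1\<close> in the radial variables. The two
  radial integrals converge because \<open>0 < \<eta> < \<gamma>\<close>, that is, because \<open>-1 < r < 2 \<gamma> - 1\<close>.
\<close>

lemma mode_kernel_schur: "\<exists>B. schur_kernel (mode_kernel k) B"
proof -
  define n where "n = normalization k"
  have n: "n > 0" using normalization_pos by (simp add: n_def)
  define N where "N = real (k + 1)"
  have k\<gamma>: "real k \<le> \<gamma> * real k" using \<gamma> mult_right_mono[of 1 \<gamma> "real k"] by simp
  have b1: "(expo k - \<eta>) + r + 1 > 0" "((expo k - \<eta>) + r + 1) / \<gamma> < N"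
    using \<eta> \<gamma> k\<gamma> unfolding expo_def N_def by (auto simp: field_simps)
  have b2: "(real k - \<eta>) + r + 1 > 0" "((real k - \<eta>) + r + 1) / \<gamma> < N"
    using \<eta> \<gamma> k\<gamma> unfolding \<eta>_def N_def by (auto simp: field_simps)
  obtain c1 where c1: "c1 \<ge> 0" "\<And>X. X > 0 \<Longrightarrow>
    (\<integral>\<^sup>+x. ennreal (x powr (expo k - \<eta>) * (X + (\<gamma> - 1) * x powr \<gamma>) powr (- N)) \<partial>\<rho>)
      = ennreal (c1 * X powr (((expo k - \<eta>) + r + 1) / \<gamma> - N))"
    using radial_inverse_power[OF b1(1) _ _ b1(2), of "\<gamma> - 1"] \<gamma> by auto
  obtain c2 where c2: "c2 \<ge> 0" "\<And>X. X > 0 \<Longrightarrow>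
    (\<integral>\<^sup>+x. ennreal (x powr (real k - \<eta>) * (X + 1 * x powr \<gamma>) powr (- N)) \<partial>\<rho>)
      = ennreal (c2 * X powr (((real k - \<eta>) + r + 1) / \<gamma> - N))"
    using radial_inverse_power[OF b2(1) _ _ b2(2), of 1] \<gamma> by auto
  define c2' where "c2' = c2 * (\<gamma> - 1) powr (((real k - \<eta>) + r + 1) / \<gamma> - N)"
  have c2': "c2' \<ge> 0" using c2 by (simp add: c2'_def)
  define B where "B = n * pi * (c1 + c2')"
  have meas_row: "(\<lambda>w. ennreal (norm (mode_kernel k z w)) * ennreal (weight w)) \<in> borel_measurable \<nu>"
    and meas_col: "(\<lambda>w. ennreal (norm (mode_kernel k w z)) * ennreal (weight w)) \<in> borel_measurable \<nu>"
    if "z \<in> space \<nu>" for z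
  proof -
    note [measurable] = mode_kernel_measurable[of k] weight_measurable that
    have [measurable]: "(\<lambda>w. mode_kernel k z w) \<in> borel_measurable \<nu>" "(\<lambda>w. mode_kernel k w z) \<in> borel_measurable \<nu>"
      using mode_kernel_measurable[of k] that by measurable
    show "(\<lambda>w. ennreal (norm (mode_kernel k z w)) * ennreal (weight w)) \<in> borel_measurable \<nu>"
      "(\<lambda>w. ennreal (norm (mode_kernel k w z)) * ennreal (weight w)) \<in> borel_measurable \<nu>" by measurable
  qed
  have row: "(\<integral>\<^sup>+w. ennreal (norm (mode_kernel k z w)) * ennreal (weight w) \<partial>\<nu>) \<le> ennreal B * ennreal (weight z)"
    if z: "z \<in> space \<nu>" for z
  proof -
    obtain \<alpha> s where zs: "z = (\<alpha>, s)" "\<alpha> > 0" using z by (auto simp: space_profile_measure)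
    have "(\<integral>\<^sup>+w. ennreal (norm (mode_kernel k z w)) * ennreal (weight w) \<partial>\<nu>)
        = (\<integral>\<^sup>+\<beta>. \<integral>\<^sup>+t. ennreal (norm (mode_kernel k (\<alpha>, s) (\<beta>, t))) * ennreal (weight (\<beta>, t)) \<partial>lborel \<partial>\<rho>)"
      using meas_row[OF z] unfolding zs(1) by (rule nn_integral_profile)
    also have "\<dots> \<le> (\<integral>\<^sup>+\<beta>. ennreal (n * pi * \<alpha> ^ k) * ennreal (\<beta> powr (expo k - \<eta>) * (\<alpha> powr \<gamma> + (\<gamma> - 1) * \<beta> powr \<gamma>) powr (- N)) \<partial>\<rho>)"
    proof (rule nn_integral_mono)
      fix \<beta> assume "\<beta> \<in> space \<rho>"
      then have \<beta>: "\<beta> > 0" by simp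
      define a where "a = \<alpha> powr \<gamma> + (\<gamma> - 1) * \<beta> powr \<gamma>"
      have a: "a > 0" unfolding a_def using zs \<beta> \<gamma> by (intro add_pos_pos mult_pos_pos) auto
      have "(\<integral>\<^sup>+t. ennreal (norm (mode_kernel k (\<alpha>, s) (\<beta>, t))) * ennreal (weight (\<beta>, t)) \<partial>lborel)
          = (\<integral>\<^sup>+t. ennreal (n * \<alpha> ^ k * \<beta> powr (expo k - \<eta>)) * ennreal (1 / cmod (Complex a (t - s)) ^ (k + 2)) \<partial>lborel)"
        using zs \<beta> n
        by (intro nn_integral_cong)
          (simp add: norm_mode_kernel weight_def a_def n_def ennreal_mult [symmetric] powr_diff powr_minus_divide)
      also have "\<dots> = ennreal (n * \<alpha> ^ k * \<beta> powr (expo k - \<eta>)) * (\<integral>\<^sup>+t. ennreal (1 / cmod (Complex a (t - s)) ^ (k + 2)) \<partial>lborel)"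
        by (rule nn_integral_cmult) (simp add: Complex_eq)
      also have "\<dots> \<le> ennreal (n * \<alpha> ^ k * \<beta> powr (expo k - \<eta>)) * ennreal (pi * a powr (- real (k + 1)))"
        by (intro mult_left_mono nn_integral_line_power_le a) auto
      also have "\<dots> = ennreal (n * pi * \<alpha> ^ k) * ennreal (\<beta> powr (expo k - \<eta>) * a powr (- N))"
        using zs n by (simp add: ennreal_mult [symmetric] N_def mult_ac)
      finally show "(\<integral>\<^sup>+t. ennreal (norm (mode_kernel k (\<alpha>, s) (\<beta>, t))) * ennreal (weight (\<beta>, t)) \<partial>lborel)
        \<le> ennreal (n * pi * \<alpha> ^ k) * ennreal (\<beta> powr (expo k - \<eta>) * (\<alpha> powr \<gamma> + (\<gamma> - 1) * \<beta> powr \<gamma>) powr (- N))"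
        unfolding a_def .
    qed
    also have "\<dots> = ennreal (n * pi * \<alpha> ^ k) * (\<integral>\<^sup>+\<beta>. ennreal (\<beta> powr (expo k - \<eta>) * (\<alpha> powr \<gamma> + (\<gamma> - 1) * \<beta> powr \<gamma>) powr (- N)) \<partial>\<rho>)"
      by (rule nn_integral_cmult) (intro radial_measurableI, measurable)
    also have "\<dots> = ennreal (n * pi * \<alpha> ^ k) * ennreal (c1 * (\<alpha> powr \<gamma>) powr (((expo k - \<eta>) + r + 1) / \<gamma> - N))"
      using zs by (subst c1(2)) auto
    also have "\<dots> = ennreal (n * pi * c1 * weight z)"
    proof -
      have "\<gamma> * (((expo k - \<eta>) + r + 1) / \<gamma> - N) = - real k - \<eta>"
        using \<gamma> by (simp add: field_simps expo_def N_def)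
      then have "(\<alpha> powr \<gamma>) powr (((expo k - \<eta>) + r + 1) / \<gamma> - N) = \<alpha> powr (- real k - \<eta>)"
        by (simp only: powr_powr)
      moreover have "\<alpha> ^ k * \<alpha> powr (- real k - \<eta>) = weight z"
        using zs by (simp add: weight_def powr_diff powr_minus_divide powr_realpow)
      ultimately have "\<alpha> ^ k * (\<alpha> powr \<gamma>) powr (((expo k - \<eta>) + r + 1) / \<gamma> - N) = weight z" by simp
      then show ?thesis
        using zs n c1(1) by (simp add: ennreal_mult [symmetric] mult_ac)
    qed
    also have "\<dots> \<le> ennreal (B * weight z)"
      unfolding B_def using n c1(1) c2' zs
      by (intro ennreal_leI mult_right_mono) (auto simp: weight_def)
    finally show ?thesis using n c1(1) c2' zs by (simp add: ennreal_mult B_def weight_def)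
  qed
  have col: "(\<integral>\<^sup>+z. ennreal (norm (mode_kernel k z w)) * ennreal (weight z) \<partial>\<nu>) \<le> ennreal B * ennreal (weight w)"
    if w: "w \<in> space \<nu>" for w
  proof -
    obtain \<beta> t where wt: "w = (\<beta>, t)" "\<beta> > 0" using w by (auto simp: space_profile_measure)
    have "(\<integral>\<^sup>+z. ennreal (norm (mode_kernel k z w)) * ennreal (weight z) \<partial>\<nu>)
        = (\<integral>\<^sup>+\<alpha>. \<integral>\<^sup>+s. ennreal (norm (mode_kernel k (\<alpha>, s) (\<beta>, t))) * ennreal (weight (\<alpha>, s)) \<partial>lborel \<partial>\<rho>)"
      using meas_col[OF w] unfolding wt(1) by (rule nn_integral_profile)
    also have "\<dots> \<le> (\<integral>\<^sup>+\<alpha>. ennreal (n * pi * \<beta> powr expo k) * ennreal (\<alpha> powr (real k - \<eta>) * ((\<gamma> - 1) * \<beta> powr \<gamma> + 1 * \<alpha> powr \<gamma>) powr (- N)) \<partial>\<rho>)"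
    proof (rule nn_integral_mono)
      fix \<alpha> assume "\<alpha> \<in> space \<rho>"
      then have \<alpha>: "\<alpha> > 0" by simp
      define a where "a = \<alpha> powr \<gamma> + (\<gamma> - 1) * \<beta> powr \<gamma>"
      have a: "a > 0" unfolding a_def using wt \<alpha> \<gamma> by (intro add_pos_pos mult_pos_pos) auto
      have flip: "cmod (Complex a (t - s)) = cmod (Complex a (s - t))" for s
        by (simp add: cmod_def power2_commute)
      have "(\<integral>\<^sup>+s. ennreal (norm (mode_kernel k (\<alpha>, s) (\<beta>, t))) * ennreal (weight (\<alpha>, s)) \<partial>lborel)
          = (\<integral>\<^sup>+s. ennreal (n * \<beta> powr expo k * \<alpha> powr (real k - \<eta>)) * ennreal (1 / cmod (Complex a (s - t)) ^ (k + 2)) \<partial>lborel)"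
        using wt \<alpha> n unfolding flip[symmetric]
        by (intro nn_integral_cong)
          (simp add: norm_mode_kernel weight_def a_def n_def ennreal_mult [symmetric] powr_diff powr_minus_divide powr_realpow mult_ac)
      also have "\<dots> = ennreal (n * \<beta> powr expo k * \<alpha> powr (real k - \<eta>)) * (\<integral>\<^sup>+s. ennreal (1 / cmod (Complex a (s - t)) ^ (k + 2)) \<partial>lborel)"
        by (rule nn_integral_cmult) (simp add: Complex_eq)
      also have "\<dots> \<le> ennreal (n * \<beta> powr expo k * \<alpha> powr (real k - \<eta>)) * ennreal (pi * a powr (- real (k + 1)))"
        by (intro mult_left_mono nn_integral_line_power_le a) auto
      also have "\<dots> = ennreal (n * pi * \<beta> powr expo k) * ennreal (\<alpha> powr (real k - \<eta>) * a powr (- N))"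
        using n by (simp add: ennreal_mult [symmetric] N_def mult_ac)
      finally show "(\<integral>\<^sup>+s. ennreal (norm (mode_kernel k (\<alpha>, s) (\<beta>, t))) * ennreal (weight (\<alpha>, s)) \<partial>lborel)
        \<le> ennreal (n * pi * \<beta> powr expo k) * ennreal (\<alpha> powr (real k - \<eta>) * ((\<gamma> - 1) * \<beta> powr \<gamma> + 1 * \<alpha> powr \<gamma>) powr (- N))"
        unfolding a_def by (simp add: add.commute)
    qed
    also have "\<dots> = ennreal (n * pi * \<beta> powr expo k) * (\<integral>\<^sup>+\<alpha>. ennreal (\<alpha> powr (real k - \<eta>) * ((\<gamma> - 1) * \<beta> powr \<gamma> + 1 * \<alpha> powr \<gamma>) powr (- N)) \<partial>\<rho>)"
      by (rule nn_integral_cmult) (intro radial_measurableI, measurable)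
    also have "\<dots> = ennreal (n * pi * \<beta> powr expo k) * ennreal (c2 * ((\<gamma> - 1) * \<beta> powr \<gamma>) powr (((real k - \<eta>) + r + 1) / \<gamma> - N))"
      using wt \<gamma> by (subst c2(2)) auto
    also have "\<dots> = ennreal (n * pi * c2' * weight w)"
    proof -
      have e: "\<gamma> * (((real k - \<eta>) + r + 1) / \<gamma> - N) = - expo k - \<eta>"
        using \<gamma> by (simp add: field_simps expo_def N_def \<eta>_def)
      have "((\<gamma> - 1) * \<beta> powr \<gamma>) powr (((real k - \<eta>) + r + 1) / \<gamma> - N)
          = (\<gamma> - 1) powr (((real k - \<eta>) + r + 1) / \<gamma> - N) * \<beta> powr (- expo k - \<eta>)"
        using \<gamma> by (simp add: powr_mult powr_powr e)
      moreover have "\<beta> powr expo k * \<beta> powr (- expo k - \<eta>) = weight w"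
        using wt by (simp add: weight_def powr_add [symmetric])
      ultimately have "\<beta> powr expo k * (c2 * ((\<gamma> - 1) * \<beta> powr \<gamma>) powr (((real k - \<eta>) + r + 1) / \<gamma> - N)) = c2' * weight w"
        by (simp add: c2'_def mult_ac)
      then show ?thesis
        using wt n c2(1) by (simp add: ennreal_mult [symmetric] mult.assoc)
    qed
    also have "\<dots> \<le> ennreal (B * weight w)"
      unfolding B_def using n c1(1) c2' wt
      by (intro ennreal_leI mult_right_mono) (auto simp: weight_def)
    finally show ?thesis using n c1(1) c2' wt by (simp add: ennreal_mult B_def weight_def)
  qed
  have "B \<ge> 0" unfolding B_def using n c1(1) c2' by simp
  then show ?thesis using row col mode_kernel_measurable unfolding schur_kernel_def by auto
qed


sublocale profile: pair_sigma_finite \<rho> lborel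
  using sigma_finite_radial_measure lborel.sigma_finite_measure_axioms by (simp add: pair_sigma_finite_def)

lemma mode_kernel_eq:
  "mode_kernel k (\<alpha>, s) (\<beta>, t) = of_real (normalization k * \<alpha> ^ k * \<beta> powr expo k)
    * (1 / Complex (\<alpha> powr \<gamma> + (\<gamma> - 1) * \<beta> powr \<gamma>) (t - s) ^ Suc (k + 1))"
  by (simp add: mode_kernel_def)

lemma adjoint_mode_kernel_eq:
  "kernel_adjoint (mode_kernel k) (\<alpha>, s) (\<beta>, t) = of_real (normalization k * \<beta> ^ k * \<alpha> powr expo k)
    * (1 / Complex (\<beta> powr \<gamma> + (\<gamma> - 1) * \<alpha> powr \<gamma>) (t - s) ^ Suc (k + 1))"
proof -
  have "cnj (Complex a (s - t)) = Complex a (t - s)" for a by (simp add: complex_eq_iff)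
  then show ?thesis unfolding kernel_adjoint_def mode_kernel_eq by simp
qed

text \<open>
  The \<open>s\<close>-integral produces \<open>1 / (X + \<gamma> \<beta>\<^sup>\<gamma>)\<^bsup>2 k + 3\<^esup>\<close>, where the denominator of the kernel on the right is \<open>X\<^bsup>k + 2\<^esup>\<close>. The remaining
  radial integral is a multiple of \<open>1 / X\<^bsup>k + 2\<^esup>\<close>, and \<open>normalization k\<close> is the constant that makes the factor \<open>1\<close>.
\<close>

lemma mode_kernel_idempotent:
  assumes "z \<in> space \<nu>" "w \<in> space \<nu>"
    and int: "integrable \<nu> (\<lambda>u. mode_kernel k z u * mode_kernel k u w)"
  shows "(\<integral>u. mode_kernel k z u * mode_kernel k u w \<partial>\<nu>) = mode_kernel k z w"
proof -
  obtain \<alpha> s \<delta> t where zw: "z = (\<alpha>, s)" "w = (\<delta>, t)" "\<alpha> > 0" "\<delta> > 0"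
    using assms(1,2) by (auto simp: space_profile_measure)
  define n where "n = normalization k"
  define e where "e = expo k"
  define X where "X = Complex (\<alpha> powr \<gamma> + (\<gamma> - 1) * \<delta> powr \<gamma>) (t - s)"
  define c where "c = of_real (n * n * \<alpha> ^ k * \<delta> powr e) * (2 * of_real pi * of_nat ((2 * k + 2) choose (k + 1)) :: complex)"
  define W where "W \<beta> = \<gamma> * \<beta> powr \<gamma>" for \<beta>
  define \<omega> where "\<omega> = density \<rho> (\<lambda>\<beta>. ennreal (\<beta> powr e * \<beta> ^ k))"
  define D where "D = fact k / \<gamma> * \<gamma> powr (- (real k + 1))"
  have D: "D \<ge> 0" using \<gamma> by (simp add: D_def)
  have m [measurable]: "(\<lambda>x. x powr a) \<in> borel_measurable \<rho>" "(\<lambda>x. x ^ k) \<in> borel_measurable \<rho>" for a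
    by (intro radial_measurableI; measurable)+
  have \<omega>: "sigma_finite_measure \<omega>"
    unfolding \<omega>_def
    by (subst sigma_finite_measure.sigma_finite_iff_density_finite[OF sigma_finite_radial_measure]) auto
  have W: "W \<in> borel_measurable \<omega>" unfolding \<omega>_def W_def by simp
  have X: "Re X > 0" unfolding X_def using zw \<gamma> by (simp add: add_pos_pos)
  have Laplace: "(\<integral>\<^sup>+y. ennreal (exp (- (\<xi> * W y))) \<partial>\<omega>)
      = ennreal (D * \<xi> powr (- (real (Suc (2 * k + 2)) - real (Suc (k + 1)))))" if \<xi>: "\<xi> > 0" for \<xi>
  proof -
    have "(\<integral>\<^sup>+y. ennreal (exp (- (\<xi> * W y))) \<partial>\<omega>)
        = (\<integral>\<^sup>+y. ennreal (y powr e * y ^ k) * ennreal (exp (- (\<xi> * W y))) \<partial>\<rho>)"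
      unfolding \<omega>_def by (subst nn_integral_density) (auto simp: W_def)
    also have "\<dots> = (\<integral>\<^sup>+y. ennreal (y powr (e + real k) * exp (- ((\<xi> * \<gamma>) * y powr \<gamma>))) \<partial>\<rho>)"
      by (intro nn_integral_cong) (simp add: ennreal_mult [symmetric] powr_add powr_realpow W_def mult_ac)
    also have "\<dots> = ennreal (Gamma ((e + real k + r + 1) / \<gamma>) / \<gamma> * (\<xi> * \<gamma>) powr (- ((e + real k + r + 1) / \<gamma>)))"
      using \<gamma> \<xi> by (intro radial_Laplace) (auto simp: e_def expo_def algebra_simps intro!: add_pos_nonneg)
    also have "(e + real k + r + 1) / \<gamma> = real k + 1"
      using \<gamma> by (simp add: e_def expo_def field_simps)
    also have "Gamma (real k + 1) = fact k" using Gamma_fact[of k, where 'a = real] by (simp add: add.commute)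
    moreover have ex: "real (Suc (2 * k + 2)) - real (Suc (k + 1)) = real k + 1" by simp
    ultimately show ?thesis using \<xi> \<gamma> unfolding ex by (simp add: D_def powr_mult mult_ac)
  qed
  have two_k: "k + 1 + (k + 1) = 2 * k + 2" by simp
  have inner: "(\<integral>y. mode_kernel k z (\<beta>, y) * mode_kernel k (\<beta>, y) w \<partial>lborel)
      = of_real (\<beta> powr e * \<beta> ^ k) * (c * (1 / (X + of_real (W \<beta>)) ^ Suc (2 * k + 2)))"
    if \<beta>: "\<beta> > 0" for \<beta>
  proof -
    define a where "a = \<alpha> powr \<gamma> + (\<gamma> - 1) * \<beta> powr \<gamma>"
    define b where "b = \<beta> powr \<gamma> + (\<gamma> - 1) * \<delta> powr \<gamma>"
    have ab: "a > 0" "b > 0" unfolding a_def b_def using zw \<beta> \<gamma> by (auto intro!: add_pos_pos mult_pos_pos)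
    have "mode_kernel k z (\<beta>, y) * mode_kernel k (\<beta>, y) w
        = of_real (n * \<alpha> ^ k * \<beta> powr e * (n * \<beta> ^ k * \<delta> powr e))
          * (1 / (Complex a (y - s) ^ Suc (k + 1) * Complex b (t - y) ^ Suc (k + 1)))" for y
      unfolding zw mode_kernel_eq a_def b_def n_def e_def by simp
    then have "(\<integral>y. mode_kernel k z (\<beta>, y) * mode_kernel k (\<beta>, y) w \<partial>lborel)
        = of_real (n * \<alpha> ^ k * \<beta> powr e * (n * \<beta> ^ k * \<delta> powr e))
          * (2 * of_real pi * of_nat ((2 * k + 2) choose (k + 1)) / Complex (a + b) (t - s) ^ Suc (2 * k + 2))"
      by (simp only: integral_mult_right_zero integral_power_product[OF ab] two_k)
    moreover have "Complex (a + b) (t - s) = X + of_real (W \<beta>)"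
      by (simp add: X_def W_def a_def b_def complex_eq_iff algebra_simps)
    ultimately show ?thesis by (simp add: c_def mult_ac del: power_Suc binomial_Suc_Suc)
  qed
  have "(\<integral>u. mode_kernel k z u * mode_kernel k u w \<partial>\<nu>)
      = (\<integral>\<beta>. \<integral>y. mode_kernel k z (\<beta>, y) * mode_kernel k (\<beta>, y) w \<partial>lborel \<partial>\<rho>)"
    using int unfolding profile_measure_def by (rule profile.integral_fst'[symmetric])
  also have "\<dots> = (\<integral>\<beta>. (\<beta> powr e * \<beta> ^ k) *\<^sub>R (c * (1 / (X + of_real (W \<beta>)) ^ Suc (2 * k + 2))) \<partial>\<rho>)"
    by (intro Bochner_Integration.integral_cong refl) (simp add: inner scaleR_conv_of_real del: power_Suc of_real_mult)
  also have "\<dots> = (\<integral>\<beta>. c * (1 / (X + of_real (W \<beta>)) ^ Suc (2 * k + 2)) \<partial>\<omega>)"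
    unfolding \<omega>_def using W unfolding \<omega>_def by (intro integral_density[symmetric]) auto
  also have "\<dots> = c * (of_real (D * fact (k + 1) / fact (2 * k + 2)) / X ^ Suc (k + 1))"
    unfolding integral_mult_right_zero
    by (subst integral_complex_inverse_power[OF \<omega> W _ Laplace D X]) (use \<gamma> in \<open>auto simp: W_def\<close>)
  also have "\<dots> = mode_kernel k z w"
  proof -
    have "n * (2 * pi * real ((2 * k + 2) choose (k + 1)) * (D * fact (k + 1) / fact (2 * k + 2))) = 1"
    proof -
      have binom: "real ((2 * k + 2) choose (k + 1)) = fact (2 * k + 2) / (fact (k + 1) * fact (k + 1))"
        by (subst binomial_fact) auto
      have "\<gamma> powr (- (real k + 1)) = 1 / \<gamma> ^ (k + 1)"
        using powr_uminus_of_nat[of \<gamma> "k + 1"] \<gamma> by (simp only: of_nat_add of_nat_1)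
      then have D': "D = fact k / \<gamma> ^ (k + 2)" by (simp add: D_def)
      define m M :: real where "m = fact (k + 1)" and "M = fact (2 * k + 2)"
      have "m > 0" "M > 0" by (simp_all add: m_def M_def del: fact_Suc)
      then have "n * (2 * pi * (M / (m * m)) * (D * m / M)) = n * (2 * pi * D) / m" by simp
      also have "\<dots> = 1"
      proof -
        have "m = (real k + 1) * fact k" by (simp add: m_def)
        then show ?thesis
          unfolding D' n_def normalization_def using \<gamma> by (simp add: add_eq_0_iff)
      qed
      finally show ?thesis unfolding binom m_def M_def .
    qed
    moreover define Y where "Y = D * fact (k + 1) / fact (2 * k + 2)"
    moreover define b where "b = ((2 * k + 2) choose (k + 1))"
    ultimately have 1: "n * (2 * pi * real b * Y) = 1" by (simp only:)
    have "c * of_real Y = of_real ((n * (2 * pi * real b * Y)) * (n * \<alpha> ^ k * \<delta> powr e))"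
      unfolding c_def b_def[symmetric] by (simp add: mult_ac)
    then have "c * of_real (D * fact (k + 1) / fact (2 * k + 2)) = of_real (n * \<alpha> ^ k * \<delta> powr e)"
      unfolding 1 by (simp only: Y_def mult_1)
    then show ?thesis
      unfolding zw mode_kernel_eq n_def[symmetric] e_def[symmetric] X_def[symmetric]
      by (simp only: times_divide_eq_right mult_1_right)
  qed
  finally show ?thesis .
qed

text \<open>
  All three \<open>s\<close>-dependent factors combine by two applications of the line integral, which leaves
  the radial integral of \<open>1 / (X + 2 (\<gamma> - 1) \<beta>\<^sup>\<gamma> + 2 \<delta>\<^sup>\<gamma>)\<^bsup>3 k + 4\<^esup>\<close>. The two Gamma factors of the constant are the two
  radial integrals of its Laplace representation.
\<close>

lemma mode_kernel_triple:
  assumes "z \<in> space \<nu>" "w \<in> space \<nu>"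
    and int: "integrable (\<nu> \<Otimes>\<^sub>M \<nu>) (\<lambda>(u, v). mode_kernel k z u * (kernel_adjoint (mode_kernel k) u v * mode_kernel k v w))"
  shows "(\<integral>(u, v). mode_kernel k z u * (kernel_adjoint (mode_kernel k) u v * mode_kernel k v w) \<partial>(\<nu> \<Otimes>\<^sub>M \<nu>))
    = of_real (leray_C r \<gamma> k) * mode_kernel k z w"
proof -
  obtain \<alpha> s \<epsilon> t where zw: "z = (\<alpha>, s)" "w = (\<epsilon>, t)" "\<alpha> > 0" "\<epsilon> > 0"
    using assms(1,2) by (auto simp: space_profile_measure)
  define F where "F u v = mode_kernel k z u * (kernel_adjoint (mode_kernel k) u v * mode_kernel k v w)" for u v
  define n where "n = normalization k"
  define e where "e = expo k"
  define X where "X = Complex (\<alpha> powr \<gamma> + (\<gamma> - 1) * \<epsilon> powr \<gamma>) (t - s)"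
  define c where "c = of_real (n * n * n * \<alpha> ^ k * \<epsilon> powr e)
    * (2 * of_real pi * of_nat ((2 * k + 2) choose (k + 1)) * (2 * of_real pi * of_nat ((3 * k + 3) choose (k + 1))) :: complex)"
  define W where "W y = 2 * (\<gamma> - 1) * fst y powr \<gamma> + 2 * snd y powr \<gamma>" for y :: "real \<times> real"
  define g where "g y = fst y powr (2 * e) * snd y powr (2 * real k)" for y :: "real \<times> real"
  define \<omega> where "\<omega> = density (\<rho> \<Otimes>\<^sub>M \<rho>) (\<lambda>y. ennreal (g y))"
  define p q where "p = 2 * real k + 2 - (2 * real k + 1 + r) / \<gamma>" and "q = (2 * real k + 1 + r) / \<gamma>"
  define D where "D = Gamma p / \<gamma> * (Gamma q / \<gamma>) * ((\<gamma> - 1) powr (- p) * (1 / 2 ^ (2 * k + 2)))"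
  interpret rr: pair_sigma_finite \<rho> \<rho>
    using sigma_finite_radial_measure by (simp add: pair_sigma_finite_def)
  interpret rl: pair_sigma_finite "\<rho> \<Otimes>\<^sub>M \<rho>" "lborel \<Otimes>\<^sub>M lborel :: (real \<times> real) measure" ..
  have pq: "(2 * e + r + 1) / \<gamma> = p" "(2 * real k + r + 1) / \<gamma> = q" "p + q = 2 * real k + 2"
    using \<gamma> by (simp_all add: p_def q_def e_def expo_def field_simps)
  have q0: "q > 0" unfolding q_def using \<gamma> r_gt by (intro divide_pos_pos) auto
  have "2 * e + r + 1 > 0"
  proof -
    have "(\<gamma> - 1) * 1 \<le> (\<gamma> - 1) * (real k + 1)" using \<gamma> by (intro mult_left_mono) auto
    then show ?thesis using r_lt by (simp add: e_def expo_def)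
  qed
  then have p0: "p > 0" unfolding pq(1)[symmetric] using \<gamma> by simp
  have D: "D \<ge> 0" unfolding D_def using p0 q0 \<gamma> by (simp add: less_imp_le)
  have [measurable]: "(\<lambda>x. x powr a) \<in> borel_measurable \<rho>" for a
    by (intro radial_measurableI; measurable)
  have W [measurable]: "W \<in> borel_measurable (\<rho> \<Otimes>\<^sub>M \<rho>)" unfolding W_def by measurable
  have g [measurable]: "g \<in> borel_measurable (\<rho> \<Otimes>\<^sub>M \<rho>)" unfolding g_def by measurable
  have \<omega>: "sigma_finite_measure \<omega>"
    unfolding \<omega>_def by (subst rr.sigma_finite_iff_density_finite) auto
  have W\<omega>: "W \<in> borel_measurable \<omega>" by (simp add: \<omega>_def)
  have X: "Re X > 0" unfolding X_def using zw \<gamma> by (simp add: add_pos_pos)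
  have Laplace: "(\<integral>\<^sup>+y. ennreal (exp (- (\<xi> * W y))) \<partial>\<omega>)
      = ennreal (D * \<xi> powr (- (real (Suc (3 * k + 3)) - real (Suc (k + 1)))))" if \<xi>: "\<xi> > 0" for \<xi>
  proof -
    define G1 where "G1 x = ennreal (x powr (2 * e) * exp (- ((\<xi> * (2 * (\<gamma> - 1))) * x powr \<gamma>)))" for x
    define G2 where "G2 x = ennreal (x powr (2 * real k) * exp (- ((\<xi> * 2) * x powr \<gamma>)))" for x
    have [measurable]: "G1 \<in> borel_measurable \<rho>" "G2 \<in> borel_measurable \<rho>" unfolding G1_def G2_def by measurable
    have "(\<integral>\<^sup>+y. ennreal (exp (- (\<xi> * W y))) \<partial>\<omega>)
        = (\<integral>\<^sup>+y. ennreal (g y) * ennreal (exp (- (\<xi> * W y))) \<partial>(\<rho> \<Otimes>\<^sub>M \<rho>))"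
      unfolding \<omega>_def by (subst nn_integral_density) auto
    also have "\<dots> = (\<integral>\<^sup>+y. G1 (fst y) * G2 (snd y) \<partial>(\<rho> \<Otimes>\<^sub>M \<rho>))"
      by (intro nn_integral_cong)
        (simp add: g_def G1_def G2_def W_def ennreal_mult [symmetric] exp_add [symmetric] algebra_simps)
    also have "\<dots> = (\<integral>\<^sup>+x. \<integral>\<^sup>+y. G1 x * G2 y \<partial>\<rho> \<partial>\<rho>)"
      by (subst sigma_finite_measure.nn_integral_fst[OF sigma_finite_radial_measure, symmetric]) auto
    also have "\<dots> = (\<integral>\<^sup>+x. G1 x \<partial>\<rho>) * (\<integral>\<^sup>+y. G2 y \<partial>\<rho>)"
      by (simp add: nn_integral_cmult nn_integral_multc)
    also have "(\<integral>\<^sup>+x. G1 x \<partial>\<rho>) = ennreal (Gamma p / \<gamma> * (\<xi> * (2 * (\<gamma> - 1))) powr (- p))"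
      unfolding G1_def pq(1)[symmetric] using \<gamma> \<xi> \<open>2 * e + r + 1 > 0\<close> by (intro radial_Laplace) auto
    also have "(\<integral>\<^sup>+x. G2 x \<partial>\<rho>) = ennreal (Gamma q / \<gamma> * (\<xi> * 2) powr (- q))"
      unfolding G2_def pq(2)[symmetric] using \<gamma> \<xi> r_gt by (intro radial_Laplace) auto
    also have "ennreal (Gamma p / \<gamma> * (\<xi> * (2 * (\<gamma> - 1))) powr (- p)) * ennreal (Gamma q / \<gamma> * (\<xi> * 2) powr (- q))
        = ennreal (Gamma p / \<gamma> * (\<xi> * (2 * (\<gamma> - 1))) powr (- p) * (Gamma q / \<gamma> * (\<xi> * 2) powr (- q)))"
      using p0 q0 \<gamma> by (intro ennreal_mult[symmetric]) (auto simp: less_imp_le)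
    also have "(\<xi> * (2 * (\<gamma> - 1))) powr (- p) = \<xi> powr (- p) * (2 powr (- p) * (\<gamma> - 1) powr (- p))"
      by (simp only: powr_mult)
    also have "(\<xi> * 2) powr (- q) = \<xi> powr (- q) * 2 powr (- q)"
      using \<xi> by (simp add: powr_mult)
    also have "Gamma p / \<gamma> * (\<xi> powr (- p) * (2 powr (- p) * (\<gamma> - 1) powr (- p))) * (Gamma q / \<gamma> * (\<xi> powr (- q) * 2 powr (- q)))
        = Gamma p / \<gamma> * (Gamma q / \<gamma>) * ((\<gamma> - 1) powr (- p) * 2 powr (- (p + q))) * \<xi> powr (- (p + q))"
    proof -
      have "x powr (- (p + q)) = x powr (- p) * x powr (- q)" for x :: real
        by (simp add: powr_add [symmetric])
      then show ?thesis by (simp only: mult_ac)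
    qed
    also have "2 powr (- (p + q)) = (1 / 2 ^ (2 * k + 2) :: real)"
      using powr_uminus_of_nat[of 2 "2 * k + 2"] unfolding pq(3)
      by (simp only: of_nat_add of_nat_mult of_nat_numeral)
    moreover have ex: "real (Suc (3 * k + 3)) - real (Suc (k + 1)) = p + q" unfolding pq(3) by simp
    ultimately show ?thesis unfolding D_def ex by (simp add: mult_ac)
  qed
  define \<pi> where "\<pi> p = ((fst (fst p), fst (snd p)), (snd (fst p), snd (snd p)))" for p :: "(real \<times> real) \<times> (real \<times> real)"
  define N where "N = (\<rho> \<Otimes>\<^sub>M \<rho>) \<Otimes>\<^sub>M (lborel \<Otimes>\<^sub>M lborel :: (real \<times> real) measure)"
  have \<nu>\<nu>: "\<nu> \<Otimes>\<^sub>M \<nu> = distr N (\<nu> \<Otimes>\<^sub>M \<nu>) \<pi>"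
    unfolding N_def \<pi>_def profile_measure_def
    by (rule distr_pair_swap_middle[symmetric])
      (auto intro: sigma_finite_radial_measure lborel.sigma_finite_measure_axioms)
  have \<pi>: "\<pi> \<in> N \<rightarrow>\<^sub>M \<nu> \<Otimes>\<^sub>M \<nu>" unfolding N_def \<pi>_def profile_measure_def by measurable
  have F_meas: "case_prod F \<in> borel_measurable (\<nu> \<Otimes>\<^sub>M \<nu>)"
    using int unfolding F_def by (rule borel_measurable_integrable)
  define H where "H x y = F (fst x, fst y) (snd x, snd y)" for x y :: "real \<times> real"
  have H\<pi>: "case_prod F (\<pi> p) = case_prod H p" for p
    by (simp add: \<pi>_def H_def split_def)
  have intH: "integrable N (case_prod H)"
  proof -
    have "integrable (distr N (\<nu> \<Otimes>\<^sub>M \<nu>) \<pi>) (case_prod F)"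
      using int unfolding F_def \<nu>\<nu>[symmetric] .
    then have "integrable N (\<lambda>p. case_prod F (\<pi> p))" using \<pi> F_meas by (simp add: integrable_distr_eq)
    then show ?thesis by (simp add: H\<pi> cong: Bochner_Integration.integrable_cong)
  qed
  have H_eq: "H x y = of_real (g x) * (of_real (n * n * n * \<alpha> ^ k * \<epsilon> powr e)
      * (1 / Complex (\<alpha> powr \<gamma> + (\<gamma> - 1) * fst x powr \<gamma>) (fst y - s) ^ Suc (k + 1)
      * (1 / (Complex (snd x powr \<gamma> + (\<gamma> - 1) * fst x powr \<gamma>) (snd y - fst y) ^ Suc (k + 1)
        * Complex (snd x powr \<gamma> + (\<gamma> - 1) * \<epsilon> powr \<gamma>) (t - snd y) ^ Suc (k + 1)))))"
    if "fst x > 0" "snd x > 0" for x y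
  proof -
    have "fst x powr (2 * e) = fst x powr e * fst x powr e" by (simp add: powr_add [symmetric])
    moreover have "snd x powr (2 * real k) = snd x ^ k * snd x ^ k"
      using that by (simp add: powr_realpow [symmetric] powr_add [symmetric])
    ultimately show ?thesis
      unfolding H_def F_def zw mode_kernel_eq adjoint_mode_kernel_eq g_def
      by (simp add: n_def e_def del: power_Suc)
  qed
  have two_k: "k + 1 + (k + 1) = 2 * k + 2" and three_k: "k + 1 + (2 * k + 2) = 3 * k + 3" by simp_all
  have inner: "(\<integral>y. H x y \<partial>(lborel \<Otimes>\<^sub>M lborel)) = of_real (g x) * (c * (1 / (X + of_real (W x)) ^ Suc (3 * k + 3)))"
    if x: "fst x > 0" "snd x > 0" and int: "integrable (lborel \<Otimes>\<^sub>M lborel) (H x)" for x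
  proof -
    define a1 where "a1 = \<alpha> powr \<gamma> + (\<gamma> - 1) * fst x powr \<gamma>"
    define a2 where "a2 = snd x powr \<gamma> + (\<gamma> - 1) * fst x powr \<gamma>"
    define a3 where "a3 = snd x powr \<gamma> + (\<gamma> - 1) * \<epsilon> powr \<gamma>"
    define d where "d = complex_of_real (n * n * n * \<alpha> ^ k * \<epsilon> powr e)"
    have a: "a1 > 0" "a2 > 0" "a3 > 0" "a2 + a3 > 0"
      unfolding a1_def a2_def a3_def using zw x \<gamma> by (auto intro!: add_pos_pos mult_pos_pos)
    have 1: "(\<integral>y. H x (u, y) \<partial>lborel) = of_real (g x) * d * (2 * of_real pi * of_nat ((2 * k + 2) choose (k + 1)))
        * (1 / (Complex a1 (u - s) ^ Suc (k + 1) * Complex (a2 + a3) (t - u) ^ Suc (2 * k + 2)))" for u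
    proof -
      have "(\<integral>y. H x (u, y) \<partial>lborel) = of_real (g x) * (d * (1 / Complex a1 (u - s) ^ Suc (k + 1)
          * (2 * of_real pi * of_nat ((2 * k + 2) choose (k + 1)) / Complex (a2 + a3) (t - u) ^ Suc (2 * k + 2))))"
        unfolding H_eq[OF x] fst_conv snd_conv a1_def[symmetric] a2_def[symmetric] a3_def[symmetric] d_def[symmetric]
        by (simp only: integral_mult_right_zero integral_power_product[OF a(2,3)] two_k)
      then show ?thesis by (simp add: mult_ac del: power_Suc binomial_Suc_Suc)
    qed
    have "(\<integral>y. H x y \<partial>(lborel \<Otimes>\<^sub>M lborel)) = (\<integral>u. \<integral>y. H x (u, y) \<partial>lborel \<partial>lborel)"
      by (rule lborel_pair.integral_fst'[OF int, symmetric])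
    also have "\<dots> = of_real (g x) * d * (2 * of_real pi * of_nat ((2 * k + 2) choose (k + 1)))
        * (2 * of_real pi * of_nat ((3 * k + 3) choose (k + 1)) / Complex (a1 + (a2 + a3)) (t - s) ^ Suc (3 * k + 3))"
      unfolding 1 by (simp only: integral_mult_right_zero integral_power_product[OF a(1,4)] three_k)
    finally show ?thesis
    proof -
      assume "(\<integral>y. H x y \<partial>(lborel \<Otimes>\<^sub>M lborel)) = of_real (g x) * d * (2 * of_real pi * of_nat ((2 * k + 2) choose (k + 1)))
        * (2 * of_real pi * of_nat ((3 * k + 3) choose (k + 1)) / Complex (a1 + (a2 + a3)) (t - s) ^ Suc (3 * k + 3))"
      moreover have "Complex (a1 + (a2 + a3)) (t - s) = X + of_real (W x)"
        by (simp add: X_def W_def a1_def a2_def a3_def complex_eq_iff algebra_simps)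
      ultimately show ?thesis unfolding c_def d_def by (simp add: mult_ac del: power_Suc binomial_Suc_Suc)
    qed
  qed
  have "(\<integral>(u, v). mode_kernel k z u * (kernel_adjoint (mode_kernel k) u v * mode_kernel k v w) \<partial>(\<nu> \<Otimes>\<^sub>M \<nu>))
      = (\<integral>p. case_prod F p \<partial>distr N (\<nu> \<Otimes>\<^sub>M \<nu>) \<pi>)"
    unfolding F_def by (subst \<nu>\<nu>) simp
  also have "\<dots> = (\<integral>p. case_prod H p \<partial>N)"
    unfolding H\<pi>[symmetric] by (rule integral_distr[OF \<pi> F_meas])
  also have "\<dots> = (\<integral>x. \<integral>y. H x y \<partial>(lborel \<Otimes>\<^sub>M lborel) \<partial>(\<rho> \<Otimes>\<^sub>M \<rho>))"
    using rl.integral_fst'[OF intH[unfolded N_def]] unfolding N_def by simp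
  also have "\<dots> = (\<integral>x. g x *\<^sub>R (c * (1 / (X + of_real (W x)) ^ Suc (3 * k + 3))) \<partial>(\<rho> \<Otimes>\<^sub>M \<rho>))"
  proof (rule integral_cong_AE)
    show "AE x in \<rho> \<Otimes>\<^sub>M \<rho>. (\<integral>y. H x y \<partial>(lborel \<Otimes>\<^sub>M lborel)) = g x *\<^sub>R (c * (1 / (X + of_real (W x)) ^ Suc (3 * k + 3)))"
      using rl.AE_integrable_fst'[OF intH[unfolded N_def]] AE_space
    proof eventually_elim
      case (elim x)
      then show ?case
        by (subst inner) (auto simp: space_pair_measure scaleR_conv_of_real simp del: power_Suc)
    qed
    have "integrable (\<rho> \<Otimes>\<^sub>M \<rho>) (\<lambda>x. \<integral>y. H x y \<partial>(lborel \<Otimes>\<^sub>M lborel))"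
      using rl.integrable_fst'[OF intH[unfolded N_def]] by simp
    then show "(\<lambda>x. \<integral>y. H x y \<partial>(lborel \<Otimes>\<^sub>M lborel)) \<in> borel_measurable (\<rho> \<Otimes>\<^sub>M \<rho>)"
      by (rule borel_measurable_integrable)
  qed measurable
  also have "\<dots> = (\<integral>x. c * (1 / (X + of_real (W x)) ^ Suc (3 * k + 3)) \<partial>\<omega>)"
    unfolding \<omega>_def by (intro integral_density[symmetric]) (auto simp: g_def)
  also have "\<dots> = c * (of_real (D * fact (k + 1) / fact (3 * k + 3)) / X ^ Suc (k + 1))"
    unfolding integral_mult_right_zero
    by (subst integral_complex_inverse_power[OF \<omega> W\<omega> _ Laplace D X]) (use \<gamma> in \<open>auto simp: W_def\<close>)
  also have "\<dots> = of_real (leray_C r \<gamma> k) * mode_kernel k z w"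
  proof -
    have "n * n * (2 * pi * real ((2 * k + 2) choose (k + 1)) * (2 * pi * real ((3 * k + 3) choose (k + 1)))
        * (D * fact (k + 1) / fact (3 * k + 3))) = leray_C r \<gamma> k"
    proof -
      have binom: "real ((2 * k + 2) choose (k + 1)) = fact (2 * k + 2) / (fact (k + 1) * fact (k + 1))"
        "real ((3 * k + 3) choose (k + 1)) = fact (3 * k + 3) / (fact (k + 1) * fact (2 * k + 2))"
        by (subst binomial_fact; auto)+
      have "n * n * (2 * pi * real ((2 * k + 2) choose (k + 1)) * (2 * pi * real ((3 * k + 3) choose (k + 1)))
          * (D * fact (k + 1) / fact (3 * k + 3))) = (2 * pi * n)\<^sup>2 * D / (fact (k + 1))\<^sup>2"
      proof -
        have "n * n * (2 * pi * (M / (m * m)) * (2 * pi * (N / (m * M))) * (D * m / N)) = (2 * pi * n)\<^sup>2 * D / m\<^sup>2"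
          if "m > 0" "M > 0" "N > 0" for m M N :: real
          using that by (simp add: power2_eq_square)
        from this[of "fact (k + 1)" "fact (2 * k + 2)" "fact (3 * k + 3)"] show ?thesis
          unfolding binom by (simp only: fact_gt_zero)
      qed
      also have "2 * pi * n = \<gamma> ^ (k + 2) * (real k + 1)" by (simp add: n_def normalization_def)
      also have "(\<gamma> ^ (k + 2) * (real k + 1))\<^sup>2 * D / (fact (k + 1))\<^sup>2 = \<gamma> ^ (2 * k + 4) * D / (fact k)\<^sup>2"
      proof -
        have "fact (k + 1) = (real k + 1) * fact k" by simp
        then show ?thesis
          by (simp only:) (simp add: power_mult_distrib power_add power_mult power2_eq_square power4_eq_xxxx)
      qed
      also have "\<dots> = Gamma q * Gamma p / (fact k)\<^sup>2 * (\<gamma> / 2) ^ (2 * k + 2) * (\<gamma> - 1) powr (- p)"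
        using \<gamma> by (simp add: D_def power_divide power_add power2_eq_square field_simps eval_nat_numeral)
      also have "\<dots> = leray_C r \<gamma> k"
      proof -
        have "Gamma (real k + 1) = fact k" using Gamma_fact[of k, where 'a = real] by (simp add: add.commute)
        then show ?thesis unfolding leray_C_def p_def q_def by simp
      qed
      finally show ?thesis .
    qed
    moreover define Y where "Y = D * fact (k + 1) / fact (3 * k + 3)"
    moreover define b b' where "b = ((2 * k + 2) choose (k + 1))" and "b' = ((3 * k + 3) choose (k + 1))"
    ultimately have C: "n * n * (2 * pi * real b * (2 * pi * real b') * Y) = leray_C r \<gamma> k" by (simp only:)
    have "c * of_real Y = of_real ((n * n * (2 * pi * real b * (2 * pi * real b') * Y)) * (n * \<alpha> ^ k * \<epsilon> powr e))"
      unfolding c_def b_def[symmetric] b'_def[symmetric] by (simp add: mult_ac)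
    then have "c * of_real (D * fact (k + 1) / fact (3 * k + 3)) = of_real (leray_C r \<gamma> k) * of_real (n * \<alpha> ^ k * \<epsilon> powr e)"
      unfolding C by (simp only: Y_def of_real_mult)
    then show ?thesis
      unfolding zw mode_kernel_eq n_def[symmetric] e_def[symmetric] X_def[symmetric]
      by (simp only: times_divide_eq_right mult_1_right)
  qed
  finally show ?thesis .
qed

end

section \<open>Boundedness of the constants\<close>

text \<open>
  The logarithm of \<open>\<Gamma>(x) / (x\<^bsup>x - 1/2\<^esup> e\<^bsup>-x\<^esup>)\<close>. One step \<open>x \<mapsto> x + 1\<close> changes it by
  \<open>1 - (x + 1/2) ln (1 + 1/x)\<close>, which lies between \<open>- 1 / (4 x (x + 1))\<close> and \<open>0\<close>.
\<close>

definition stirling_remainder :: "real \<Rightarrow> real" where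
  "stirling_remainder x = ln (Gamma x) - (x - 1 / 2) * ln x + x"

lemma ln_Gamma_eq: "ln (Gamma x) = stirling_remainder x + (x - 1 / 2) * ln x - x"
  by (simp add: stirling_remainder_def)

lemma stirling_remainder_step:
  assumes x: "x > 0"
  shows "stirling_remainder (x + 1) = stirling_remainder x + 1 - (x + 1 / 2) * (ln (x + 1) - ln x)"
proof -
  have "Gamma (x + 1) = x * Gamma x" using x by (intro Gamma_plus1) (auto elim!: nonpos_Ints_cases)
  then have "ln (Gamma (x + 1)) = ln x + ln (Gamma x)" using x Gamma_real_pos[OF x] by (simp add: ln_mult less_imp_neq[symmetric])
  then show ?thesis unfolding stirling_remainder_def by (simp add: algebra_simps)
qed

lemma stirling_remainder_decreasing:
  assumes x: "x > 0"
  shows "stirling_remainder (x + 1) \<le> stirling_remainder x"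
proof -
  have "2 / (2 * x + 1) \<le> ln (x + 1) - ln x" using ln_inverse_approx_ge[of x "x + 1"] x by simp
  then have "(x + 1 / 2) * (2 / (2 * x + 1)) \<le> (x + 1 / 2) * (ln (x + 1) - ln x)"
    using x by (intro mult_left_mono) auto
  moreover have "(x + 1 / 2) * (2 / (2 * x + 1)) = 1" using x by (simp add: field_simps)
  ultimately show ?thesis using stirling_remainder_step[OF x] by linarith
qed

lemma stirling_remainder_ge:
  assumes x: "x > 0"
  shows "stirling_remainder (x + 1) - 1 / (4 * (x + 1)) \<ge> stirling_remainder x - 1 / (4 * x)"
proof -
  have "ln (x + 1) - ln x \<le> (1 / x + 1 / (x + 1)) / 2"
    using ln_inverse_approx_le[of x 1] x by (simp add: inverse_eq_divide)
  then have "(x + 1 / 2) * (ln (x + 1) - ln x) \<le> (x + 1 / 2) * ((1 / x + 1 / (x + 1)) / 2)"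
    using x by (intro mult_left_mono) auto
  also have "\<dots> = 1 + 1 / (4 * x) - 1 / (4 * (x + 1))"
    using x by (simp add: divide_simps) (simp add: algebra_simps)
  finally show ?thesis using stirling_remainder_step[OF x] by linarith
qed

lemma stirling_remainder_bounded_below:
  "stirling_remainder (real (Suc k)) \<ge> stirling_remainder 1 - 1 / 4"
proof -
  have "stirling_remainder (real (Suc k)) - 1 / (4 * real (Suc k)) \<ge> stirling_remainder 1 - 1 / 4"
  proof (induction k)
    case (Suc k)
    then show ?case using stirling_remainder_ge[of "real (Suc k)"] by (simp add: add.commute)
  qed simp
  moreover have "1 / (4 * real (Suc k)) \<ge> 0" by simp
  ultimately show ?thesis by linarith
qed

text \<open>Steps of length one lead from any \<open>x \<ge> a\<close> back to the compact interval \<open>[a, a + 1]\<close> without decreasing the function.\<close>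

lemma stirling_remainder_bounded_above:
  assumes a: "a > 0"
  obtains B where "\<And>x. x \<ge> a \<Longrightarrow> stirling_remainder x \<le> B"
proof -
  have "continuous_on {a..a + 1} stirling_remainder"
    unfolding stirling_remainder_def
  proof (intro continuous_intros)
    show "{a..a + 1} \<inter> \<int>\<^sub>\<le>\<^sub>0 = {}" using a by (auto elim!: nonpos_Ints_cases)
    show "\<forall>x\<in>{a..a + 1}. Gamma x \<noteq> 0" "\<forall>x\<in>{a..a + 1}. x \<noteq> 0"
      using a Gamma_real_pos by (fastforce simp: less_imp_neq[symmetric])+
  qed
  then have "bounded (stirling_remainder ` {a..a + 1})"
    by (intro compact_imp_bounded compact_continuous_image) auto
  then obtain B where "\<forall>y\<in>stirling_remainder ` {a..a + 1}. norm y \<le> B"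
    unfolding bounded_iff by blast
  then have B: "\<bar>stirling_remainder x\<bar> \<le> B" if "x \<in> {a..a + 1}" for x
    using that by auto
  have shift: "stirling_remainder (x + real n) \<le> stirling_remainder x" if "x > 0" for x n
  proof (induction n)
    case (Suc n)
    then show ?case using stirling_remainder_decreasing[of "x + real n"] that by (simp add: algebra_simps)
  qed simp
  have "stirling_remainder x \<le> B" if "x \<ge> a" for x
  proof -
    define n where "n = nat \<lfloor>x - a\<rfloor>"
    have n: "real n = of_int \<lfloor>x - a\<rfloor>" unfolding n_def using that by simp
    have "a \<le> x - real n" "x - real n \<le> a + 1" unfolding n by linarith+
    then show ?thesis using shift[of "x - real n" n] B[of "x - real n"] a by simp
  qed
  then show thesis by (rule that)
qed

lemma leray_C_pos:
  assumes "\<gamma> > 1" and r: "-1 < r" "r < 2 * \<gamma> - 1"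
  shows "leray_C r \<gamma> k > 0"
proof -
  have "(2 * real k + 1 + r) / \<gamma> > 0" using assms by (intro divide_pos_pos) auto
  moreover have "2 * real k + 1 + r < \<gamma> * (2 * real k + 2)"
  proof -
    have "2 * real k * 1 \<le> 2 * real k * \<gamma>" using assms(1) by (intro mult_left_mono) auto
    then show ?thesis using r by (simp add: algebra_simps)
  qed
  then have "2 * real k + 2 - (2 * real k + 1 + r) / \<gamma> > 0" using assms by (simp add: field_simps)
  ultimately show ?thesis
    unfolding leray_C_def using assms by (intro mult_pos_pos divide_pos_pos zero_less_power Gamma_real_pos) auto
qed

text \<open>
  With \<open>n = 2 k + 2\<close>, \<open>q = (2 k + 1 + r) / \<gamma>\<close> and \<open>p = n - q\<close>, Stirling's formula cancels all terms of
  order \<open>n ln n\<close> and \<open>n\<close>: what remains are \<open>q ln (q \<gamma> / n)\<close> and \<open>p ln (p \<gamma> / ((\<gamma> - 1) n))\<close>, where the arguments are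
  \<open>1 + O(1/n)\<close>, and \<open>ln (n\<^sup>2 / (p q)) / 2\<close>.
\<close>

lemma leray_C_bounded:
  assumes \<gamma>: "\<gamma> > 1" and r: "-1 < r" "r < 2 * \<gamma> - 1"
  obtains K where "\<And>k. leray_C r \<gamma> k \<le> K"
proof -
  \<comment> \<open>A common lower bound of \<open>p / n\<close> and \<open>q / n\<close>: both are monotone in \<open>1 / n\<close>, so the extreme cases \<open>n = 2\<close> and \<open>n = \<infinity>\<close> suffice.\<close>
  define \<delta> where "\<delta> = min (min 1 ((1 + r) / 2)) (min (\<gamma> - 1) ((2 * \<gamma> - 1 - r) / 2)) / \<gamma>"
  have \<delta>: "\<delta> > 0" unfolding \<delta>_def using assms by (auto simp: min_def)
  have \<delta>\<gamma>: "\<delta> * \<gamma> \<le> 1" "\<delta> * \<gamma> \<le> (1 + r) / 2" "\<delta> * \<gamma> \<le> \<gamma> - 1" "\<delta> * \<gamma> \<le> (2 * \<gamma> - 1 - r) / 2"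
  proof -
    have eq: "\<delta> * \<gamma> = min (min 1 ((1 + r) / 2)) (min (\<gamma> - 1) ((2 * \<gamma> - 1 - r) / 2))"
      using \<gamma> by (simp add: \<delta>_def)
    show "\<delta> * \<gamma> \<le> 1" "\<delta> * \<gamma> \<le> (1 + r) / 2" "\<delta> * \<gamma> \<le> \<gamma> - 1" "\<delta> * \<gamma> \<le> (2 * \<gamma> - 1 - r) / 2"
      unfolding eq
      by (rule min.coboundedI1 min.coboundedI2, rule min.cobounded1 min.cobounded2)+
  qed
  obtain B where B: "\<And>x. x \<ge> 2 * \<delta> \<Longrightarrow> stirling_remainder x \<le> B"
    using stirling_remainder_bounded_above[of "2 * \<delta>"] \<delta> by auto
  define c where "c = stirling_remainder 1 - 1 / 4"
  define K where "K = 2 * B - 2 * c - ln 2 + \<bar>r - 1\<bar> + \<bar>r - 1\<bar> / (\<gamma> - 1) - ln \<delta>"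
  have "leray_C r \<gamma> k \<le> exp K" for k
  proof -
    define n where "n = 2 * real k + 2"
    define q where "q = (n - 1 + r) / \<gamma>"
    define p where "p = n - q"
    have n: "n \<ge> 2" by (simp add: n_def)
    have q\<gamma>: "q * \<gamma> = n - 1 + r" and p\<gamma>: "p * \<gamma> = (\<gamma> - 1) * n + 1 - r"
      using \<gamma> by (simp_all add: q_def p_def field_simps)
    have "q * \<gamma> \<ge> (\<delta> * n) * \<gamma>"
    proof (cases "r \<ge> 1")
      case True
      have "(\<delta> * \<gamma>) * n \<le> 1 * n" using \<delta>\<gamma>(1) n by (intro mult_right_mono) auto
      then show ?thesis unfolding q\<gamma> using True by (simp add: mult_ac)
    next
      case False
      have "(\<delta> * \<gamma>) * n \<le> (1 + r) / 2 * n" using \<delta>\<gamma>(2) n by (intro mult_right_mono) auto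
      moreover have "(1 - r) * 2 \<le> (1 - r) * n" using False n by (intro mult_left_mono) auto
      ultimately show ?thesis unfolding q\<gamma> by (simp add: algebra_simps)
    qed
    then have q_ge: "q \<ge> \<delta> * n" using \<gamma> by simp
    have "p * \<gamma> \<ge> (\<delta> * n) * \<gamma>"
    proof (cases "r \<le> 1")
      case True
      have "(\<delta> * \<gamma>) * n \<le> (\<gamma> - 1) * n" using \<delta>\<gamma>(3) n by (intro mult_right_mono) auto
      then show ?thesis unfolding p\<gamma> using True by (simp add: algebra_simps)
    next
      case False
      have "(\<delta> * \<gamma>) * n \<le> (2 * \<gamma> - 1 - r) / 2 * n" using \<delta>\<gamma>(4) n by (intro mult_right_mono) auto
      moreover have "(r - 1) * 2 \<le> (r - 1) * n" using False n by (intro mult_left_mono) auto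
      ultimately show ?thesis unfolding p\<gamma> by (simp add: algebra_simps)
    qed
    then have p_ge: "p \<ge> \<delta> * n" using \<gamma> by simp
    have dn: "\<delta> * n \<ge> 2 * \<delta>" using n \<delta> by simp
    have pq: "p + q = n" by (simp add: p_def)
    have pos: "p > 0" "q > 0" "p \<le> n" "q \<le> n" "n > 0"
      using p_ge q_ge dn \<delta> n pq by linarith+
    have lnG: "ln (Gamma q) \<le> B + (q - 1 / 2) * ln q - q" "ln (Gamma p) \<le> B + (p - 1 / 2) * ln p - p"
      using B[of q] B[of p] q_ge p_ge dn by (simp_all add: ln_Gamma_eq)
    have k1: "real k + 1 = n / 2" by (simp add: n_def)
    have lnGk: "ln (Gamma (n / 2)) \<ge> c + (n / 2 - 1 / 2) * (ln n - ln 2) - n / 2"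
    proof -
      have eq: "real (Suc k) = n / 2" by (simp add: n_def)
      show ?thesis
        using stirling_remainder_bounded_below[of k] pos unfolding eq by (simp add: ln_Gamma_eq c_def ln_div)
    qed
    have C_eq: "leray_C r \<gamma> k = Gamma q * Gamma p / (Gamma (n / 2))\<^sup>2 * (\<gamma> / 2) powr n * (\<gamma> - 1) powr (- p)"
    proof -
      have "(\<gamma> / 2) ^ (2 * k + 2) = (\<gamma> / 2) powr n"
        using \<gamma> by (subst powr_realpow [symmetric]) (auto simp: n_def add.commute)
      moreover have "(2 * real k + 1 + r) / \<gamma> = q" by (simp add: q_def n_def)
      ultimately show ?thesis unfolding leray_C_def k1 by (simp add: p_def n_def)
    qed
    have "ln (leray_C r \<gamma> k) = ln (Gamma q) + ln (Gamma p) - 2 * ln (Gamma (n / 2))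
        + n * (ln \<gamma> - ln 2) - p * ln (\<gamma> - 1)"
    proof -
      have "Gamma q > 0" "Gamma p > 0" "Gamma (n / 2) > 0" using pos by auto
      then show ?thesis unfolding C_eq using \<gamma>
        by (simp add: ln_mult ln_div ln_powr ln_realpow less_imp_neq[symmetric])
    qed
    also have "\<dots> \<le> 2 * B + (q - 1 / 2) * ln q + (p - 1 / 2) * ln p - n
        - 2 * (c + (n / 2 - 1 / 2) * (ln n - ln 2) - n / 2) + n * (ln \<gamma> - ln 2) - p * ln (\<gamma> - 1)"
    proof -
      have "g1 + g2 - 2 * g3 + w - x \<le> 2 * B + u + v - n - 2 * (c + t - n / 2) + w - x"
        if "g1 \<le> B + u - q" "g2 \<le> B + v - p" "c + t - n / 2 \<le> g3" for g1 g2 g3 u v t w x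
      proof -
        have "g1 + g2 \<le> 2 * B + u + v - n" using that(1,2) pq by linarith
        moreover have "2 * (c + t - n / 2) \<le> 2 * g3" using that(3) by simp
        ultimately show ?thesis by linarith
      qed
      from this[OF lnG lnGk] show ?thesis .
    qed
    also have "\<dots> = 2 * B - 2 * c - ln 2 + q * (ln q + ln \<gamma> - ln n) + p * (ln p + ln \<gamma> - ln (\<gamma> - 1) - ln n)
        + (ln n - (ln p + ln q) / 2)"
      by (simp add: field_simps flip: pq)
    also have "\<dots> \<le> K"
    proof -
      have 1: "q * (ln q + ln \<gamma> - ln n) \<le> \<bar>r - 1\<bar>"
      proof -
        have "ln q + ln \<gamma> - ln n = ln (q * \<gamma> / n)" using pos \<gamma> by (simp add: ln_mult ln_div)
        also have "\<dots> \<le> q * \<gamma> / n - 1" using pos \<gamma> by (intro ln_le_minus_one) auto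
        also have "\<dots> = (r - 1) / n" unfolding q\<gamma> using pos by (simp add: field_simps)
        also have "\<dots> \<le> \<bar>r - 1\<bar> / n" using pos by (intro divide_right_mono) auto
        finally have "q * (ln q + ln \<gamma> - ln n) \<le> q * (\<bar>r - 1\<bar> / n)" using pos by (intro mult_left_mono) auto
        also have "\<dots> = q / n * \<bar>r - 1\<bar>" by simp
        also have "\<dots> \<le> 1 * \<bar>r - 1\<bar>" using pos by (intro mult_right_mono) auto
        finally show ?thesis by simp
      qed
      have 2: "p * (ln p + ln \<gamma> - ln (\<gamma> - 1) - ln n) \<le> \<bar>r - 1\<bar> / (\<gamma> - 1)"
      proof -
        have "ln p + ln \<gamma> - ln (\<gamma> - 1) - ln n = ln (p * \<gamma> / ((\<gamma> - 1) * n))"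
          using pos \<gamma> by (simp add: ln_mult ln_div)
        also have "\<dots> \<le> p * \<gamma> / ((\<gamma> - 1) * n) - 1" using pos \<gamma> by (intro ln_le_minus_one) auto
        also have "\<dots> = (1 - r) / ((\<gamma> - 1) * n)" unfolding p\<gamma> using pos \<gamma> by (simp add: field_simps)
        also have "\<dots> \<le> \<bar>r - 1\<bar> / ((\<gamma> - 1) * n)" using pos \<gamma> by (intro divide_right_mono) auto
        finally have "p * (ln p + ln \<gamma> - ln (\<gamma> - 1) - ln n) \<le> p * (\<bar>r - 1\<bar> / ((\<gamma> - 1) * n))"
          using pos by (intro mult_left_mono) auto
        also have "\<dots> = p / n * (\<bar>r - 1\<bar> / (\<gamma> - 1))" by simp
        also have "\<dots> \<le> 1 * (\<bar>r - 1\<bar> / (\<gamma> - 1))" using pos \<gamma> by (intro mult_right_mono) auto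
        finally show ?thesis by simp
      qed
      have "ln (\<delta> * n) \<le> ln p" "ln (\<delta> * n) \<le> ln q" using p_ge q_ge \<delta> pos by auto
      then have 3: "ln n - (ln p + ln q) / 2 \<le> - ln \<delta>"
      proof -
        have "ln \<delta> + ln n \<le> ln p" "ln \<delta> + ln n \<le> ln q"
          using \<open>ln (\<delta> * n) \<le> ln p\<close> \<open>ln (\<delta> * n) \<le> ln q\<close> \<delta> pos by (simp_all add: ln_mult)
        then have "2 * (ln \<delta> + ln n) \<le> ln p + ln q" by simp
        then have "ln \<delta> + ln n \<le> (ln p + ln q) / 2" by simp
        moreover define y where "y = (ln p + ln q) / 2"
        ultimately show ?thesis unfolding y_def [symmetric] by simp
      qed
      show ?thesis unfolding K_def using 1 2 3 by linarith
    qed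
    finally show ?thesis using leray_C_pos[OF assms] by (metis exp_le_cancel_iff exp_ln)
  qed
  then show thesis by (rule that)
qed

section \<open>Fourier modes on the hypersurface\<close>

definition circle_measure :: "real measure" where
  "circle_measure = restrict_space lborel {0..<2 * pi}"

lemma space_circle_measure [simp]: "space circle_measure = {0..<2 * pi}"
  by (simp add: circle_measure_def space_restrict_space)

lemma emeasure_circle_measure: "emeasure circle_measure (space circle_measure) = ennreal (2 * pi)"
  unfolding space_circle_measure circle_measure_def by (subst emeasure_restrict_space) auto

lemma sigma_finite_circle_measure: "sigma_finite_measure circle_measure"
  unfolding circle_measure_def
  by (intro sigma_finite_measure_restrict_space lborel.sigma_finite_measure_axioms) auto

lemma integral_circle_measure:
  fixes f :: "real \<Rightarrow> complex"
  shows "(\<integral>\<theta>. f \<theta> \<partial>circle_measure) = (LBINT \<theta>:{0..<2 * pi}. f \<theta>)"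
  unfolding circle_measure_def set_lebesgue_integral_def by (subst integral_restrict_space) auto

lemma circle_measurableI: "f \<in> borel_measurable borel \<Longrightarrow> f \<in> borel_measurable circle_measure"
  unfolding circle_measure_def by (intro measurable_restrict_space1) simp

lemma cis_measurable [measurable]: "cis \<in> borel_measurable borel"
  by (intro borel_measurable_continuous_onI continuous_intros)

lemma integral_cis_circle:
  "(\<integral>\<theta>. cis (of_int n * \<theta>) \<partial>circle_measure) = (if n = 0 then 2 * of_real pi else 0)"
proof (cases "n = 0")
  case True
  then show ?thesis
    using emeasure_circle_measure by (simp add: measure_def scaleR_conv_of_real)
next
  case False
    have vd: "((\<lambda>\<theta>. cis (of_int n * \<theta>) / (\<i> * of_int n)) has_vector_derivative cis (of_int n * \<theta>)) (at \<theta> within A)" for \<theta> A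
    proof -
      have "((\<lambda>z. exp (\<i> * of_int n * z) / (\<i> * of_int n)) has_field_derivative exp (\<i> * of_int n * of_real \<theta>))
          (at (of_real \<theta>))"
        using False by (auto intro!: derivative_eq_intros)
      from has_vector_derivative_real_field[OF this, of A]
      have "((\<lambda>\<theta>. exp (\<i> * of_int n * of_real \<theta>) / (\<i> * of_int n)) has_vector_derivative
          exp (\<i> * of_int n * of_real \<theta>)) (at \<theta> within A)" .
      then show ?thesis by (simp add: cis_conv_exp mult_ac)
    qed
    have "(LBINT \<theta>=ereal 0..ereal (2 * pi). cis (of_int n * \<theta>))
        = cis (of_int n * (2 * pi)) / (\<i> * of_int n) - cis (of_int n * 0) / (\<i> * of_int n)"
      by (rule interval_integral_FTC_finite) (auto intro!: continuous_intros vd)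
    also have "cis (of_int n * (2 * pi)) = 1"
      using cis_multiple_2pi[of "of_int n"] by (simp add: mult_ac)
    finally have "(LBINT \<theta>:{0..2 * pi}. cis (of_int n * \<theta>)) = 0"
      by (simp add: interval_integral_Icc zero_ereal_def)
    moreover have "(LBINT \<theta>:{0..<2 * pi}. cis (of_int n * \<theta>)) = (LBINT \<theta>:{0..2 * pi}. cis (of_int n * \<theta>))"
      by (rule set_integral_discrete_difference[where X = "{2 * pi}"]) auto
    ultimately show ?thesis unfolding integral_circle_measure using False by simp
qed

context leray_parameters
begin

abbreviation "\<tau> \<equiv> circle_measure"
abbreviation "\<mu> \<equiv> mu \<gamma> r"

definition \<Phi> :: "(real \<times> real) \<times> real \<Rightarrow> complex \<times> complex" where
  "\<Phi> = (\<lambda>(x, \<theta>). hypersurface_param \<gamma> (snd x, fst x, \<theta>))"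

lemma param_measurable: "hypersurface_param \<gamma> \<in> borel_measurable borel"
proof -
  have "(\<lambda>p::real \<times> real \<times> real. (of_real (fst (snd p)) * cis (snd (snd p)), Complex (fst p) (fst (snd p) powr \<gamma>)))
      \<in> borel_measurable borel"
  proof -
    have [measurable]: "(\<lambda>p::real \<times> real \<times> real. fst p) \<in> borel_measurable borel"
      "(\<lambda>p::real \<times> real \<times> real. fst (snd p)) \<in> borel_measurable borel"
      "(\<lambda>p::real \<times> real \<times> real. snd (snd p)) \<in> borel_measurable borel"
      by (auto intro!: borel_measurable_continuous_onI continuous_intros)
    show ?thesis unfolding Complex_eq by measurable
  qed
  then show ?thesis by (simp add: hypersurface_param_def split_def)
qed

lemma hypersurface_borel: "hypersurface \<gamma> \<in> sets borel"
proof -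
  have [measurable]: "(\<lambda>p::complex \<times> complex. Im (snd p)) \<in> borel_measurable borel"
    "(\<lambda>p::complex \<times> complex. cmod (fst p)) \<in> borel_measurable borel"
    by (auto intro!: borel_measurable_continuous_onI continuous_intros)
  have "{\<zeta>\<in>space borel. Im (snd \<zeta>) = cmod (fst \<zeta>) powr \<gamma>} \<in> sets borel" by measurable
  then show ?thesis by (simp add: hypersurface_def)
qed

lemma param_in_hypersurface: "\<alpha> > 0 \<Longrightarrow> hypersurface_param \<gamma> (s, \<alpha>, \<theta>) \<in> hypersurface \<gamma>"
  by (simp add: hypersurface_param_def hypersurface_def norm_mult)

lemma product_id_measurable: "(\<lambda>x. x) \<in> borel_measurable (\<nu> \<Otimes>\<^sub>M \<tau>)"
proof -
  have "(\<lambda>x. (fst x, snd x)) \<in> \<nu> \<Otimes>\<^sub>M \<tau> \<rightarrow>\<^sub>M borel \<Otimes>\<^sub>M borel"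
    by (intro measurable_Pair measurable_compose[OF measurable_fst profile_id_measurable]
        measurable_compose[OF measurable_snd circle_measurableI]) simp
  then show ?thesis by (simp add: borel_prod)
qed

lemma \<Phi>_borel: "\<Phi> \<in> borel_measurable borel"
proof -
  have "(\<lambda>p::(real \<times> real) \<times> real. (snd (fst p), fst (fst p), snd p)) \<in> borel_measurable borel"
    by (intro borel_measurable_continuous_onI continuous_intros)
  from measurable_compose[OF this param_measurable] show ?thesis
    by (simp add: \<Phi>_def split_def)
qed

lemma \<Phi>_measurable [measurable]: "\<Phi> \<in> \<nu> \<Otimes>\<^sub>M \<tau> \<rightarrow>\<^sub>M restrict_space borel (hypersurface \<gamma>)"
proof (rule measurable_restrict_space2)
  show "\<Phi> \<in> space (\<nu> \<Otimes>\<^sub>M \<tau>) \<rightarrow> hypersurface \<gamma>"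
    by (auto simp: space_pair_measure space_profile_measure \<Phi>_def param_in_hypersurface)
  show "\<Phi> \<in> borel_measurable (\<nu> \<Otimes>\<^sub>M \<tau>)"
    using measurable_compose[OF product_id_measurable \<Phi>_borel] by simp
qed

text \<open>
  The first factor of the product carries the profile variables, so that Fubini's theorem splits
  an integral over the hypersurface into an integral over the circle and one over the profile space.
\<close>

lemma mu_eq_distr: "\<mu> = distr (\<nu> \<Otimes>\<^sub>M \<tau>) (restrict_space borel (hypersurface \<gamma>)) \<Phi>"
proof (rule measure_eqI)
  define \<Omega> where "\<Omega> = (UNIV :: real set) \<times> {0::real<..} \<times> {0..<2 * pi}"
  define w where "w = (\<lambda>(s::real, \<alpha>, \<theta>::real). ennreal (\<alpha> powr r))"
  interpret \<tau>: sigma_finite_measure \<tau> by (rule sigma_finite_circle_measure)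
  have \<Omega> [measurable]: "\<Omega> \<in> sets borel" unfolding \<Omega>_def
    by (auto simp: borel_prod[symmetric])
  have w [measurable]: "w \<in> borel_measurable borel"
  proof -
    have [measurable]: "(\<lambda>p::real \<times> real \<times> real. fst (snd p)) \<in> borel_measurable borel"
      by (intro borel_measurable_continuous_onI continuous_intros)
    have "(\<lambda>p::real \<times> real \<times> real. ennreal (fst (snd p) powr r)) \<in> borel_measurable borel" by measurable
    then show ?thesis by (simp add: w_def split_def)
  qed
  have mu: "\<mu> = distr (density (restrict_space lborel \<Omega>) w) (restrict_space borel (hypersurface \<gamma>)) (hypersurface_param \<gamma>)"
    unfolding mu_def \<Omega>_def w_def ..
  have param: "hypersurface_param \<gamma> \<in> density (restrict_space lborel \<Omega>) w \<rightarrow>\<^sub>M restrict_space borel (hypersurface \<gamma>)"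
  proof (rule measurable_restrict_space2)
    show "hypersurface_param \<gamma> \<in> space (density (restrict_space lborel \<Omega>) w) \<rightarrow> hypersurface \<gamma>"
      by (auto simp: space_restrict_space \<Omega>_def param_in_hypersurface)
    show "hypersurface_param \<gamma> \<in> borel_measurable (density (restrict_space lborel \<Omega>) w)"
      using measurable_restrict_space1[of "hypersurface_param \<gamma>" lborel borel \<Omega>] param_measurable by simp
  qed
  fix X assume "X \<in> sets \<mu>"
  then have Xr [measurable]: "X \<in> sets (restrict_space borel (hypersurface \<gamma>))" by (simp add: mu_def)
  then have X [measurable]: "X \<in> sets borel"
    using hypersurface_borel by (auto simp: sets_restrict_space_iff)
  note [measurable] = param_measurable
  define F where "F s \<alpha> \<theta> = ennreal (\<alpha> powr r) * indicator X (hypersurface_param \<gamma> (s, \<alpha>, \<theta>))" for s \<alpha> \<theta>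
  have Fm: "(\<lambda>p. F (fst p) (fst (snd p)) (snd (snd p)) * indicator \<Omega> p) \<in> borel_measurable borel"
  proof -
    have "(\<lambda>p. w p * indicator X (hypersurface_param \<gamma> p) * indicator \<Omega> p) \<in> borel_measurable borel" by measurable
    then show ?thesis by (simp add: F_def w_def split_def)
  qed
  have "emeasure \<mu> X = (\<integral>\<^sup>+z. indicator X z \<partial>\<mu>)" by (subst nn_integral_indicator) (auto simp: mu_def)
  also have "\<dots> = (\<integral>\<^sup>+p. indicator X (hypersurface_param \<gamma> p) \<partial>density (restrict_space lborel \<Omega>) w)"
    unfolding mu using Xr by (intro nn_integral_distr[OF param]) simp
  also have "\<dots> = (\<integral>\<^sup>+p. w p * indicator X (hypersurface_param \<gamma> p) \<partial>restrict_space lborel \<Omega>)"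
    by (rule nn_integral_density) (intro measurable_restrict_space1, measurable)+
  also have "\<dots> = (\<integral>\<^sup>+p. w p * indicator X (hypersurface_param \<gamma> p) * indicator \<Omega> p \<partial>lborel)"
    by (rule nn_integral_restrict_space) simp
  also have "\<dots> = (\<integral>\<^sup>+p. F (fst p) (fst (snd p)) (snd (snd p)) * indicator \<Omega> p \<partial>(lborel \<Otimes>\<^sub>M lborel))"
    unfolding lborel_prod by (simp add: F_def w_def split_def)
  also have "\<dots> = (\<integral>\<^sup>+s. \<integral>\<^sup>+q. F s (fst q) (snd q) * indicator \<Omega> (s, q) \<partial>lborel \<partial>lborel)"
    using Fm by (subst lborel.nn_integral_fst[symmetric]) (auto simp: lborel_prod)
  also have "\<dots> = (\<integral>\<^sup>+s. \<integral>\<^sup>+\<alpha>. \<integral>\<^sup>+\<theta>. F s \<alpha> \<theta> * indicator \<Omega> (s, \<alpha>, \<theta>) \<partial>lborel \<partial>lborel \<partial>lborel)"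
  proof (rule nn_integral_cong)
    fix s :: real
    have "(\<lambda>q. F s (fst q) (snd q) * indicator \<Omega> (s, q)) \<in> borel_measurable borel"
      using measurable_compose[OF _ Fm, of "\<lambda>q. (s, q)" borel]
      by (auto intro!: borel_measurable_continuous_onI continuous_intros)
    then show "(\<integral>\<^sup>+q. F s (fst q) (snd q) * indicator \<Omega> (s, q) \<partial>lborel)
        = (\<integral>\<^sup>+\<alpha>. \<integral>\<^sup>+\<theta>. F s \<alpha> \<theta> * indicator \<Omega> (s, \<alpha>, \<theta>) \<partial>lborel \<partial>lborel)"
      unfolding lborel_prod[symmetric] by (subst lborel.nn_integral_fst[symmetric]) (auto simp: lborel_prod)
  qed
  also have "\<dots> = (\<integral>\<^sup>+\<alpha>. \<integral>\<^sup>+s. \<integral>\<^sup>+\<theta>. F s \<alpha> \<theta> * indicator \<Omega> (s, \<alpha>, \<theta>) \<partial>lborel \<partial>lborel \<partial>lborel)"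
  proof (rule lborel_pair.Fubini')
    have "(\<lambda>p::(real \<times> real) \<times> real. (snd (fst p), fst (fst p), snd p)) \<in> borel_measurable borel"
      by (intro borel_measurable_continuous_onI continuous_intros)
    from measurable_compose[OF this Fm]
    have "(\<lambda>p::(real \<times> real) \<times> real. F (snd (fst p)) (fst (fst p)) (snd p) * indicator \<Omega> (snd (fst p), fst (fst p), snd p)) \<in> borel_measurable borel"
      by simp
    then have "(\<lambda>p::(real \<times> real) \<times> real. F (snd (fst p)) (fst (fst p)) (snd p) * indicator \<Omega> (snd (fst p), fst (fst p), snd p))
        \<in> borel_measurable ((lborel \<Otimes>\<^sub>M lborel) \<Otimes>\<^sub>M lborel)" by (simp add: lborel_prod)
    from lborel.borel_measurable_nn_integral_fst[OF this]
    show "(\<lambda>(\<alpha>, s). \<integral>\<^sup>+\<theta>. F s \<alpha> \<theta> * indicator \<Omega> (s, \<alpha>, \<theta>) \<partial>lborel) \<in> borel_measurable (lborel \<Otimes>\<^sub>M lborel)"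
      by (simp add: split_def)
  qed
  also have "\<dots> = (\<integral>\<^sup>+\<alpha>. \<integral>\<^sup>+s. \<integral>\<^sup>+\<theta>. indicator X (\<Phi> ((\<alpha>, s), \<theta>)) \<partial>\<tau> \<partial>lborel \<partial>\<rho>)"
  proof -
    have m1: "(\<lambda>z. \<integral>\<^sup>+\<theta>. indicator X (\<Phi> (z, \<theta>)) \<partial>\<tau>) \<in> borel_measurable \<nu>"
      by (intro \<tau>.borel_measurable_nn_integral) measurable
    then have m2: "(\<lambda>\<alpha>. \<integral>\<^sup>+s. \<integral>\<^sup>+\<theta>. indicator X (\<Phi> ((\<alpha>, s), \<theta>)) \<partial>\<tau> \<partial>lborel) \<in> borel_measurable \<rho>"
      unfolding profile_measure_def by measurable
    have "(\<integral>\<^sup>+\<alpha>. \<integral>\<^sup>+s. \<integral>\<^sup>+\<theta>. indicator X (\<Phi> ((\<alpha>, s), \<theta>)) \<partial>\<tau> \<partial>lborel \<partial>\<rho>)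
        = (\<integral>\<^sup>+\<alpha>. ennreal (\<alpha> powr r) * (\<integral>\<^sup>+s. \<integral>\<^sup>+\<theta>. indicator X (\<Phi> ((\<alpha>, s), \<theta>)) \<partial>\<tau> \<partial>lborel) * indicator {0<..} \<alpha> \<partial>lborel)"
      using m2 unfolding radial_measure_def nn_integral_half_line[symmetric]
      by (intro nn_integral_density) auto
    also have "\<dots> = (\<integral>\<^sup>+\<alpha>. \<integral>\<^sup>+s. \<integral>\<^sup>+\<theta>. F s \<alpha> \<theta> * indicator \<Omega> (s, \<alpha>, \<theta>) \<partial>lborel \<partial>lborel \<partial>lborel)"
    proof (rule nn_integral_cong)
      fix \<alpha> :: real
      show "ennreal (\<alpha> powr r) * (\<integral>\<^sup>+s. \<integral>\<^sup>+\<theta>. indicator X (\<Phi> ((\<alpha>, s), \<theta>)) \<partial>\<tau> \<partial>lborel) * indicator {0<..} \<alpha>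
          = (\<integral>\<^sup>+s. \<integral>\<^sup>+\<theta>. F s \<alpha> \<theta> * indicator \<Omega> (s, \<alpha>, \<theta>) \<partial>lborel \<partial>lborel)"
      proof (cases "\<alpha> > 0")
        case True
        have in1: "(\<lambda>\<theta>. indicator X (\<Phi> ((\<alpha>, s), \<theta>)) :: ennreal) \<in> borel_measurable \<tau>" for s
          using measurable_compose[OF _ \<Phi>_borel, of "\<lambda>\<theta>. ((\<alpha>, s), \<theta>)" borel]
          by (intro circle_measurableI borel_measurable_indicator') (auto intro!: borel_measurable_continuous_onI continuous_intros simp: measurable_sets_borel)
        have in2: "(\<lambda>s. \<integral>\<^sup>+\<theta>. indicator X (\<Phi> ((\<alpha>, s), \<theta>)) \<partial>\<tau>) \<in> borel_measurable lborel"
          using measurable_compose[OF measurable_Pair1'[of \<alpha> \<rho> lborel] m1[unfolded profile_measure_def]] True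
          by simp
        have "(\<integral>\<^sup>+s. \<integral>\<^sup>+\<theta>. F s \<alpha> \<theta> * indicator \<Omega> (s, \<alpha>, \<theta>) \<partial>lborel \<partial>lborel)
            = (\<integral>\<^sup>+s. \<integral>\<^sup>+\<theta>. ennreal (\<alpha> powr r) * indicator X (\<Phi> ((\<alpha>, s), \<theta>)) \<partial>\<tau> \<partial>lborel)"
        proof (rule nn_integral_cong)
          fix s
          show "(\<integral>\<^sup>+\<theta>. F s \<alpha> \<theta> * indicator \<Omega> (s, \<alpha>, \<theta>) \<partial>lborel) = (\<integral>\<^sup>+\<theta>. ennreal (\<alpha> powr r) * indicator X (\<Phi> ((\<alpha>, s), \<theta>)) \<partial>\<tau>)"
            unfolding circle_measure_def
            by (subst nn_integral_restrict_space)
              (use True in \<open>auto intro!: nn_integral_cong simp: F_def \<Omega>_def \<Phi>_def indicator_def\<close>)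
        qed
        also have "\<dots> = ennreal (\<alpha> powr r) * (\<integral>\<^sup>+s. \<integral>\<^sup>+\<theta>. indicator X (\<Phi> ((\<alpha>, s), \<theta>)) \<partial>\<tau> \<partial>lborel)"
          using in1 in2 by (simp add: nn_integral_cmult)
        finally show ?thesis using True by simp
      next
        case False
        then show ?thesis by (simp add: \<Omega>_def indicator_def)
      qed
    qed
    finally show ?thesis by simp
  qed
  also have "\<dots> = (\<integral>\<^sup>+x. \<integral>\<^sup>+\<theta>. indicator X (\<Phi> (x, \<theta>)) \<partial>\<tau> \<partial>\<nu>)"
    by (rule nn_integral_profile[symmetric]) (intro \<tau>.borel_measurable_nn_integral, measurable)
  also have "\<dots> = (\<integral>\<^sup>+p. indicator X (\<Phi> p) \<partial>(\<nu> \<Otimes>\<^sub>M \<tau>))"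
    by (rule \<tau>.nn_integral_fst) measurable
  also have "\<dots> = (\<integral>\<^sup>+z. indicator X z \<partial>distr (\<nu> \<Otimes>\<^sub>M \<tau>) (restrict_space borel (hypersurface \<gamma>)) \<Phi>)"
    by (rule nn_integral_distr[symmetric]) auto
  also have "\<dots> = emeasure (distr (\<nu> \<Otimes>\<^sub>M \<tau>) (restrict_space borel (hypersurface \<gamma>)) \<Phi>) X"
    by (subst nn_integral_indicator) auto
  finally show "emeasure \<mu> X = emeasure (distr (\<nu> \<Otimes>\<^sub>M \<tau>) (restrict_space borel (hypersurface \<gamma>)) \<Phi>) X" .
qed (simp add: mu_def)


subsection \<open>The unitary equivalence of a Fourier mode with the profile space\<close>

definition coord :: "complex \<times> complex \<Rightarrow> real \<times> real" where
  "coord z = (cmod (fst z), Re (snd z))"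

text \<open>
  The map \<open>g \<mapsto> g(\<alpha>, s) e\<^bsup>i k \<theta>\<^esup>\<close>, up to the factor \<open>(2 \<pi>)\<^bsup>1/2\<^esup>\<close> an isometry onto the \<open>k\<close>-th Fourier mode. Its argument
  is a function on the whole plane, because the points of the hypersurface with vanishing first coordinate have
  \<open>\<alpha> = 0\<close>.
\<close>

definition lift :: "int \<Rightarrow> (real \<times> real \<Rightarrow> complex) \<Rightarrow> complex \<times> complex \<Rightarrow> complex" where
  "lift k g z = cis (of_int k * Arg (fst z)) * g (coord z)"

definition coeff :: "int \<Rightarrow> (complex \<times> complex \<Rightarrow> complex) \<Rightarrow> real \<times> real \<Rightarrow> complex" where
  "coeff k f x = fourier_coeff \<gamma> f k (snd x) (fst x)"

lemma coeff_eq: "coeff k f x = 1 / (2 * of_real pi) * (\<integral>\<theta>. f (\<Phi> (x, \<theta>)) * cis (- (of_int k * \<theta>)) \<partial>\<tau>)"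
  by (simp add: coeff_def fourier_coeff_def integral_circle_measure \<Phi>_def)

lemma cis_int_cong:
  assumes "cis x = cis y"
  shows "cis (of_int k * x) = cis (of_int k * y)"
proof (cases k)
  case (nonneg n)
  then show ?thesis using assms by (metis Complex.DeMoivre of_int_of_nat_eq)
next
  case (neg n)
  have "cis (real (Suc n) * x) = cis (real (Suc n) * y)"
    using assms by (metis Complex.DeMoivre)
  then have "cnj (cis (real (Suc n) * x)) = cnj (cis (real (Suc n) * y))" by simp
  moreover have "of_int k * u = - (real (Suc n) * u)" for u :: real by (simp add: neg algebra_simps)
  ultimately show ?thesis by (simp only: cis_cnj)
qed

lemma coord_\<Phi>: "x \<in> space \<nu> \<Longrightarrow> coord (\<Phi> (x, \<theta>)) = x"
  by (auto simp: space_profile_measure \<Phi>_def coord_def hypersurface_param_def norm_mult)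

lemma lift_\<Phi>:
  assumes "x \<in> space \<nu>"
  shows "lift k g (\<Phi> (x, \<theta>)) = cis (of_int k * \<theta>) * g x"
proof -
  obtain \<alpha> s where x: "x = (\<alpha>, s)" "\<alpha> > 0" using assms by (auto simp: space_profile_measure)
  have "cis (Arg (of_real \<alpha> * cis \<theta>)) = cis \<theta>"
    using x(2) by (subst cis_Arg) (auto simp: sgn_mult sgn_of_real)
  then have "cis (of_int k * Arg (fst (\<Phi> (x, \<theta>)))) = cis (of_int k * \<theta>)"
    unfolding x by (intro cis_int_cong) (simp add: \<Phi>_def hypersurface_param_def)
  then show ?thesis using coord_\<Phi>[OF assms] by (simp add: lift_def)
qed

sublocale pt: pair_sigma_finite \<nu> \<tau>
  using sigma_finite_profile sigma_finite_circle_measure by (simp add: pair_sigma_finite_def)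

lemma borel_measurable_mu: "f \<in> borel_measurable \<mu> \<longleftrightarrow> f \<in> borel_measurable (restrict_space borel (hypersurface \<gamma>))"
  using measurable_cong_sets[of \<mu> "restrict_space borel (hypersurface \<gamma>)" borel borel]
  by (simp add: mu_def)

lemma measurable_comp_\<Phi>:
  assumes "f \<in> borel_measurable \<mu>"
  shows "(\<lambda>p. f (\<Phi> p)) \<in> borel_measurable (\<nu> \<Otimes>\<^sub>M \<tau>)"
  using assms measurable_compose[OF \<Phi>_measurable] unfolding borel_measurable_mu by blast

lemma nn_integral_mu:
  assumes "f \<in> borel_measurable \<mu>"
  shows "(\<integral>\<^sup>+z. f z \<partial>\<mu>) = (\<integral>\<^sup>+x. \<integral>\<^sup>+\<theta>. f (\<Phi> (x, \<theta>)) \<partial>\<tau> \<partial>\<nu>)"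
proof -
  have f: "f \<in> borel_measurable (restrict_space borel (hypersurface \<gamma>))" 
    using assms measurable_cong_sets[of \<mu> "restrict_space borel (hypersurface \<gamma>)" borel borel] by (simp add: mu_def)
  have "(\<integral>\<^sup>+z. f z \<partial>\<mu>) = (\<integral>\<^sup>+p. f (\<Phi> p) \<partial>(\<nu> \<Otimes>\<^sub>M \<tau>))"
    unfolding mu_eq_distr using f by (intro nn_integral_distr) auto
  also have "\<dots> = (\<integral>\<^sup>+x. \<integral>\<^sup>+\<theta>. f (\<Phi> (x, \<theta>)) \<partial>\<tau> \<partial>\<nu>)"
    using measurable_compose[OF \<Phi>_measurable f] by (rule pt.M2.nn_integral_fst[symmetric])
  finally show ?thesis .
qed

lemma integral_mu:
  fixes f :: "complex \<times> complex \<Rightarrow> complex"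
  assumes "integrable \<mu> f"
  shows "(\<integral>z. f z \<partial>\<mu>) = (\<integral>x. \<integral>\<theta>. f (\<Phi> (x, \<theta>)) \<partial>\<tau> \<partial>\<nu>)"
proof -
  have f: "f \<in> borel_measurable (restrict_space borel (hypersurface \<gamma>))"
    using borel_measurable_integrable[OF assms] by (simp add: borel_measurable_mu)
  have int: "integrable (\<nu> \<Otimes>\<^sub>M \<tau>) (\<lambda>p. f (\<Phi> p))"
    using assms unfolding mu_eq_distr by (subst (asm) integrable_distr_eq[OF \<Phi>_measurable f])
  have "(\<integral>z. f z \<partial>\<mu>) = (\<integral>p. f (\<Phi> p) \<partial>(\<nu> \<Otimes>\<^sub>M \<tau>))"
    unfolding mu_eq_distr by (rule integral_distr[OF \<Phi>_measurable f])
  also have "\<dots> = (\<integral>x. \<integral>\<theta>. f (\<Phi> (x, \<theta>)) \<partial>\<tau> \<partial>\<nu>)"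
    by (rule pt.integral_fst'[OF int, symmetric])
  finally show ?thesis .
qed

lemma lift_measurable:
  assumes g: "g \<in> borel_measurable borel"
  shows "lift k g \<in> borel_measurable \<mu>"
proof -
  have [measurable]: "(\<lambda>z::complex \<times> complex. fst z) \<in> borel_measurable borel"
    by (intro borel_measurable_continuous_onI continuous_intros)
  have "coord \<in> borel_measurable borel"
    unfolding coord_def by (intro borel_measurable_continuous_onI continuous_intros)
  from measurable_compose[OF this g] have [measurable]: "(\<lambda>z. g (coord z)) \<in> borel_measurable borel" .
  \<comment> \<open>The argument has a jump, but \<open>cis (Arg w)\<close> is a measurable expression in \<open>w\<close>, and so are its integral powers.\<close>
  define u where "u w = (if w = 0 then 1 else sgn w)" for w :: complex
  have u [measurable]: "u \<in> borel_measurable borel"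
    unfolding u_def sgn_div_norm by measurable
  have u_cis: "u w = cis (Arg w)" for w
    by (auto simp: u_def cis_Arg Arg_zero)
  have "cis (of_int k * Arg w) = (if k \<ge> 0 then u w ^ nat k else cnj (u w) ^ nat (- k))" for w
  proof (cases k)
    case (nonneg n)
    then show ?thesis using Complex.DeMoivre[of "Arg w" n] by (simp add: u_cis)
  next
    case (neg n)
    then have "real_of_int k = - real (Suc n)" and nk: "nat (- k) = Suc n" "\<not> k \<ge> 0" by auto
    then have "of_int k * Arg w = real (Suc n) * - Arg w" by (simp only: mult_minus_left mult_minus_right)
    note this nk
    then show ?thesis by (simp only: u_cis cis_cnj Complex.DeMoivre if_False)
  qed
  moreover have "(\<lambda>w. if k \<ge> 0 then u w ^ nat k else cnj (u w) ^ nat (- k)) \<in> borel_measurable borel" by measurable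
  ultimately have [measurable]: "(\<lambda>w. cis (of_int k * Arg w)) \<in> borel_measurable borel" by simp
  have "lift k g \<in> borel_measurable borel" unfolding lift_def by measurable
  then show ?thesis unfolding borel_measurable_mu by (rule measurable_restrict_space1)
qed

lemma lift_L2:
  assumes g: "g \<in> borel_measurable borel" "g \<in> L2 \<nu>"
  shows "lift k g \<in> L2 \<mu>"
proof (rule L2I_bounded)
  show [measurable]: "lift k g \<in> borel_measurable \<mu>" by (rule lift_measurable[OF g(1)])
  have "(\<integral>\<^sup>+z. ennreal ((cmod (lift k g z))\<^sup>2) \<partial>\<mu>) = (\<integral>\<^sup>+x. \<integral>\<^sup>+\<theta>. ennreal ((cmod (g x))\<^sup>2) \<partial>\<tau> \<partial>\<nu>)"
    by (subst nn_integral_mu) (auto intro!: nn_integral_cong simp: lift_\<Phi> norm_mult)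
  also have "\<dots> = (\<integral>\<^sup>+x. ennreal ((cmod (g x))\<^sup>2) * ennreal (2 * pi) \<partial>\<nu>)"
    by (simp add: emeasure_circle_measure[unfolded space_circle_measure])
  also have "\<dots> = (\<integral>\<^sup>+x. ennreal ((cmod (g x))\<^sup>2) \<partial>\<nu>) * ennreal (2 * pi)"
    using L2_measurable[OF g(2)] by (intro nn_integral_multc) auto
  also have "\<dots> < \<infinity>" using L2_nn_integral_finite[OF g(2)] by (simp add: ennreal_mult_less_top)
  finally show "(\<integral>\<^sup>+z. ennreal ((cmod (lift k g z))\<^sup>2) \<partial>\<mu>) < \<infinity>" .
qed

lemma coeff_measurable:
  assumes "f \<in> borel_measurable \<mu>"
  shows "coeff k f \<in> borel_measurable \<nu>"
proof -
  note [measurable] = measurable_comp_\<Phi>[OF assms]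
  have [measurable]: "(\<lambda>\<theta>. cis (- (of_int k * \<theta>))) \<in> borel_measurable \<tau>"
    by (intro circle_measurableI) measurable
  have "(\<lambda>x. 1 / (2 * of_real pi) * (\<integral>\<theta>. f (\<Phi> (x, \<theta>)) * cis (- (of_int k * \<theta>)) \<partial>\<tau>)) \<in> borel_measurable \<nu>"
    by measurable
  then show ?thesis unfolding coeff_eq [symmetric] .
qed

lemma coeff_L2:
  assumes f: "f \<in> L2 \<mu>"
  shows "coeff k f \<in> L2 \<nu>"
proof (rule L2I_bounded)
  show "coeff k f \<in> borel_measurable \<nu>" by (rule coeff_measurable[OF L2_measurable[OF f]])
  note [measurable] = measurable_comp_\<Phi>[OF L2_measurable[OF f]]
  have "ennreal ((cmod (coeff k f x))\<^sup>2) \<le> ennreal (2 * pi) * (\<integral>\<^sup>+\<theta>. ennreal ((cmod (f (\<Phi> (x, \<theta>))))\<^sup>2) \<partial>\<tau>)"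
    if x: "x \<in> space \<nu>" for x
  proof -
    have [measurable]: "(\<lambda>\<theta>. f (\<Phi> (x, \<theta>))) \<in> borel_measurable \<tau>" using x by measurable
    have "cmod (coeff k f x) \<le> cmod (\<integral>\<theta>. f (\<Phi> (x, \<theta>)) * cis (- (of_int k * \<theta>)) \<partial>\<tau>)"
    proof -
      have "1 * cmod (\<integral>\<theta>. f (\<Phi> (x, \<theta>)) * cis (- (of_int k * \<theta>)) \<partial>\<tau>) \<le> 2 * pi * cmod (\<integral>\<theta>. f (\<Phi> (x, \<theta>)) * cis (- (of_int k * \<theta>)) \<partial>\<tau>)"
        using pi_gt3 by (intro mult_right_mono) auto
      then show ?thesis unfolding coeff_eq norm_mult by (simp add: norm_divide field_simps)
    qed
    then have "ennreal (cmod (coeff k f x)) \<le> ennreal (cmod (\<integral>\<theta>. f (\<Phi> (x, \<theta>)) * cis (- (of_int k * \<theta>)) \<partial>\<tau>))"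
      by (rule ennreal_leI)
    also have "\<dots> \<le> (\<integral>\<^sup>+\<theta>. ennreal (cmod (f (\<Phi> (x, \<theta>)))) * 1 \<partial>\<tau>)"
    proof (cases "integrable \<tau> (\<lambda>\<theta>. f (\<Phi> (x, \<theta>)) * cis (- (of_int k * \<theta>)))")
      case True
      from integral_norm_bound_ennreal[OF True] show ?thesis by (simp add: norm_mult)
    qed (simp add: not_integrable_integral_eq)
    finally have "(ennreal (cmod (coeff k f x)))\<^sup>2 \<le> (\<integral>\<^sup>+\<theta>. ennreal (cmod (f (\<Phi> (x, \<theta>)))) * 1 \<partial>\<tau>)\<^sup>2"
      by (rule power_mono) simp
    also have "\<dots> \<le> (\<integral>\<^sup>+\<theta>. (ennreal (cmod (f (\<Phi> (x, \<theta>)))))\<^sup>2 \<partial>\<tau>) * (\<integral>\<^sup>+\<theta>. 1\<^sup>2 \<partial>\<tau>)"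
      by (rule Cauchy_Schwarz_nn_integral) measurable
    also have "(\<integral>\<^sup>+\<theta>. 1\<^sup>2 \<partial>\<tau>) = ennreal (2 * pi)"
      by (simp add: emeasure_circle_measure[unfolded space_circle_measure])
    finally show ?thesis by (simp add: ennreal_power mult.commute)
  qed
  then have "(\<integral>\<^sup>+x. ennreal ((cmod (coeff k f x))\<^sup>2) \<partial>\<nu>)
      \<le> (\<integral>\<^sup>+x. ennreal (2 * pi) * (\<integral>\<^sup>+\<theta>. ennreal ((cmod (f (\<Phi> (x, \<theta>))))\<^sup>2) \<partial>\<tau>) \<partial>\<nu>)"
    by (intro nn_integral_mono)
  also have "\<dots> = ennreal (2 * pi) * (\<integral>\<^sup>+x. \<integral>\<^sup>+\<theta>. ennreal ((cmod (f (\<Phi> (x, \<theta>))))\<^sup>2) \<partial>\<tau> \<partial>\<nu>)"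
    by (intro nn_integral_cmult pt.M2.borel_measurable_nn_integral) measurable
  also have "\<dots> = ennreal (2 * pi) * (\<integral>\<^sup>+z. ennreal ((cmod (f z))\<^sup>2) \<partial>\<mu>)"
    using L2_measurable[OF f] by (subst nn_integral_mu) auto
  also have "\<dots> < \<infinity>" using L2_nn_integral_finite[OF f] by (simp add: ennreal_mult_less_top)
  finally show "(\<integral>\<^sup>+x. ennreal ((cmod (coeff k f x))\<^sup>2) \<partial>\<nu>) < \<infinity>" .
qed

text \<open>Up to the factor \<open>2 \<pi>\<close>, taking Fourier coefficients is adjoint to \<open>lift\<close>.\<close>

lemma inner_lift:
  assumes g: "g \<in> borel_measurable borel" "g \<in> L2 \<nu>" and f: "f \<in> L2 \<mu>"
  shows "l2_inner \<mu> (lift k g) f = 2 * of_real pi * l2_inner \<nu> g (coeff k f)"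
proof -
  have "l2_inner \<mu> (lift k g) f = (\<integral>x. \<integral>\<theta>. lift k g (\<Phi> (x, \<theta>)) * cnj (f (\<Phi> (x, \<theta>))) \<partial>\<tau> \<partial>\<nu>)"
    unfolding l2_inner_def by (rule integral_mu[OF L2_integrable_mult[OF lift_L2[OF g] f]])
  also have "\<dots> = (\<integral>x. 2 * of_real pi * (g x * cnj (coeff k f x)) \<partial>\<nu>)"
  proof (rule Bochner_Integration.integral_cong[OF refl])
    fix x assume x: "x \<in> space \<nu>"
    have "(\<integral>\<theta>. lift k g (\<Phi> (x, \<theta>)) * cnj (f (\<Phi> (x, \<theta>))) \<partial>\<tau>)
        = (\<integral>\<theta>. g x * cnj (f (\<Phi> (x, \<theta>)) * cis (- (of_int k * \<theta>))) \<partial>\<tau>)"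
      using x by (intro Bochner_Integration.integral_cong) (simp_all add: lift_\<Phi> cis_cnj mult_ac)
    also have "\<dots> = g x * cnj (\<integral>\<theta>. f (\<Phi> (x, \<theta>)) * cis (- (of_int k * \<theta>)) \<partial>\<tau>)"
      by (simp only: integral_mult_right_zero Bochner_Integration.integral_cnj)
    also have "\<dots> = 2 * of_real pi * (g x * cnj (coeff k f x))"
      by (simp add: coeff_eq)
    finally show "(\<integral>\<theta>. lift k g (\<Phi> (x, \<theta>)) * cnj (f (\<Phi> (x, \<theta>))) \<partial>\<tau>) = 2 * of_real pi * (g x * cnj (coeff k f x))" .
  qed
  finally show ?thesis unfolding l2_inner_def by simp
qed

lemma coeff_lift:
  assumes x: "x \<in> space \<nu>"
  shows "coeff j (lift k g) x = (if j = k then g x else 0)"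
proof -
  have "(\<integral>\<theta>. lift k g (\<Phi> (x, \<theta>)) * cis (- (of_int j * \<theta>)) \<partial>\<tau>) = (\<integral>\<theta>. g x * cis (of_int (k - j) * \<theta>) \<partial>\<tau>)"
    using x by (intro Bochner_Integration.integral_cong) (simp_all add: lift_\<Phi> cis_mult mult_ac algebra_simps)
  also have "\<dots> = g x * (if k - j = 0 then 2 * of_real pi else 0)"
    unfolding integral_mult_right_zero integral_cis_circle ..
  finally show ?thesis unfolding coeff_eq by simp
qed

subsection \<open>The modes of the Leray transform\<close>

text \<open>
  The iterated integral agrees with the integral operator almost everywhere; only the former is
  defined by the same formula as the modes of the transform at every point.
\<close>

definition mode_op :: "nat \<Rightarrow> (real \<times> real \<Rightarrow> complex) \<Rightarrow> real \<times> real \<Rightarrow> complex" where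
  "mode_op k g z = (\<integral>\<beta>. \<integral>t. mode_kernel k z (\<beta>, t) * g (\<beta>, t) \<partial>lborel \<partial>\<rho>)"

lemma mode_kernel_borel_product:
  "case_prod (mode_kernel k) \<in> borel_measurable (borel \<Otimes>\<^sub>M \<nu>)"
  "case_prod (kernel_adjoint (mode_kernel k)) \<in> borel_measurable (borel \<Otimes>\<^sub>M \<nu>)"
proof -
  have id: "(\<lambda>x. x) \<in> borel \<Otimes>\<^sub>M \<nu> \<rightarrow>\<^sub>M (borel :: ((real \<times> real) \<times> (real \<times> real)) measure)"
  proof -
    have "(\<lambda>x. (fst x, snd x)) \<in> (borel :: (real \<times> real) measure) \<Otimes>\<^sub>M \<nu> \<rightarrow>\<^sub>M borel \<Otimes>\<^sub>M borel"
      by (intro measurable_Pair measurable_fst measurable_compose[OF measurable_snd profile_id_measurable])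
    then show ?thesis by (simp add: borel_prod)
  qed
  have adj: "(\<lambda>p. kernel_adjoint (mode_kernel k) (fst p) (snd p)) \<in> borel_measurable borel"
  proof -
    have "(\<lambda>p::(real \<times> real) \<times> (real \<times> real). (snd p, fst p)) \<in> borel_measurable borel"
      by (intro borel_measurable_continuous_onI continuous_intros)
    from measurable_compose[OF this mode_kernel_borel] show ?thesis
      unfolding kernel_adjoint_def by simp
  qed
  from measurable_compose[OF id mode_kernel_borel] measurable_compose[OF id adj]
  show "case_prod (mode_kernel k) \<in> borel_measurable (borel \<Otimes>\<^sub>M \<nu>)"
    "case_prod (kernel_adjoint (mode_kernel k)) \<in> borel_measurable (borel \<Otimes>\<^sub>M \<nu>)"
    by (simp_all add: split_def)
qed

lemma mode_op_borel:
  assumes "g \<in> borel_measurable \<nu>"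
  shows "mode_op k g \<in> borel_measurable borel"
proof -
  note [measurable] = mode_kernel_borel_product(1)[of k, unfolded profile_measure_def] assms[unfolded profile_measure_def]
  show ?thesis unfolding mode_op_def by measurable
qed

lemma adjoint_op_borel:
  assumes "g \<in> borel_measurable \<nu>"
  shows "kernel_op \<nu> (kernel_adjoint (mode_kernel k)) g \<in> borel_measurable borel"
proof -
  note [measurable] = mode_kernel_borel_product(2)[of k] assms
  show ?thesis unfolding kernel_op_def by measurable
qed

lemma mode_op_AE:
  assumes g: "g \<in> L2 \<nu>"
  shows "AE z in \<nu>. mode_op k g z = kernel_op \<nu> (mode_kernel k) g z"
proof -
  obtain B where B: "schur_kernel (mode_kernel k) B" using mode_kernel_schur by blast
  show ?thesis
    using kernel_op_integrable_AE[OF B g]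
  proof eventually_elim
    case (elim z)
    show ?case
      unfolding mode_op_def kernel_op_def profile_measure_def
      using profile.integral_fst'[OF elim[unfolded profile_measure_def]] by simp
  qed
qed

lemma mode_op_L2:
  assumes g: "g \<in> L2 \<nu>"
  shows "mode_op k g \<in> L2 \<nu>"
proof -
  obtain B where B: "schur_kernel (mode_kernel k) B" using mode_kernel_schur by blast
  show ?thesis
  proof (rule L2I_bounded)
    show "mode_op k g \<in> borel_measurable \<nu>"
      by (rule profile_measurableI[OF mode_op_borel[OF L2_measurable[OF g]]])
    have "(\<integral>\<^sup>+x. ennreal ((cmod (mode_op k g x))\<^sup>2) \<partial>\<nu>)
        = (\<integral>\<^sup>+x. ennreal ((cmod (kernel_op \<nu> (mode_kernel k) g x))\<^sup>2) \<partial>\<nu>)"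
      by (rule nn_integral_cong_AE) (use mode_op_AE[OF g, of k] in \<open>eventually_elim; simp\<close>)
    also have "\<dots> < \<infinity>" by (rule L2_nn_integral_finite[OF kernel_op_L2[OF B g]])
    finally show "(\<integral>\<^sup>+x. ennreal ((cmod (mode_op k g x))\<^sup>2) \<partial>\<nu>) < \<infinity>" .
  qed
qed

text \<open>
  The factors \<open>B\<^sup>k \<alpha>\<^bsup>\<gamma> - 1\<^esup>\<close> in the definition of the mode contribute \<open>\<beta>\<close> to the power
  \<open>(\<gamma> - 1) (k + 1)\<close>, which is \<open>expo k + r\<close>.
\<close>

lemma leray_mode_eq:
  assumes f: "f \<in> borel_measurable \<mu>"
  shows "leray_mode \<gamma> k f = lift (int k) (mode_op k (coeff (int k) f))"
proof
  fix z
  define a s where "a = cmod (fst z)" and "s = Re (snd z)"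
  define c where "c = \<gamma>\<^sup>2 * (real k + 1) / (2 * pi)"
  define J where "J \<beta> = (\<integral>t. 1 / Complex (a powr \<gamma> + (\<gamma> - 1) * \<beta> powr \<gamma>) (t - s) ^ (k + 2) * coeff (int k) f (\<beta>, t) \<partial>lborel)" for \<beta>
  have inner1: "(\<integral>t. mode_kernel k (a, s) (\<beta>, t) * coeff (int k) f (\<beta>, t) \<partial>lborel)
      = of_real (normalization k * a ^ k * \<beta> powr expo k) * J \<beta>" for \<beta>
    unfolding J_def integral_mult_right_zero[symmetric]
    by (intro Bochner_Integration.integral_cong refl) (simp add: mode_kernel_def)
  have inner2: "(LBINT t. of_real (\<gamma> * a * \<beta> powr (\<gamma> - 1)) ^ k / Complex ((\<gamma> - 1) * \<beta> powr \<gamma> + a powr \<gamma>) (t - s) ^ (k + 2)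
        * fourier_coeff \<gamma> f (int k) t \<beta> * of_real (\<beta> powr (\<gamma> - 1)))
      = of_real ((\<gamma> * a * \<beta> powr (\<gamma> - 1)) ^ k * \<beta> powr (\<gamma> - 1)) * J \<beta>" for \<beta>
    unfolding J_def integral_mult_right_zero[symmetric]
    by (intro Bochner_Integration.integral_cong refl) (simp add: coeff_def add.commute)
  have "mode_op k (coeff (int k) f) (a, s)
      = (\<integral>\<beta>. of_real (normalization k * a ^ k * \<beta> powr expo k) * J \<beta> \<partial>\<rho>)"
    unfolding mode_op_def inner1 ..
  also have "\<dots> = (\<integral>\<beta>. \<beta> powr r *\<^sub>R (of_real (normalization k * a ^ k * \<beta> powr expo k) * J \<beta>) \<partial>half_line)"
    unfolding radial_measure_def
  proof (rule integral_density)
    have "(\<lambda>\<beta>. \<integral>t. mode_kernel k (a, s) (\<beta>, t) * coeff (int k) f (\<beta>, t) \<partial>lborel) \<in> borel_measurable \<rho>"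
    proof -
      note [measurable] = coeff_measurable[OF f, of "int k", unfolded profile_measure_def]
      have "mode_kernel k (a, s) \<in> borel_measurable \<nu>"
        using mode_kernel_borel_product(1)[of k] by measurable
      then have [measurable]: "mode_kernel k (a, s) \<in> borel_measurable (\<rho> \<Otimes>\<^sub>M lborel)"
        by (simp add: profile_measure_def)
      show ?thesis by measurable
    qed
    then show "(\<lambda>\<beta>. of_real (normalization k * a ^ k * \<beta> powr expo k) * J \<beta>) \<in> borel_measurable half_line"
      unfolding inner1 by (simp add: radial_measure_def)
  qed auto
  also have "\<dots> = (LBINT \<beta>:{0<..}. of_real c * (of_real ((\<gamma> * a * \<beta> powr (\<gamma> - 1)) ^ k * \<beta> powr (\<gamma> - 1)) * J \<beta>))"
    unfolding integral_half_line
  proof (rule set_lebesgue_integral_cong)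
    show "\<forall>\<beta>. \<beta> \<in> {0<..} \<longrightarrow> \<beta> powr r *\<^sub>R (of_real (normalization k * a ^ k * \<beta> powr expo k) * J \<beta>)
        = of_real c * (of_real ((\<gamma> * a * \<beta> powr (\<gamma> - 1)) ^ k * \<beta> powr (\<gamma> - 1)) * J \<beta>)"
    proof (intro allI impI)
      fix \<beta> :: real assume "\<beta> \<in> {0<..}"
      then have \<beta>: "\<beta> > 0" by simp
      have p: "\<beta> powr r * \<beta> powr expo k = (\<beta> powr (\<gamma> - 1)) ^ k * \<beta> powr (\<gamma> - 1)"
      proof -
        have "(\<beta> powr (\<gamma> - 1)) ^ k * \<beta> powr (\<gamma> - 1) = \<beta> powr ((\<gamma> - 1) * real k) * \<beta> powr (\<gamma> - 1)"
          using \<beta> by (simp add: powr_powr[symmetric] powr_realpow)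
        then show ?thesis by (simp add: powr_add[symmetric] expo_def algebra_simps)
      qed
      have "\<beta> powr r * (normalization k * a ^ k * \<beta> powr expo k) = c * ((\<gamma> * a * \<beta> powr (\<gamma> - 1)) ^ k * \<beta> powr (\<gamma> - 1))"
      proof -
        have nrm: "normalization k = c * \<gamma> ^ k"
          by (simp add: normalization_def c_def power_add power2_eq_square)
        have "\<beta> powr r * (normalization k * a ^ k * \<beta> powr expo k) = c * \<gamma> ^ k * a ^ k * (\<beta> powr r * \<beta> powr expo k)"
          unfolding nrm by simp
        also have "\<dots> = c * ((\<gamma> * a * \<beta> powr (\<gamma> - 1)) ^ k * \<beta> powr (\<gamma> - 1))"
          unfolding p by (simp add: power_mult_distrib)
        finally show ?thesis .
      qed
      from arg_cong[OF this, of "\<lambda>x. of_real x * J \<beta>"]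
      show "\<beta> powr r *\<^sub>R (of_real (normalization k * a ^ k * \<beta> powr expo k) * J \<beta>)
        = of_real c * (of_real ((\<gamma> * a * \<beta> powr (\<gamma> - 1)) ^ k * \<beta> powr (\<gamma> - 1)) * J \<beta>)"
        by (simp only: scaleR_conv_of_real of_real_mult mult.assoc)
    qed
  qed simp
  also have "\<dots> = of_real c * (LBINT \<beta>:{0<..}. of_real ((\<gamma> * a * \<beta> powr (\<gamma> - 1)) ^ k * \<beta> powr (\<gamma> - 1)) * J \<beta>)"
    by (rule set_integral_mult_right)
  finally have "mode_op k (coeff (int k) f) (a, s)
      = of_real c * (LBINT \<beta>:{0<..}. of_real ((\<gamma> * a * \<beta> powr (\<gamma> - 1)) ^ k * \<beta> powr (\<gamma> - 1)) * J \<beta>)" .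
  then show "leray_mode \<gamma> k f z = lift (int k) (mode_op k (coeff (int k) f)) z"
    unfolding leray_mode_def Let_def lift_def coord_def a_def[symmetric] s_def[symmetric] c_def[symmetric] inner2
    by simp
qed


definition adjoint_mode :: "nat \<Rightarrow> (complex \<times> complex \<Rightarrow> complex) \<Rightarrow> complex \<times> complex \<Rightarrow> complex" where
  "adjoint_mode k f = lift (int k) (kernel_op \<nu> (kernel_adjoint (mode_kernel k)) (coeff (int k) f))"

lemma adjoint_op_L2:
  assumes "g \<in> L2 \<nu>"
  shows "kernel_op \<nu> (kernel_adjoint (mode_kernel k)) g \<in> L2 \<nu>"
  using mode_kernel_schur[of k] schur_kernel_adjoint kernel_op_L2 assms by blast

lemma leray_mode_L2:
  assumes "f \<in> L2 \<mu>"
  shows "leray_mode \<gamma> k f \<in> L2 \<mu>"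
  unfolding leray_mode_eq[OF L2_measurable[OF assms]]
  by (intro lift_L2 mode_op_borel mode_op_L2 coeff_L2 coeff_measurable L2_measurable assms)

lemma adjoint_mode_L2:
  assumes "f \<in> L2 \<mu>"
  shows "adjoint_mode k f \<in> L2 \<mu>"
  unfolding adjoint_mode_def
  by (intro lift_L2 adjoint_op_borel adjoint_op_L2 coeff_L2 coeff_measurable L2_measurable assms)

lemma inner_leray_mode:
  assumes f: "f \<in> L2 \<mu>" and g: "g \<in> L2 \<mu>"
  shows "l2_inner \<mu> (leray_mode \<gamma> k f) g
    = 2 * of_real pi * l2_inner \<nu> (kernel_op \<nu> (mode_kernel k) (coeff (int k) f)) (coeff (int k) g)"
proof -
  obtain B where B: "schur_kernel (mode_kernel k) B" using mode_kernel_schur by blast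
  note cf = coeff_L2[OF f, of "int k"] and cg = coeff_L2[OF g, of "int k"]
  have "l2_inner \<mu> (leray_mode \<gamma> k f) g
      = 2 * of_real pi * l2_inner \<nu> (mode_op k (coeff (int k) f)) (coeff (int k) g)"
    unfolding leray_mode_eq[OF L2_measurable[OF f]]
    by (intro inner_lift mode_op_borel mode_op_L2 cf L2_measurable[OF cf] g)
  also have "l2_inner \<nu> (mode_op k (coeff (int k) f)) (coeff (int k) g)
      = l2_inner \<nu> (kernel_op \<nu> (mode_kernel k) (coeff (int k) f)) (coeff (int k) g)"
    by (intro l2_inner_cong_AE mode_op_L2 kernel_op_L2[OF B] cf cg mode_op_AE) simp
  finally show ?thesis .
qed

lemma inner_adjoint_mode:
  assumes f: "f \<in> L2 \<mu>" and g: "g \<in> L2 \<mu>"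
  shows "l2_inner \<mu> (adjoint_mode k f) g
    = 2 * of_real pi * l2_inner \<nu> (kernel_op \<nu> (kernel_adjoint (mode_kernel k)) (coeff (int k) f)) (coeff (int k) g)"
  unfolding adjoint_mode_def
  by (intro inner_lift adjoint_op_borel adjoint_op_L2 coeff_L2 coeff_measurable L2_measurable f g)

lemma coeff_leray_mode:
  assumes "f \<in> L2 \<mu>" "x \<in> space \<nu>"
  shows "coeff (int j) (leray_mode \<gamma> k f) x = (if j = k then mode_op k (coeff (int k) f) x else 0)"
  unfolding leray_mode_eq[OF L2_measurable[OF assms(1)]] coeff_lift[OF assms(2)] by simp

lemma coeff_adjoint_mode:
  assumes "x \<in> space \<nu>"
  shows "coeff (int j) (adjoint_mode k f) x
    = (if j = k then kernel_op \<nu> (kernel_adjoint (mode_kernel k)) (coeff (int k) f) x else 0)"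
  unfolding adjoint_mode_def coeff_lift[OF assms] by simp

lemma kernel_op_cong_space:
  "(\<And>x. x \<in> space \<nu> \<Longrightarrow> f x = g x) \<Longrightarrow> kernel_op \<nu> K f = kernel_op \<nu> K g"
  unfolding kernel_op_def by (intro ext Bochner_Integration.integral_cong) auto

lemma l2_inner_cong_space:
  "\<lbrakk>\<And>x. x \<in> space M \<Longrightarrow> f x = f' x; \<And>x. x \<in> space M \<Longrightarrow> g x = g' x\<rbrakk> \<Longrightarrow> l2_inner M f g = l2_inner M f' g'"
  unfolding l2_inner_def by (intro Bochner_Integration.integral_cong) auto

text \<open>
  A column of the kernel is a fixed point of the operator, by the idempotence of the kernel. It shows that
  no mode vanishes.
\<close>

definition test_profile :: "nat \<Rightarrow> real \<times> real \<Rightarrow> complex" where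
  "test_profile k z = mode_kernel k z (1, 0)"

lemma test_profile_borel: "test_profile k \<in> borel_measurable borel"
proof -
  have [measurable]: "(fst :: real \<times> real \<Rightarrow> real) \<in> borel_measurable borel" "(snd :: real \<times> real \<Rightarrow> real) \<in> borel_measurable borel"
    by (auto intro!: borel_measurable_continuous_onI continuous_intros)
  show ?thesis unfolding test_profile_def mode_kernel_def Complex_eq fst_conv snd_conv by measurable
qed

lemma test_profile_L2: "test_profile k \<in> L2 \<nu>"
proof (rule L2I_bounded)
  define n where "n = normalization k"
  have n: "n > 0" using normalization_pos by (simp add: n_def)
  show meas: "test_profile k \<in> borel_measurable \<nu>" by (rule profile_measurableI[OF test_profile_borel])
  define N where "N = real (2 * k + 3)"
  have b: "2 * real k + r + 1 > 0" using r_gt by simp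
  have bN: "(2 * real k + r + 1) / \<gamma> < N"
  proof -
    have "2 * real k * 1 \<le> 2 * real k * \<gamma>" using \<gamma> by (intro mult_left_mono) auto
    then have "2 * real k + r + 1 < \<gamma> * N" using r_lt \<gamma> by (simp add: N_def algebra_simps)
    then show ?thesis using \<gamma> by (simp add: field_simps)
  qed
  obtain c where c: "c \<ge> 0" "\<And>X. X > 0 \<Longrightarrow>
    (\<integral>\<^sup>+x. ennreal (x powr (2 * real k) * (X + 1 * x powr \<gamma>) powr (- N)) \<partial>\<rho>)
      = ennreal (c * X powr ((2 * real k + r + 1) / \<gamma> - N))"
    using radial_inverse_power[OF b _ _ bN, of 1] \<gamma> by auto
  have "(\<integral>\<^sup>+z. ennreal ((cmod (test_profile k z))\<^sup>2) \<partial>\<nu>)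
      = (\<integral>\<^sup>+\<alpha>. \<integral>\<^sup>+s. ennreal ((cmod (test_profile k (\<alpha>, s)))\<^sup>2) \<partial>lborel \<partial>\<rho>)"
    using meas by (intro nn_integral_profile) measurable
  also have "\<dots> \<le> (\<integral>\<^sup>+\<alpha>. ennreal (n\<^sup>2 * pi) * ennreal (\<alpha> powr (2 * real k) * ((\<gamma> - 1) + 1 * \<alpha> powr \<gamma>) powr (- N)) \<partial>\<rho>)"
  proof (rule nn_integral_mono)
    fix \<alpha> assume "\<alpha> \<in> space \<rho>"
    then have \<alpha>: "\<alpha> > 0" by simp
    define a where "a = \<alpha> powr \<gamma> + (\<gamma> - 1)"
    have a: "a > 0" unfolding a_def using \<alpha> \<gamma> by (intro add_pos_pos) auto
    have "(cmod (test_profile k (\<alpha>, s)))\<^sup>2 = n\<^sup>2 * \<alpha> powr (2 * real k) * (1 / cmod (Complex a (s - 0)) ^ (2 * k + 2 + 2))" for s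
    proof -
      have "cmod (Complex a (0 - s)) = cmod (Complex a (s - 0))" by (simp add: cmod_def)
      then have "cmod (test_profile k (\<alpha>, s)) = n * \<alpha> ^ k * (1 / cmod (Complex a (s - 0)) ^ (k + 2))"
        unfolding test_profile_def using norm_mode_kernel[OF \<alpha>, of 1 k s 0] by (simp add: a_def n_def)
      moreover have "\<alpha> powr (2 * real k) = (\<alpha> ^ k)\<^sup>2"
        using powr_realpow[OF \<alpha>, of "k * 2"] by (simp add: power_mult mult.commute)
      moreover have "cmod (Complex a (s - 0)) ^ (2 * k + 2 + 2) = (cmod (Complex a (s - 0)) ^ (k + 2))\<^sup>2"
        unfolding power_mult[symmetric] by (rule arg_cong[where f = "\<lambda>n. _ ^ n"]) simp
      ultimately show ?thesis by (simp only: power_mult_distrib power_one_over)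
    qed
    then have "(\<integral>\<^sup>+s. ennreal ((cmod (test_profile k (\<alpha>, s)))\<^sup>2) \<partial>lborel)
        = (\<integral>\<^sup>+s. ennreal (n\<^sup>2 * \<alpha> powr (2 * real k)) * ennreal (1 / cmod (Complex a (s - 0)) ^ (2 * k + 2 + 2)) \<partial>lborel)"
      by (simp only: ennreal_mult'[OF mult_nonneg_nonneg[OF zero_le_power2 powr_ge_zero]])
    also have "\<dots> = ennreal (n\<^sup>2 * \<alpha> powr (2 * real k)) * (\<integral>\<^sup>+s. ennreal (1 / cmod (Complex a (s - 0)) ^ (2 * k + 2 + 2)) \<partial>lborel)"
      by (rule nn_integral_cmult) (simp add: Complex_eq)
    also have "\<dots> \<le> ennreal (n\<^sup>2 * \<alpha> powr (2 * real k)) * ennreal (pi * a powr (- real (2 * k + 2 + 1)))"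
      by (intro mult_left_mono nn_integral_line_power_le a) auto
    also have "\<dots> = ennreal (n\<^sup>2 * pi) * ennreal (\<alpha> powr (2 * real k) * a powr (- N))"
      unfolding N_def by (simp add: ennreal_mult[symmetric] mult_ac numeral_3_eq_3)
    finally show "(\<integral>\<^sup>+s. ennreal ((cmod (test_profile k (\<alpha>, s)))\<^sup>2) \<partial>lborel)
        \<le> ennreal (n\<^sup>2 * pi) * ennreal (\<alpha> powr (2 * real k) * ((\<gamma> - 1) + 1 * \<alpha> powr \<gamma>) powr (- N))"
      unfolding a_def by (simp add: add.commute)
  qed
  also have "\<dots> = ennreal (n\<^sup>2 * pi) * ennreal (c * (\<gamma> - 1) powr ((2 * real k + r + 1) / \<gamma> - N))"
    using \<gamma> c(2)[of "\<gamma> - 1"] by (subst nn_integral_cmult) (auto intro!: radial_measurableI)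
  also have "\<dots> < \<infinity>" by (simp add: ennreal_mult_less_top)
  finally show "(\<integral>\<^sup>+z. ennreal ((cmod (test_profile k z))\<^sup>2) \<partial>\<nu>) < \<infinity>" .
qed

lemma test_profile_fixed:
  "AE z in \<nu>. kernel_op \<nu> (mode_kernel k) (test_profile k) z = test_profile k z"
proof -
  obtain B where B: "schur_kernel (mode_kernel k) B" using mode_kernel_schur by blast
  show ?thesis
    using kernel_op_integrable_AE[OF B test_profile_L2[of k]] AE_space
  proof eventually_elim
    case (elim z)
    then show ?case
      using mode_kernel_idempotent[OF elim(2), of "(1, 0)" k]
      unfolding kernel_op_def test_profile_def by (simp add: space_profile_measure)
  qed
qed

lemma l2_norm_test_profile: "l2_norm \<nu> (test_profile k) \<noteq> 0"
proof
  assume "l2_norm \<nu> (test_profile k) = 0"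
  then have "AE z in \<nu>. test_profile k z = 0" using l2_norm_eq_0_iff[OF test_profile_L2] by blast
  then have "AE z in \<nu>. False"
    using AE_space
  proof eventually_elim
    case (elim z)
    then obtain \<alpha> s where z: "z = (\<alpha>, s)" "\<alpha> > 0" by (auto simp: space_profile_measure)
    have "Complex (\<alpha> powr \<gamma> + (\<gamma> - 1)) (- s) \<noteq> 0"
      using z(2) \<gamma> by (intro Complex_nonzero add_pos_pos) auto
    then have "test_profile k z \<noteq> 0"
      using z normalization_pos[of k] by (simp add: test_profile_def mode_kernel_def)
    with elim(1) show ?case by blast
  qed
  then have "emeasure \<nu> (space \<nu>) = 0" by (simp add: AE_iff_null null_sets_def)
  then have "emeasure \<rho> {0<..} * emeasure lborel (UNIV :: real set) = 0"
    unfolding space_profile_measure unfolding profile_measure_def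
    by (subst (asm) lborel.emeasure_pair_measure_Times) (auto simp: sets.top[of \<rho>, simplified])
  then have "emeasure \<rho> (space \<rho>) = 0" by simp
  then have "AE x in \<rho>. False"
    using sets.top[of \<rho>] by (intro AE_I[of _ _ "space \<rho>"]) auto
  then have "(\<integral>\<^sup>+x. ennreal (x powr 0 * exp (- (1 * x powr \<gamma>))) \<partial>\<rho>) = (\<integral>\<^sup>+x. 0 \<partial>\<rho>)"
    by (intro nn_integral_cong_AE) (auto elim: eventually_mono)
  then have "(\<integral>\<^sup>+x. ennreal (x powr 0 * exp (- (1 * x powr \<gamma>))) \<partial>\<rho>) = 0" by simp
  moreover have "(\<integral>\<^sup>+x. ennreal (x powr 0 * exp (- (1 * x powr \<gamma>))) \<partial>\<rho>)
      = ennreal (Gamma ((0 + r + 1) / \<gamma>) / \<gamma> * 1 powr (- ((0 + r + 1) / \<gamma>)))"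
    using r_gt \<gamma> by (intro radial_Laplace) auto
  moreover have "Gamma ((0 + r + 1) / \<gamma>) > 0" using r_gt \<gamma> by (intro Gamma_real_pos divide_pos_pos) auto
  ultimately have "Gamma ((0 + r + 1) / \<gamma>) / \<gamma> \<le> 0" by (simp add: ennreal_eq_0_iff)
  with \<open>Gamma ((0 + r + 1) / \<gamma>) > 0\<close> \<gamma> show False by (simp add: divide_le_0_iff)
qed


text \<open>
  By \<open>inner_lift\<close> and \<open>coeff_lift\<close> every identity between the modes reduces to one for the integral
  operators with the kernels \<open>mode_kernel k\<close>, and modes with different \<open>k\<close> are orthogonal. The Fourier modes with negative
  index lie in the common kernel.
\<close>

lemma leray_modes_oblique_projections:
  assumes K: "\<And>k. leray_C r \<gamma> k \<le> K"
  shows "oblique_projections \<mu> (leray_mode \<gamma>) adjoint_mode (leray_C r \<gamma>) K"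
proof unfold_locales
  fix f g k assume f: "f \<in> L2 \<mu>" and g: "g \<in> L2 \<mu>"
  obtain B where B: "schur_kernel (mode_kernel k) B" using mode_kernel_schur by blast
  define T T' where "T = kernel_op \<nu> (mode_kernel k)" and "T' = kernel_op \<nu> (kernel_adjoint (mode_kernel k))"
  note cf = coeff_L2[OF f, of "int k"] and cg = coeff_L2[OF g, of "int k"]
  have T: "T u \<in> L2 \<nu>" and T': "T' u \<in> L2 \<nu>" if "u \<in> L2 \<nu>" for u
    unfolding T_def T'_def using that kernel_op_L2[OF B] adjoint_op_L2 by auto
  have op_T: "AE x in \<nu>. mode_op k u x = T u x" if "u \<in> L2 \<nu>" for u
    unfolding T_def by (rule mode_op_AE[OF that])
  have T_cong: "T u x = T v x" if "u \<in> L2 \<nu>" "v \<in> L2 \<nu>" "AE x in \<nu>. u x = v x" "x \<in> space \<nu>" for u v x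
    unfolding T_def using that by (intro kernel_op_cong_AE[OF B]) (auto intro: L2_measurable)
  show "l2_inner \<mu> (leray_mode \<gamma> k f) g = l2_inner \<mu> f (adjoint_mode k g)"
  proof -
    have "l2_inner \<mu> (leray_mode \<gamma> k f) g = 2 * of_real pi * l2_inner \<nu> (coeff (int k) f) (T' (coeff (int k) g))"
      unfolding inner_leray_mode[OF f g] T'_def kernel_op_adjoint[OF B cf cg] ..
    also have "\<dots> = cnj (2 * of_real pi * l2_inner \<nu> (T' (coeff (int k) g)) (coeff (int k) f))"
      by (simp add: l2_inner_cnj)
    also have "\<dots> = l2_inner \<mu> f (adjoint_mode k g)"
      unfolding T'_def inner_adjoint_mode[OF g f, symmetric] by (rule l2_inner_cnj)
    finally show ?thesis .
  qed
  show "l2_inner \<mu> (leray_mode \<gamma> k (leray_mode \<gamma> k f)) g = l2_inner \<mu> (leray_mode \<gamma> k f) g"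
  proof -
    have "T (coeff (int k) (leray_mode \<gamma> k f)) = T (mode_op k (coeff (int k) f))"
      unfolding T_def by (rule kernel_op_cong_space) (simp add: coeff_leray_mode[OF f])
    moreover have idem: "AE x in \<nu>. T (T (coeff (int k) f)) x = T (coeff (int k) f) x"
      unfolding T_def by (rule kernel_op_idempotent[OF B cf]) (rule mode_kernel_idempotent)
    moreover have "AE x in \<nu>. T (mode_op k (coeff (int k) f)) x = T (coeff (int k) f) x"
      using idem AE_space
    proof eventually_elim
      case (elim x)
      have "T (mode_op k (coeff (int k) f)) x = T (T (coeff (int k) f)) x"
        by (rule T_cong[OF mode_op_L2[OF cf] T[OF cf] op_T[OF cf] elim(2)])
      with elim(1) show ?case by simp
    qed
    ultimately have "l2_inner \<nu> (T (coeff (int k) (leray_mode \<gamma> k f))) (coeff (int k) g)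
        = l2_inner \<nu> (T (coeff (int k) f)) (coeff (int k) g)"
      by (intro l2_inner_cong_AE T cf cg coeff_L2 leray_mode_L2 f) simp_all
    then show ?thesis
      unfolding inner_leray_mode[OF f g] inner_leray_mode[OF leray_mode_L2[OF f] g] T_def by simp
  qed
  show "l2_inner \<mu> (leray_mode \<gamma> k (adjoint_mode k (leray_mode \<gamma> k f))) g
      = of_real (leray_C r \<gamma> k) * l2_inner \<mu> (leray_mode \<gamma> k f) g"
  proof -
    let ?u = "coeff (int k) f"
    have 1: "T (coeff (int k) (adjoint_mode k (leray_mode \<gamma> k f))) = T (T' (coeff (int k) (leray_mode \<gamma> k f)))"
      unfolding T_def T'_def by (rule kernel_op_cong_space) (simp add: coeff_adjoint_mode)
    have 2: "T' (coeff (int k) (leray_mode \<gamma> k f)) = T' (mode_op k ?u)"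
      unfolding T'_def by (rule kernel_op_cong_space) (simp add: coeff_leray_mode[OF f])
    have 3: "T' (mode_op k ?u) x = T' (T ?u) x" if "x \<in> space \<nu>" for x
      unfolding T'_def using that op_T[OF cf]
      by (intro kernel_op_cong_AE[OF schur_kernel_adjoint[OF B]] L2_measurable mode_op_L2 cf T)
    have "T (T' (mode_op k ?u)) = T (T' (T ?u))"
      unfolding T_def[of] by (rule kernel_op_cong_space) (rule 3[unfolded T_def])
    then have "AE x in \<nu>. T (coeff (int k) (adjoint_mode k (leray_mode \<gamma> k f))) x = of_real (leray_C r \<gamma> k) * T ?u x"
      unfolding 1 2 \<open>T (T' (mode_op k ?u)) = T (T' (T ?u))\<close> unfolding T_def T'_def
      by (intro kernel_op_triple[OF B cf]) (rule mode_kernel_triple)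
    then have "l2_inner \<nu> (T (coeff (int k) (adjoint_mode k (leray_mode \<gamma> k f)))) (coeff (int k) g)
        = l2_inner \<nu> (\<lambda>x. of_real (leray_C r \<gamma> k) * T ?u x) (coeff (int k) g)"
      by (intro l2_inner_cong_AE T L2_cmult cf cg coeff_L2 adjoint_mode_L2 leray_mode_L2 f) simp_all
    then show ?thesis
      unfolding inner_leray_mode[OF f g] inner_leray_mode[OF adjoint_mode_L2[OF leray_mode_L2[OF f]] g] T_def
      by (simp add: l2_inner_cmult_left)
  qed
next
  fix f g j k assume f: "f \<in> L2 \<mu>" and g: "g \<in> L2 \<mu>" and jk: "j \<noteq> (k::nat)"
  have zero: "l2_inner \<nu> u v = 0" if "\<And>x. x \<in> space \<nu> \<Longrightarrow> v x = 0" for u v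
    using l2_inner_cong_space[of \<nu> u u v "\<lambda>x. 0"] that by simp
  show "l2_inner \<mu> (leray_mode \<gamma> j f) (leray_mode \<gamma> k g) = 0"
    unfolding inner_leray_mode[OF f leray_mode_L2[OF g]]
    by (simp add: zero coeff_leray_mode[OF g] jk)
  show "l2_inner \<mu> (adjoint_mode j f) (adjoint_mode k g) = 0"
    unfolding inner_adjoint_mode[OF f adjoint_mode_L2[OF g]]
    by (simp add: zero coeff_adjoint_mode jk)
  show "l2_inner \<mu> (leray_mode \<gamma> j f) (adjoint_mode k g) = 0"
    unfolding inner_leray_mode[OF f adjoint_mode_L2[OF g]]
    by (simp add: zero coeff_adjoint_mode jk)
next
  fix k
  obtain B where B: "schur_kernel (mode_kernel k) B" using mode_kernel_schur by blast
  define V where "V = test_profile k"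
  have V: "V \<in> borel_measurable borel" "V \<in> L2 \<nu>"
    unfolding V_def by (rule test_profile_borel, rule test_profile_L2)
  define f where "f = lift (int k) V"
  have f: "f \<in> L2 \<mu>" unfolding f_def by (rule lift_L2[OF V])
  have cV: "coeff (int k) f x = V x" if "x \<in> space \<nu>" for x
    unfolding f_def coeff_lift[OF that] by simp
  have "kernel_op \<nu> (mode_kernel k) (coeff (int k) f) = kernel_op \<nu> (mode_kernel k) V"
    by (rule kernel_op_cong_space[OF cV])
  then have "l2_inner \<nu> (kernel_op \<nu> (mode_kernel k) (coeff (int k) f)) (coeff (int k) f)
      = l2_inner \<nu> (kernel_op \<nu> (mode_kernel k) V) V"
    using cV by (intro l2_inner_cong_space) auto
  also have "\<dots> = l2_inner \<nu> V V"
    using test_profile_fixed[of k] unfolding V_def[symmetric]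
    by (intro l2_inner_cong_AE kernel_op_L2[OF B] V) simp_all
  finally have "l2_inner \<mu> (leray_mode \<gamma> k f) f = 2 * of_real pi * of_real ((l2_norm \<nu> V)\<^sup>2)"
    unfolding inner_leray_mode[OF f f] by (simp add: l2_inner_self)
  moreover have "l2_norm \<nu> V \<noteq> 0" unfolding V_def by (rule l2_norm_test_profile)
  ultimately have "l2_inner \<mu> (leray_mode \<gamma> k f) f \<noteq> 0" by simp
  then show "\<exists>f\<in>L2 \<mu>. l2_inner \<mu> (leray_mode \<gamma> k f) f \<noteq> 0" using f by blast
next
  define V where "V = test_profile 0"
  have V: "V \<in> borel_measurable borel" "V \<in> L2 \<nu>"
    unfolding V_def by (rule test_profile_borel, rule test_profile_L2)
  define f where "f = lift (- 1) V"
  have f: "f \<in> L2 \<mu>" unfolding f_def by (rule lift_L2[OF V])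
  have cf: "coeff (int k) f x = 0" if "x \<in> space \<nu>" for k x
    unfolding f_def coeff_lift[OF that] by simp
  have c1: "coeff (- 1) f x = V x" if "x \<in> space \<nu>" for x
    unfolding f_def coeff_lift[OF that] by simp
  have "l2_inner \<mu> f f = 2 * of_real pi * l2_inner \<nu> V V"
    using inner_lift[OF V f, of "- 1"] l2_inner_cong_space[of \<nu> V V "coeff (- 1) f" V] c1
    unfolding f_def by simp
  then have "l2_inner \<mu> f f \<noteq> 0"
    using l2_norm_test_profile[of 0] by (simp add: l2_inner_self V_def)
  then have "\<not> (AE x in \<mu>. f x = 0)"
    using l2_norm_eq_0_iff[OF f] by (auto simp: l2_inner_self)
  moreover have "l2_inner \<mu> (leray_mode \<gamma> k f) h = 0 \<and> l2_inner \<mu> (adjoint_mode k f) h = 0" if h: "h \<in> L2 \<mu>" for k h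
  proof -
    have "kernel_op \<nu> K' (coeff (int k) f) = (\<lambda>x. 0)" for K'
    proof -
      have "kernel_op \<nu> K' (coeff (int k) f) = kernel_op \<nu> K' (\<lambda>x. 0)"
        by (rule kernel_op_cong_space[OF cf])
      then show ?thesis by (simp add: kernel_op_def fun_eq_iff)
    qed
    then show ?thesis
      unfolding inner_leray_mode[OF f h] inner_adjoint_mode[OF f h] by simp
  qed
  ultimately show "\<exists>f\<in>L2 \<mu>. \<not> (AE x in \<mu>. f x = 0) \<and>
      (\<forall>k. \<forall>h\<in>L2 \<mu>. l2_inner \<mu> (leray_mode \<gamma> k f) h = 0 \<and> l2_inner \<mu> (adjoint_mode k f) h = 0)"
    using f by blast
qed (use leray_mode_L2 adjoint_mode_L2 K in auto)

end

theorem theorem1p9: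
  fixes \<gamma> r :: real
  assumes "\<gamma> > 1" and "r \<in> {-1<..<2 * \<gamma> - 1}"
  shows "let A = leray_skew \<gamma> r;
             S = {0} \<union> (\<Union>k. {\<i> * of_real (sqrt (leray_C r \<gamma> k - 1)),
                            - \<i> * of_real (sqrt (leray_C r \<gamma> k - 1))}) :: complex set
         in (\<exists>E. l2_orthogonal_basis (mu \<gamma> r) E \<and>
                 (\<forall>e\<in>E. \<exists>c. l2_eigenfunction (mu \<gamma> r) A c e))
            \<and> l2_point_spectrum (mu \<gamma> r) A = S
            \<and> l2_spectrum (mu \<gamma> r) A = closure S"
proof -
  have r: "-1 < r" "r < 2 * \<gamma> - 1" using assms(2) by auto
  interpret leray_parameters \<gamma> r by unfold_locales (use assms(1) r in auto)
  obtain K where "\<And>k. leray_C r \<gamma> k \<le> K" using leray_C_bounded[OF assms(1) r] by blast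
  then interpret O: oblique_projections "mu \<gamma> r" "leray_mode \<gamma>" adjoint_mode "leray_C r \<gamma>" K
    by (rule leray_modes_oblique_projections)
  have L: "leray \<gamma> r = O.L" by (intro ext) (simp add: leray_def O.L_def)
  have A: "leray_skew \<gamma> r = O.A" by (intro ext) (simp add: leray_skew_def O.A_def L)
  have S: "{0} \<union> (\<Union>k. {\<i> * of_real (sqrt (leray_C r \<gamma> k - 1)), - \<i> * of_real (sqrt (leray_C r \<gamma> k - 1))}) = O.S"
    by (simp add: O.S_def O.l_def)
  show ?thesis
    unfolding Let_def A S using O.eigenfunction_basis O.point_spectrum O.spectrum by blast
qed

end
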